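(* Let $G$ be a countably infinite amenable group and let $\mathcal{F} = (F_n)_{n = 1}^\infty$ be a left-Følner sequence in $G$. A set $V \subseteq G$ is an $\mathcal{F}$-vdC set if and only if for any measure preserving system $(X,\mathscr{B},\mu,(\tau_g)_{g \in G})$ and any measurable $f:X\rightarrow\mathbb{S}^1$ satisfying $\langle \tau_vf,f\rangle = 0$ for all $v \in V$, we have $\int_Xf\,d\mu = 0$.
   Context: $\mathbb{S}^1=\{z\in\mathbb{C} : |z|=1\}$. A left-Følner sequence in a countable group $G$ is a sequence of finite nonempty sets $F_n\subseteq G$ with $\lim_{n\to\infty}|F_n\triangle gF_n|/|F_n|=0$ for all $g\in G$; $G$ is amenable if it has one. $\mathcal{F}$-vdC set: a set $V\subseteq G$ such that for any $(c_g)_{g\in G}\subseteq\mathbb{S}^1$ satisfying $\lim_{n\to\infty}\frac{1}{|F_n|}\sum_{g\in F_n}c_{vg}\overline{c_g}=0$ for all $v\in V$, we have $\lim_{n\to\infty}\frac{1}{|F_n|}\sum_{g\in F_n}c_g=0$. A measure preserving system $(X,\mathscr{B},\mu,(\tau_g)_{g\in G})$ is a probability space $(X,\mathscr{B},\mu)$ with a measurable action $\tau$ of $G$ on $X$ satisfying $\mu(\tau_gA)=\mu(A)$ for all $g\in G$, $A\in\mathscr{B}$. For a function $f$ on $X$, $\tau_gf:=f\circ\tau_g$, and $\langle f_1,f_2\rangle=\int_Xf_1\overline{f_2}\,d\mu$. *)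

theory Defs
  imports "HOL-Probability.Probability" "HOL-Algebra.Algebra"
begin

text \<open>Sequences are indexed from 0, so \<open>F 0\<close> is the first set of the sequence.\<close>

definition left_Folner_seq :: "('g, 'b) monoid_scheme \<Rightarrow> (nat \<Rightarrow> 'g set) \<Rightarrow> bool" where
  "left_Folner_seq G F \<longleftrightarrow>
     (\<forall>n. finite (F n) \<and> F n \<noteq> {} \<and> F n \<subseteq> carrier G) \<and>
     (\<forall>g\<in>carrier G.
        (\<lambda>n. real (card (sym_diff (F n) (g <#\<^bsub>G\<^esub> F n))) / real (card (F n))) \<longlonglongrightarrow> 0)"

definition amenable :: "('g, 'b) monoid_scheme \<Rightarrow> bool" where
  "amenable G \<longleftrightarrow> (\<exists>F. left_Folner_seq G F)"

definition vdC_set :: "('g, 'b) monoid_scheme \<Rightarrow> (nat \<Rightarrow> 'g set) \<Rightarrow> 'g set \<Rightarrow> bool" where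
  "vdC_set G F V \<longleftrightarrow> V \<subseteq> carrier G \<and>
     (\<forall>c :: 'g \<Rightarrow> complex.
        (\<forall>g\<in>carrier G. c g \<in> sphere 0 1) \<longrightarrow>
        (\<forall>v\<in>V. (\<lambda>n. (\<Sum>g\<in>F n. c (v \<otimes>\<^bsub>G\<^esub> g) * cnj (c g)) / of_nat (card (F n)))
                  \<longlonglongrightarrow> 0) \<longrightarrow>
        (\<lambda>n. (\<Sum>g\<in>F n. c g) / of_nat (card (F n))) \<longlonglongrightarrow> 0)"

text \<open>
  A left action of \<open>G\<close> by measurable maps. Each \<open>\<tau> g\<close> is
  a function on \<open>space M\<close> extended by \<open>undefined\<close>, i.e. a member of \<open>extensional (space M)\<close>.
\<close>

locale measure_preserving_system =
  prob_space M + group_action G "space M" \<tau>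
  for G :: "('g, 'b) monoid_scheme" and M :: "'x measure" and \<tau> :: "'g \<Rightarrow> 'x \<Rightarrow> 'x" +
  assumes measurable_action: "g \<in> carrier G \<Longrightarrow> \<tau> g \<in> measurable M M"
    and measure_preserving:
      "\<lbrakk>g \<in> carrier G; A \<in> sets M\<rbrakk> \<Longrightarrow> emeasure M (\<tau> g ` A) = emeasure M A"

definition L2_inner :: "'x measure \<Rightarrow> ('x \<Rightarrow> complex) \<Rightarrow> ('x \<Rightarrow> complex) \<Rightarrow> complex" where
  "L2_inner M f1 f2 = (\<integral>x. f1 x * cnj (f2 x) \<partial>M)"

text \<open>
  The condition quantifies over all measure preserving systems. HOL cannot quantify over types
  inside a formula, so the type \<open>'x\<close> of the points is a parameter; the space itself is
  an arbitrary set of such points, carrying an arbitrary sigma-algebra. The type must not be too small (on a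
  one-point space the condition degenerates); \<open>'g \<Rightarrow> complex\<close> has room for the shift systems on
  functions from \<open>G\<close> to the unit circle.
\<close>

definition mps_vdC_condition ::
    "'x itself \<Rightarrow> ('g, 'b) monoid_scheme \<Rightarrow> 'g set \<Rightarrow> bool" where
  "mps_vdC_condition _ G V \<longleftrightarrow>
     (\<forall>(M :: 'x measure) \<tau> f.
        measure_preserving_system G M \<tau> \<longrightarrow>
        f \<in> measurable M (restrict_space borel (sphere (0 :: complex) 1)) \<longrightarrow>
        (\<forall>v\<in>V. L2_inner M (f \<circ> \<tau> v) f = 0) \<longrightarrow>
        (\<integral>x. f x \<partial>M) = 0)"

end

theory Submission
  imports Defs "HOL-Real_Asymp.Real_Asymp" "HOL-Complex_Analysis.Great_Picard"
begin

text \<open>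
  Both implications transfer information between a function on \<open>G\<close>, seen through its averages
  along \<open>F\<close>, and a circle-valued function \<open>f\<close> on a measure preserving system.

  From sequences to systems. Let \<open>V\<close> be a vdC set and let \<open>f\<close> be orthogonal to \<open>f \<circ> \<tau> v\<close> for
  \<open>v \<in> V\<close>. It suffices to find \<open>c\<close> from \<open>G\<close> to the circle whose averages along \<open>F\<close> converge to
  \<open>\<integral>f\<close> while the averages of \<open>c (vg) * cnj (c g)\<close> converge to \<open>0\<close>: the vdC property then forces
  \<open>\<integral>f = 0\<close>. There is no pointwise ergodic theorem along an arbitrary Folner sequence, so \<open>c\<close>
  cannot be read off a single orbit. It is patched together from many independent orbits. Attach
  to every \<open>h \<in> G\<close> an independent label: a uniform number in \<open>[0,1]\<close> and a random point \<open>x h\<close>.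
  Fix a finite \<open>T\<close> that is almost invariant under right translations, let the cell of \<open>g\<close> be the
  point of \<open>Tg\<close> with the smallest number, and put \<open>c g = f (\<tau> g (x h))\<close> for \<open>h\<close> the cell of \<open>g\<close>.
  The sets \<open>Tg\<close> and \<open>Tvg\<close> are nearly equal, so \<open>g\<close> and \<open>vg\<close> usually share their cell
  (\<open>prob_cell_neq\<close>), and then \<open>c (vg) * cnj (c g)\<close> has mean \<open>\<langle>f \<circ> \<tau> v, f\<rangle>\<close>. So at every single
  \<open>g\<close> the expectations are almost the desired ones (\<open>cell_field_expectation\<close>).

  Since \<open>c g\<close> depends on labels near \<open>g\<close> only, averages over \<open>Wg\<close>, with \<open>W\<close> a finite set of
  widely separated points, concentrate exponentially fast in \<open>card W\<close>, whereas the number of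
  other windows \<open>Wh\<close> that interact with \<open>Wg\<close> is only quadratic in \<open>card W\<close>. Hence the Lovasz
  local lemma gives an outcome for which all windows are good at the same time
  (\<open>window_concentration\<close>). This uniformity is what makes every Folner sequence work: the average
  of a bounded function over \<open>F n\<close> is almost the average over \<open>F n\<close> of its window averages.

  So far the averages are only within some \<open>\<epsilon>\<close> of their targets. To let \<open>\<epsilon>\<close> tend to \<open>0\<close>, the same
  random cells are used to interpolate: a cell whose centre lies in a finite set \<open>A\<close> keeps an older
  sequence \<open>c'\<close>, the others use fresh random points. The probability \<open>s g\<close> that the cell of \<open>g\<close> lies
  in \<open>A\<close> varies slowly with \<open>g\<close>, so the transition zone does not spoil window averages, no
  matter how \<open>F n\<close> meets it (\<open>interpolating_sequences_exist\<close>, \<open>refinement_step\<close>). Repeating this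
  along an exhausting sequence of finite sets gives \<open>uniform_sequence_exists\<close>.

  From systems to sequences. If \<open>c\<close> satisfies the correlation hypothesis but its averages do not
  tend to \<open>0\<close>, pass to a subsequence of \<open>F\<close> along which they stay away from \<open>0\<close> and along which all
  finite patterns of (roundings of) the translates of \<open>c\<close> have limiting frequencies. By
  Kolmogorov's theorem the frequencies define a probability measure on functions from \<open>G\<close> to the
  circle; it is invariant under right translation because \<open>F\<close> is left Folner, and the evaluation at
  the neutral element is a function \<open>f\<close> with the correlations and the mean of \<open>c\<close>
  (\<open>Furstenberg_correspondence\<close>). This contradicts the condition on systems.
\<close>

section \<open>Independence and the Lovasz local lemma\<close>

text \<open>
  The induction bounds the conditional probability of one bad event, given that the events in \<open>S\<close>
  fail, by \<open>2 * p\<close>. Of the conditions in \<open>S\<close>, those outside the neighbourhood \<open>\<Gamma> i\<close> are independent of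
  \<open>A i\<close>, and the at most \<open>d\<close> others fail together with conditional probability at least
  \<open>1 - 2 * p * d \<ge> 1 / 2\<close>, so conditioning on them costs at most a factor of two.
\<close>

lemma (in prob_space) local_lemma_symmetric:
  fixes A :: "'i \<Rightarrow> 'a set" and \<Gamma> :: "'i \<Rightarrow> 'i set" and d :: nat
  assumes D: "finite D" and ev: "\<And>i. i \<in> D \<Longrightarrow> A i \<in> events"
    and small: "\<And>i. i \<in> D \<Longrightarrow> prob (A i) \<le> p"
    and deg: "\<And>i. i \<in> D \<Longrightarrow> card (\<Gamma> i \<inter> D) \<le> d"
    and self: "\<And>i. i \<in> D \<Longrightarrow> i \<in> \<Gamma> i"
    and pd: "4 * p * real d \<le> 1"
    and indep: "\<And>i S. i \<in> D \<Longrightarrow> S \<subseteq> D \<Longrightarrow> S \<inter> \<Gamma> i = {} \<Longrightarrow>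
        prob (A i \<inter> (space M - \<Union>(A ` S))) = prob (A i) * prob (space M - \<Union>(A ` S))"
  shows "prob (space M - \<Union>(A ` D)) > 0"
proof (cases "D = {}")
  case True
  then show ?thesis by (simp add: prob_space)
next
  case False
  then obtain i0 where i0: "i0 \<in> D" by auto
  have p0: "0 \<le> p" using small[OF i0] measure_nonneg[of M "A i0"] by linarith
  have d1: "d \<ge> 1"
  proof -
    have "card (\<Gamma> i0 \<inter> D) > 0" using self[OF i0] i0 D by (auto simp: card_gt_0_iff)
    then show ?thesis using deg[OF i0] by linarith
  qed
  define N where "N S = space M - \<Union>(A ` S)" for S
  have NE: "N S \<in> events" if "S \<subseteq> D" for S
    unfolding N_def using that D ev by (intro sets.Diff sets.top sets.finite_UN) (auto intro: finite_subset)
  have cond: "prob (A i \<inter> N S) \<le> 2 * p * prob (N S)" if "S \<subseteq> D" "i \<in> D" "i \<notin> S" for S i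
    using that
  proof (induction "card S" arbitrary: S i rule: less_induct)
    case less
    define S1 where "S1 = S \<inter> \<Gamma> i"
    define S2 where "S2 = S - \<Gamma> i"
    have finS: "finite S" using less.prems D finite_subset by auto
    have S2D: "S2 \<subseteq> D" and S1D: "S1 \<subseteq> D" using less.prems by (auto simp: S1_def S2_def)
    have NS: "N S \<subseteq> N S2" by (auto simp: N_def S2_def)
    have "prob (A i \<inter> N S) \<le> prob (A i \<inter> N S2)"
      using NS less.prems ev NE[OF S2D] by (intro finite_measure_mono) auto
    also have "\<dots> = prob (A i) * prob (N S2)"
      unfolding N_def using less.prems S2D by (intro indep) (auto simp: S2_def)
    also have "\<dots> \<le> p * prob (N S2)"
      using small less.prems by (intro mult_right_mono) auto
    finally have up: "prob (A i \<inter> N S) \<le> p * prob (N S2)" .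
    have low: "prob (N S2) \<le> 2 * prob (N S)"
    proof (cases "S1 = {}")
      case True
      then have "S2 = S" by (auto simp: S1_def S2_def)
      then show ?thesis by simp
    next
      case False
      have lt: "card S2 < card S"
        using False finS by (intro psubset_card_mono) (auto simp: S1_def S2_def)
      have each: "prob (A j \<inter> N S2) \<le> 2 * p * prob (N S2)" if "j \<in> S1" for j
        using less.hyps[OF lt S2D, of j] that S1D by (auto simp: S1_def S2_def)
      have sub: "N S2 \<subseteq> N S \<union> (\<Union>j\<in>S1. A j \<inter> N S2)"
        by (auto simp: N_def S1_def S2_def)
      have fin1: "finite S1" using finS by (simp add: S1_def)
      have "prob (N S2) \<le> prob (N S \<union> (\<Union>j\<in>S1. A j \<inter> N S2))"
        using sub NE[OF S2D] NE[OF less.prems(1)] ev S1D fin1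
        by (intro finite_measure_mono) (auto intro!: sets.Un sets.finite_UN)
      also have "\<dots> \<le> prob (N S) + prob (\<Union>j\<in>S1. A j \<inter> N S2)"
        using NE[OF S2D] NE[OF less.prems(1)] ev S1D fin1
        by (intro measure_Un_le) (auto intro!: sets.finite_UN)
      also have "prob (\<Union>j\<in>S1. A j \<inter> N S2) \<le> (\<Sum>j\<in>S1. prob (A j \<inter> N S2))"
        using NE[OF S2D] ev S1D fin1 by (intro finite_measure_subadditive_finite) auto
      also have "\<dots> \<le> (\<Sum>j\<in>S1. 2 * p * prob (N S2))"
        using each by (rule sum_mono)
      also have "\<dots> = 2 * p * real (card S1) * prob (N S2)" by simp
      also have "\<dots> \<le> 2 * p * real d * prob (N S2)"
      proof -
        have "card S1 \<le> card (\<Gamma> i \<inter> D)"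
          using D less.prems by (intro card_mono) (auto simp: S1_def)
        then have "card S1 \<le> d" using deg less.prems(2) by (meson le_trans)
        then show ?thesis using p0 by (intro mult_right_mono mult_left_mono) auto
      qed
      also have "\<dots> \<le> 1 / 2 * prob (N S2)"
        using pd by (intro mult_right_mono) auto
      finally show ?thesis by simp
    qed
    show ?case using up mult_left_mono[OF low p0] by simp
  qed
  have p4: "p \<le> 1 / 4"
  proof -
    have "p * 1 \<le> p * real d" using d1 p0 by (intro mult_left_mono) auto
    then show ?thesis using pd by linarith
  qed
  have "prob (N S) > 0" if "S \<subseteq> D" for S
    using finite_subset[OF that D] that
  proof (induction S rule: finite_induct)
    case empty
    then show ?case by (simp add: N_def prob_space)
  next
    case (insert i S)
    have eq: "N (insert i S) = N S - A i \<inter> N S" by (auto simp: N_def)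
    have "prob (N (insert i S)) = prob (N S) - prob (A i \<inter> N S)"
      unfolding eq using insert.prems ev NE by (intro finite_measure_Diff) auto
    moreover have "prob (A i \<inter> N S) \<le> 2 * p * prob (N S)"
      using cond insert by auto
    moreover have "2 * p * prob (N S) \<le> 1 / 2 * prob (N S)"
      using p4 by (intro mult_right_mono) auto
    moreover have "prob (N S) > 0" using insert by auto
    ultimately show ?case by linarith
  qed
  then show ?thesis by (simp add: N_def)
qed

text \<open>
  Each \<open>Y j\<close> factors through the restriction of \<open>\<omega>\<close> to \<open>K j\<close>, because the remaining coordinates may
  be replaced by a fixed point; restrictions to disjoint sets of coordinates are independent.
\<close>

lemma PiM_indep_vars_disjoint_support:
  fixes N :: "'y measure" and Y :: "'j \<Rightarrow> ('i \<Rightarrow> 'y) \<Rightarrow> real"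
  assumes N: "prob_space N"
    and Y: "\<And>j. j \<in> L \<Longrightarrow> Y j \<in> borel_measurable (PiM I (\<lambda>_. N))"
    and K: "\<And>j. j \<in> L \<Longrightarrow> K j \<subseteq> I" "disjoint_family_on K L"
    and dep: "\<And>j \<omega> \<omega>'. j \<in> L \<Longrightarrow> \<omega> \<in> space (PiM I (\<lambda>_. N)) \<Longrightarrow> \<omega>' \<in> space (PiM I (\<lambda>_. N)) \<Longrightarrow>
        (\<And>i. i \<in> K j \<Longrightarrow> \<omega> i = \<omega>' i) \<Longrightarrow> Y j \<omega> = Y j \<omega>'"
  shows "prob_space.indep_vars (PiM I (\<lambda>_. N)) (\<lambda>_. borel) Y L"
proof -
  let ?P = "PiM I (\<lambda>_. N)"
  interpret N: prob_space N by fact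
  interpret P: prob_space ?P using N by (intro prob_space_PiM)
  obtain y where y: "y \<in> space N" using N.not_empty by auto
  have "P.indep_vars (\<lambda>_. N) (\<lambda>i \<omega>. \<omega> i) I"
  proof (cases "I = {}")
    case True
    show ?thesis unfolding True by (simp add: prob_space.indep_vars_def2[OF prob_space_PiM] prob_space.indep_sets_def[OF prob_space_PiM] N)
  next
    case False
    have "distr ?P ?P (\<lambda>\<omega>. \<lambda>i\<in>I. \<omega> i) = distr ?P ?P (\<lambda>\<omega>. \<omega>)"
      by (intro distr_cong) (auto simp: space_PiM PiE_def extensional_restrict)
    also have "\<dots> = ?P" by (rule distr_id)
    also have "\<dots> = (\<Pi>\<^sub>M i\<in>I. distr ?P N (\<lambda>\<omega>. \<omega> i))"
      using N by (intro PiM_cong refl distr_PiM_component[symmetric])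
    finally show ?thesis
      using False by (subst P.indep_vars_iff_distr_eq_PiM') auto
  qed
  from P.indep_vars_restrict[OF this, where K = K and L = L] K
  have ind: "P.indep_vars (\<lambda>j. PiM (K j) (\<lambda>_. N)) (\<lambda>j \<omega>. \<lambda>i\<in>K j. \<omega> i) L" by auto
  define ex where "ex j \<eta> = (\<lambda>i\<in>I. if i \<in> K j then \<eta> i else y)" for j and \<eta> :: "'i \<Rightarrow> 'y"
  have exm: "ex j \<in> measurable (PiM (K j) (\<lambda>_. N)) ?P" if "j \<in> L" for j
    unfolding ex_def
  proof (intro measurable_restrict)
    fix i assume "i \<in> I"
    show "(\<lambda>x. if i \<in> K j then x i else y) \<in> measurable (PiM (K j) (\<lambda>_. N)) N"
      using y by (cases "i \<in> K j") auto
  qed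
  have "P.indep_vars (\<lambda>_. borel) (\<lambda>j \<omega>. (Y j \<circ> ex j) (\<lambda>i\<in>K j. \<omega> i)) L"
    proof (rule P.indep_vars_compose2[OF ind])
    show "Y j \<circ> ex j \<in> borel_measurable (PiM (K j) (\<lambda>_. N))" if "j \<in> L" for j
      by (rule measurable_comp[OF exm[OF that] Y[OF that]])
  qed
  then have Z: "P.indep_vars (\<lambda>_. borel) (\<lambda>j \<omega>. Y j (ex j (\<lambda>i\<in>K j. \<omega> i))) L" by simp
  have "Y j (ex j (\<lambda>i\<in>K j. \<omega> i)) = Y j \<omega>" if "j \<in> L" "\<omega> \<in> space ?P" for j \<omega>
    using that K(1)[OF that(1)] y
    by (intro dep) (auto simp: ex_def space_PiM PiE_iff subset_iff)
  then have "(\<lambda>\<omega>. Y j (ex j (\<lambda>i\<in>K j. \<omega> i))) -` A \<inter> space ?P = Y j -` A \<inter> space ?P" if "j \<in> L" for j A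
    using that by auto
  then have "P.indep_sets (\<lambda>j. {(\<lambda>\<omega>. Y j (ex j (\<lambda>i\<in>K j. \<omega> i))) -` A \<inter> space ?P |A. A \<in> sets borel}) L
      \<longleftrightarrow> P.indep_sets (\<lambda>j. {Y j -` A \<inter> space ?P |A. A \<in> sets borel}) L"
    by (intro P.indep_sets_cong) auto
  with Z show ?thesis unfolding P.indep_vars_def2 using Y by blast
qed

section \<open>Simultaneous concentration of window averages\<close>

definition depends_on :: "('i \<Rightarrow> 'y) set \<Rightarrow> 'i set \<Rightarrow> (('i \<Rightarrow> 'y) \<Rightarrow> 'r) \<Rightarrow> bool" where
  "depends_on S J f \<longleftrightarrow> (\<forall>\<omega>\<in>S. \<forall>\<omega>'\<in>S. (\<forall>i\<in>J. \<omega> i = \<omega>' i) \<longrightarrow> f \<omega> = f \<omega>')"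

lemma PiM_prob_disjoint_support:
  assumes N: "prob_space N" and A: "A \<in> sets (PiM I (\<lambda>_. N))" and B: "B \<in> sets (PiM I (\<lambda>_. N))"
    and J: "J \<subseteq> I" "J' \<subseteq> I" "J \<inter> J' = {}"
    and dA: "depends_on (space (PiM I (\<lambda>_. N))) J (\<lambda>\<omega>. \<omega> \<in> A)"
    and dB: "depends_on (space (PiM I (\<lambda>_. N))) J' (\<lambda>\<omega>. \<omega> \<in> B)"
  shows "measure (PiM I (\<lambda>_. N)) (A \<inter> B) = measure (PiM I (\<lambda>_. N)) A * measure (PiM I (\<lambda>_. N)) B"
proof -
  let ?P = "PiM I (\<lambda>_. N)"
  interpret P: prob_space ?P using N by (intro prob_space_PiM)
  define Y :: "bool \<Rightarrow> ('b \<Rightarrow> 'a) \<Rightarrow> real" where "Y c = (if c then indicator A else indicator B)" for c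
  have "P.indep_vars (\<lambda>_. borel) Y UNIV"
  proof (rule PiM_indep_vars_disjoint_support[OF N, where K = "\<lambda>c. if c then J else J'"])
    show "Y j \<in> borel_measurable ?P" for j using A B by (auto simp: Y_def)
    show "disjoint_family_on (\<lambda>c. if c then J else J') UNIV"
      using J by (auto simp: disjoint_family_on_def)
  next
    fix j \<omega> \<omega>'
    assume s: "\<omega> \<in> space ?P" "\<omega>' \<in> space ?P" and e: "\<And>i. i \<in> (if j then J else J') \<Longrightarrow> \<omega> i = \<omega>' i"
    show "Y j \<omega> = Y j \<omega>'"
      using dA[unfolded depends_on_def, rule_format, OF s] dB[unfolded depends_on_def, rule_format, OF s] e
      by (cases j) (auto simp: Y_def indicator_def)
  qed (use J in auto)
  from P.indep_varsD_finite[OF this, of "\<lambda>_. {1}"]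
  have "P.prob (\<Inter>c\<in>UNIV. Y c -` {1} \<inter> space ?P) = (\<Prod>c\<in>UNIV. P.prob (Y c -` {1} \<inter> space ?P))"
    by simp
  moreover have "Y True -` {1} \<inter> space ?P = A" "Y False -` {1} \<inter> space ?P = B"
    using sets.sets_into_space[OF A] sets.sets_into_space[OF B] by (auto simp: Y_def indicator_def split: if_splits)
  moreover have "(\<Inter>c\<in>UNIV. Y c -` {1} \<inter> space ?P) = (Y True -` {1} \<inter> space ?P) \<inter> (Y False -` {1} \<inter> space ?P)"
    by (auto simp: UNIV_bool)
  ultimately show ?thesis by (simp add: UNIV_bool mult.commute)
qed

text \<open>
  A new point has to avoid only the finitely many \<open>k\<inverse>k'w\<close>, so a greedy choice succeeds.
\<close>

lemma (in group) sparse_set_exists: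
  assumes inf: "infinite (carrier G)" and K: "finite K" "K \<subseteq> carrier G"
  shows "\<exists>W. finite W \<and> W \<subseteq> carrier G \<and> card W = m \<and>
           (\<forall>w\<in>W. \<forall>w'\<in>W. w \<noteq> w' \<longrightarrow> (K #> w) \<inter> (K #> w') = {})"
proof (induction m)
  case 0
  show ?case by (rule exI[of _ "{}"]) simp
next
  case (Suc m)
  then obtain W where W: "finite W" "W \<subseteq> carrier G" "card W = m"
    and dis: "\<And>w w'. w \<in> W \<Longrightarrow> w' \<in> W \<Longrightarrow> w \<noteq> w' \<Longrightarrow> (K #> w) \<inter> (K #> w') = {}" by blast
  define B where "B = W \<union> (\<lambda>(k, k', w). inv k \<otimes> (k' \<otimes> w)) ` (K \<times> K \<times> W)"
  have "finite B" using K W by (auto simp: B_def)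
  then obtain x where x: "x \<in> carrier G" "x \<notin> B" using inf by (meson finite_subset subsetI)
  have disx: "(K #> x) \<inter> (K #> w) = {}" if w: "w \<in> W" for w
  proof (rule ccontr)
    assume "(K #> x) \<inter> (K #> w) \<noteq> {}"
    then obtain k k' where k: "k \<in> K" "k' \<in> K" "k \<otimes> x = k' \<otimes> w" by (auto simp: r_coset_def)
    then have "x = inv k \<otimes> (k' \<otimes> w)"
      using x w K W by (metis inv_solve_left m_closed subsetD)
    then have "x \<in> B" using k w by (force simp: B_def)
    then show False using x by simp
  qed
  have xW: "x \<notin> W" using x by (simp add: B_def)
  show ?case
  proof (intro exI[of _ "insert x W"] conjI ballI impI)
    fix w w' assume "w \<in> insert x W" "w' \<in> insert x W" "w \<noteq> w'"
    then show "(K #> w) \<inter> (K #> w') = {}" using dis disx by blast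
  qed (use W xW x in auto)
qed

definition local_family ::
    "('g, 'b) monoid_scheme \<Rightarrow> 'y measure \<Rightarrow> 'g set \<Rightarrow> 'o set \<Rightarrow> ('o \<Rightarrow> 'g \<Rightarrow> ('g \<Rightarrow> 'y) \<Rightarrow> real) \<Rightarrow> bool" where
  "local_family G N K B b \<longleftrightarrow>
     (\<forall>j\<in>B. \<forall>g\<in>carrier G. b j g \<in> borel_measurable (PiM (carrier G) (\<lambda>_. N)) \<and>
        (\<forall>\<omega>\<in>space (PiM (carrier G) (\<lambda>_. N)). \<bar>b j g \<omega>\<bar> \<le> 1) \<and>
        depends_on (space (PiM (carrier G) (\<lambda>_. N))) (K #>\<^bsub>G\<^esub> g) (b j g))"

text \<open>
  Let \<open>b j g\<close> be random variables that depend only on the labels in \<open>Kg\<close>. For a window \<open>W\<close> with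
  disjoint translates \<open>Kw\<close>, Hoeffding's inequality bounds the probability that the sum over \<open>Wg\<close>
  deviates from its mean by a term exponentially small in \<open>card W\<close>. Two windows interact only if \<open>KWg\<close>
  and \<open>KWh\<close> meet, which for fixed \<open>g\<close> happens for at most \<open>(card K * card W)\<^sup>2\<close> many \<open>h\<close>, so the local
  lemma applies once \<open>W\<close> is large. The window is chosen before the variables: it depends only on \<open>K\<close>, on
  \<open>e\<close> and on the number \<open>p\<close> of families, and this order of quantifiers is essential for the
  interpolation argument below.
\<close>

lemma (in group) window_concentration:
  fixes e :: real and p :: nat
  assumes inf: "infinite (carrier G)" and K: "finite K" "K \<subseteq> carrier G" and e: "e > 0"
  shows "\<exists>W. finite W \<and> W \<noteq> {} \<and> W \<subseteq> carrier G \<and>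
    (\<forall>(N :: 'y measure) (B :: 'o set) b D. prob_space N \<longrightarrow> finite B \<longrightarrow> card B \<le> p \<longrightarrow>
       finite D \<longrightarrow> D \<subseteq> carrier G \<longrightarrow>
       local_family G N K B b \<longrightarrow>
       (\<exists>\<omega>\<in>space (PiM (carrier G) (\<lambda>_. N)). \<forall>g\<in>D. \<forall>j\<in>B.
          \<bar>\<Sum>w\<in>W. b j (w \<otimes> g) \<omega> - integral\<^sup>L (PiM (carrier G) (\<lambda>_. N)) (b j (w \<otimes> g))\<bar> \<le> e * card W))"
proof -
  have "(\<lambda>m::nat. 4 * (real p * (2 * exp (- (e\<^sup>2 * real m) / 2))) * ((real (card K) * real m)\<^sup>2 + 1)) \<longlonglongrightarrow> 0"
  proof -
    have 1: "(\<lambda>m::nat. exp (- (e\<^sup>2 * real m) / 2)) \<longlonglongrightarrow> 0" using e by real_asymp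
    have 2: "(\<lambda>m::nat. (real m)\<^sup>2 * exp (- (e\<^sup>2 * real m) / 2)) \<longlonglongrightarrow> 0" using e by real_asymp
    have "(\<lambda>m::nat. 8 * real p * (real (card K))\<^sup>2 * ((real m)\<^sup>2 * exp (- (e\<^sup>2 * real m) / 2))
        + 8 * real p * exp (- (e\<^sup>2 * real m) / 2)) \<longlonglongrightarrow> 8 * real p * (real (card K))\<^sup>2 * 0 + 8 * real p * 0"
      by (intro tendsto_intros 1 2)
    then show ?thesis by (simp add: algebra_simps power_mult_distrib)
  qed
  then have "eventually (\<lambda>m::nat. 4 * (real p * (2 * exp (- (e\<^sup>2 * real m) / 2))) * ((real (card K) * real m)\<^sup>2 + 1) < 1) sequentially"
    by (rule order_tendstoD) simp
  then have "eventually (\<lambda>m::nat. m \<ge> 1 \<and> 4 * (real p * (2 * exp (- (e\<^sup>2 * real m) / 2))) * ((real (card K) * real m)\<^sup>2 + 1) < 1) sequentially"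
    using eventually_ge_at_top[of "1::nat"] by eventually_elim auto
  \<comment> \<open>The size of the window is fixed by the condition of the local lemma.\<close>
  then obtain m :: nat where m1: "m \<ge> 1"
    and m: "4 * (real p * (2 * exp (- (e\<^sup>2 * real m) / 2))) * ((real (card K) * real m)\<^sup>2 + 1) < 1"
    by (auto simp: eventually_sequentially)
  obtain W where W: "finite W" "W \<subseteq> carrier G" "card W = m"
    and dis: "\<And>w w'. w \<in> W \<Longrightarrow> w' \<in> W \<Longrightarrow> w \<noteq> w' \<Longrightarrow> (K #> w) \<inter> (K #> w') = {}"
    using sparse_set_exists[OF inf K, of m] by (elim exE conjE) (rule that, assumption+, blast)
  have Wne: "W \<noteq> {}" using W m1 by auto
  show ?thesis
  proof (intro exI[of _ W] conjI allI impI)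
    fix N :: "'y measure" and B :: "'o set" and b D
    assume N: "prob_space N" and B: "finite B" "card B \<le> p" and D: "finite D" "D \<subseteq> carrier G"
      and ass: "local_family G N K B b"
    let ?P = "PiM (carrier G) (\<lambda>_. N)"
    interpret P: prob_space ?P using N by (intro prob_space_PiM)
    have meas: "b j g \<in> borel_measurable ?P"
      and bd: "\<omega> \<in> space ?P \<Longrightarrow> \<bar>b j g \<omega>\<bar> \<le> 1"
      and dep: "depends_on (space ?P) (K #> g) (b j g)" if "j \<in> B" "g \<in> carrier G" for j g \<omega>
      using ass that by (auto simp: local_family_def)
    define R where "R j g \<omega> = (\<Sum>w\<in>W. b j (w \<otimes> g) \<omega> - P.expectation (b j (w \<otimes> g)))" for j g \<omega>
    define A where "A g = (\<Union>j\<in>B. {\<omega> \<in> space ?P. \<bar>R j g \<omega>\<bar> > e * m})" for g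
    define S where "S g = (\<Union>w\<in>W. K #> (w \<otimes> g))" for g
    define \<Gamma> where "\<Gamma> g = {h \<in> carrier G. S g \<inter> S h \<noteq> {}} \<union> {g}" for g
    have Scar: "S g \<subseteq> carrier G" if "g \<in> carrier G" for g
      using W K that by (auto simp: S_def r_coset_def)
    have Rm: "R j g \<in> borel_measurable ?P" if "j \<in> B" "g \<in> carrier G" for j g
      unfolding R_def using W that by (intro borel_measurable_sum borel_measurable_diff meas) auto
    have Aev: "A g \<in> P.events" if "g \<in> carrier G" for g
      unfolding A_def using B Rm that by (intro sets.finite_UN) (auto intro!: borel_measurable_less borel_measurable_abs)
    have Rdep: "R j g \<omega> = R j g \<omega>'"
      if "j \<in> B" "g \<in> carrier G" "\<omega> \<in> space ?P" "\<omega>' \<in> space ?P" "\<forall>i\<in>S g. \<omega> i = \<omega>' i" for j g \<omega> \<omega>'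
    proof -
      have "b j (w \<otimes> g) \<omega> = b j (w \<otimes> g) \<omega>'" if w: "w \<in> W" for w
        using dep[OF \<open>j \<in> B\<close>, of "w \<otimes> g"] that \<open>g \<in> carrier G\<close> \<open>\<omega> \<in> space ?P\<close> \<open>\<omega>' \<in> space ?P\<close>
          \<open>\<forall>i\<in>S g. \<omega> i = \<omega>' i\<close> W(2)
        unfolding depends_on_def S_def by blast
      then show ?thesis by (simp add: R_def)
    qed
    have prA: "P.prob (A g) \<le> real p * (2 * exp (- (e\<^sup>2 * real m) / 2))" if g: "g \<in> carrier G" for g
    proof -
      have one: "P.prob {\<omega> \<in> space ?P. \<bar>R j g \<omega>\<bar> > e * m} \<le> 2 * exp (- (e\<^sup>2 * real m) / 2)" if j: "j \<in> B" for j
      proof -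
        have ind: "P.indep_vars (\<lambda>_. borel) (\<lambda>w. b j (w \<otimes> g)) W"
        proof (rule PiM_indep_vars_disjoint_support[OF N, where K = "\<lambda>w. K #> (w \<otimes> g)"])
          show "disjoint_family_on (\<lambda>w. K #> (w \<otimes> g)) W"
            unfolding disjoint_family_on_def
          proof (intro ballI impI)
            fix w w' assume w: "w \<in> W" "w' \<in> W" "w \<noteq> w'"
            then have "(K #> w) \<inter> (K #> w') = {}" by (rule dis)
            then have "((K #> w) #> g) \<inter> ((K #> w') #> g) = {}"
              using g w W K by (auto simp: r_coset_def subset_iff)
            then show "(K #> (w \<otimes> g)) \<inter> (K #> (w' \<otimes> g)) = {}"
              using coset_mult_assoc[OF K(2)] g w W by (auto simp: subset_iff)
          qed
        next
          fix w \<omega> \<omega>' assume "w \<in> W" "\<omega> \<in> space ?P" "\<omega>' \<in> space ?P" "\<And>i. i \<in> K #> (w \<otimes> g) \<Longrightarrow> \<omega> i = \<omega>' i"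
          then show "b j (w \<otimes> g) \<omega> = b j (w \<otimes> g) \<omega>'"
            using dep[OF j, of "w \<otimes> g"] g W(2) unfolding depends_on_def by blast
        next
          fix w assume "w \<in> W"
          then show "K #> w \<otimes> g \<subseteq> carrier G" using r_coset_subset_G[OF K(2)] g W(2) by blast
        qed (use meas j g W in auto)
        interpret H: Hoeffding_ineq ?P W "\<lambda>w. b j (w \<otimes> g)" "\<lambda>_. -1" "\<lambda>_. 1" "\<Sum>w\<in>W. P.expectation (b j (w \<otimes> g))"
        proof unfold_locales
          fix w assume "w \<in> W"
          then have "\<bar>b j (w \<otimes> g) \<omega>\<bar> \<le> 1" if "\<omega> \<in> space ?P" for \<omega>
            using bd[OF j _ that, of "w \<otimes> g"] g W by auto
          then show "AE x in ?P. b j (w \<otimes> g) x \<in> {-1..1}"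
            by (intro AE_I2) (auto simp: abs_le_iff minus_le_iff)
        qed (use W ind in auto)
        have "P.prob {\<omega> \<in> space ?P. \<bar>R j g \<omega>\<bar> > e * m} \<le>
          P.prob {\<omega> \<in> space ?P. \<bar>(\<Sum>w\<in>W. b j (w \<otimes> g) \<omega>) - (\<Sum>w\<in>W. P.expectation (b j (w \<otimes> g)))\<bar> \<ge> e * m}"
          using meas j g W
          by (intro P.finite_measure_mono) (auto simp: R_def sum_subtractf subset_iff intro!: borel_measurable_le borel_measurable_abs borel_measurable_diff borel_measurable_sum)
        also have "\<dots> \<le> 2 * exp (-2 * (e * m)\<^sup>2 / (\<Sum>i\<in>W. (1 - (-1))\<^sup>2))"
          using e m1 W by (intro H.Hoeffding_ineq_abs_ge) auto
        also have "-2 * (e * m)\<^sup>2 / (\<Sum>i\<in>W. (1 - (-1))\<^sup>2) = - (e\<^sup>2 * real m) / 2"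
          using m1 W by (simp add: field_simps power2_eq_square)
        finally show ?thesis .
      qed
      have "P.prob (A g) \<le> (\<Sum>j\<in>B. P.prob {\<omega> \<in> space ?P. \<bar>R j g \<omega>\<bar> > e * m})"
        unfolding A_def using B Rm g
        by (intro P.finite_measure_subadditive_finite) (auto intro!: borel_measurable_less borel_measurable_abs)
      also have "\<dots> \<le> (\<Sum>j\<in>B. 2 * exp (- (e\<^sup>2 * real m) / 2))" using one by (rule sum_mono)
      also have "\<dots> = real (card B) * (2 * exp (- (e\<^sup>2 * real m) / 2))" by simp
      also have "\<dots> \<le> real p * (2 * exp (- (e\<^sup>2 * real m) / 2))" using B by (intro mult_right_mono) auto
      finally show ?thesis .
    qed
    have deg: "card (\<Gamma> g \<inter> D) \<le> (card K * m)\<^sup>2 + 1" if g: "g \<in> carrier G" for g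
    proof -
      define KW where "KW = (\<lambda>(k, w). k \<otimes> w) ` (K \<times> W)"
      have KW: "finite KW" "card KW \<le> card K * m" "KW \<subseteq> carrier G"
        using K W by (auto simp: KW_def intro!: order_trans[OF card_image_le] simp: card_cartesian_product)
      have "\<Gamma> g \<subseteq> insert g ((\<lambda>(s, t). inv t \<otimes> (s \<otimes> g)) ` (KW \<times> KW))"
      proof
        fix h assume h: "h \<in> \<Gamma> g"
        show "h \<in> insert g ((\<lambda>(s, t). inv t \<otimes> (s \<otimes> g)) ` (KW \<times> KW))"
        proof (cases "h = g")
          case False
          then have hc: "h \<in> carrier G" and "S g \<inter> S h \<noteq> {}" using h by (auto simp: \<Gamma>_def)
          then obtain k w k' w' where *: "k \<in> K" "w \<in> W" "k' \<in> K" "w' \<in> W" "k \<otimes> (w \<otimes> g) = k' \<otimes> (w' \<otimes> h)"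
            unfolding S_def r_coset_def by blast
          define s t where "s = k \<otimes> w" and "t = k' \<otimes> w'"
          have st: "s \<in> KW" "t \<in> KW" using * by (auto simp: s_def t_def KW_def)
          have "s \<otimes> g = t \<otimes> h" using * g hc K W by (simp add: s_def t_def m_assoc subset_iff)
          then have "h = inv t \<otimes> (s \<otimes> g)" using st KW(3) g hc
            by (metis inv_solve_left m_closed subsetD)
          then show ?thesis using st by force
        qed simp
      qed
      then have "card (\<Gamma> g \<inter> D) \<le> card (insert g ((\<lambda>(s, t). inv t \<otimes> (s \<otimes> g)) ` (KW \<times> KW)))"
        using KW by (intro card_mono) auto
      also have "\<dots> \<le> Suc (card ((\<lambda>(s, t). inv t \<otimes> (s \<otimes> g)) ` (KW \<times> KW)))" by (rule card_insert_le_m1) auto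
      also have "\<dots> \<le> Suc (card (KW \<times> KW))" using KW by (intro Suc_le_mono[THEN iffD2] card_image_le) auto
      also have "\<dots> \<le> Suc ((card K * m) * (card K * m))"
        using KW by (simp add: card_cartesian_product mult_le_mono)
      finally show ?thesis by (simp add: power2_eq_square)
    qed
    have "P.prob (space ?P - \<Union>(A ` D)) > 0"
    proof (rule P.local_lemma_symmetric[where \<Gamma> = \<Gamma> and d = "(card K * m)\<^sup>2 + 1"
          and p = "real p * (2 * exp (- (e\<^sup>2 * real m) / 2))"])
      show "4 * (real p * (2 * exp (- (e\<^sup>2 * real m) / 2))) * real ((card K * m)\<^sup>2 + 1) \<le> 1"
      proof -
        have "real ((card K * m)\<^sup>2 + 1) = (real (card K) * real m)\<^sup>2 + 1" by simp
        then show ?thesis using m by (metis less_imp_le)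
      qed
    next
      fix g T assume g: "g \<in> D" and T: "T \<subseteq> D" "T \<inter> \<Gamma> g = {}"
      have gc: "g \<in> carrier G" and Tc: "T \<subseteq> carrier G" using g T D by auto
      have A: "\<omega> \<in> A h \<longleftrightarrow> \<omega>' \<in> A h"
        if "h \<in> carrier G" "\<omega> \<in> space ?P" "\<omega>' \<in> space ?P" "\<forall>i\<in>S h. \<omega> i = \<omega>' i" for h \<omega> \<omega>'
        using Rdep[OF _ that] that by (auto simp: A_def)
      show "P.prob (A g \<inter> (space ?P - \<Union>(A ` T))) = P.prob (A g) * P.prob (space ?P - \<Union>(A ` T))"
      proof (rule PiM_prob_disjoint_support[OF N, where J = "S g" and J' = "\<Union>h\<in>T. S h"])
        show "A g \<in> P.events" using Aev gc by auto
        show "space ?P - \<Union>(A ` T) \<in> P.events"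
          using Aev Tc T D by (intro sets.Diff sets.top sets.finite_UN) (auto intro: finite_subset)
        show "S g \<subseteq> carrier G" "(\<Union>h\<in>T. S h) \<subseteq> carrier G" using Scar gc Tc by auto
        show "S g \<inter> (\<Union>h\<in>T. S h) = {}" using T Tc by (auto simp: \<Gamma>_def)
        show "depends_on (space ?P) (S g) (\<lambda>\<omega>. \<omega> \<in> A g)"
          unfolding depends_on_def using A[OF gc] by blast
        show "depends_on (space ?P) (\<Union>h\<in>T. S h) (\<lambda>\<omega>. \<omega> \<in> space ?P - \<Union>(A ` T))"
          unfolding depends_on_def
        proof (intro ballI impI)
          fix \<omega> \<omega>' assume w: "\<omega> \<in> space ?P" "\<omega>' \<in> space ?P" "\<forall>i\<in>\<Union>h\<in>T. S h. \<omega> i = \<omega>' i"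
          have "\<omega> \<in> A h \<longleftrightarrow> \<omega>' \<in> A h" if "h \<in> T" for h using A w that Tc by blast
          then show "(\<omega> \<in> space ?P - \<Union>(A ` T)) = (\<omega>' \<in> space ?P - \<Union>(A ` T))" using w by auto
        qed
      qed
    next
      show "card (\<Gamma> g \<inter> D) \<le> (card K * m)\<^sup>2 + 1" if "g \<in> D" for g
        using deg that D by blast
      show "g \<in> \<Gamma> g" if "g \<in> D" for g by (simp add: \<Gamma>_def)
    qed (use D Aev prA in auto)
    then have "space ?P - \<Union>(A ` D) \<noteq> {}" by (metis measure_empty less_irrefl)
    then obtain \<omega> where "\<omega> \<in> space ?P" "\<omega> \<notin> \<Union>(A ` D)" by blast
    then show "\<exists>\<omega>\<in>space ?P. \<forall>g\<in>D. \<forall>j\<in>B.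
          \<bar>\<Sum>w\<in>W. b j (w \<otimes> g) \<omega> - P.expectation (b j (w \<otimes> g))\<bar> \<le> e * card W"
      by (intro bexI[of _ \<omega>]) (auto simp: A_def R_def W(3) not_less)
  qed (use W Wne in auto)
qed

section \<open>Random cells\<close>

text \<open>
  A label consists of a priority, uniform in \<open>[0,1]\<close>, and a point of the system.
\<close>

abbreviation label_space :: "'x measure \<Rightarrow> (real \<times> 'x) measure" where
  "label_space M \<equiv> uniform_measure lborel {0..1} \<Otimes>\<^sub>M M"

abbreviation labelling :: "'i set \<Rightarrow> 'x measure \<Rightarrow> ('i \<Rightarrow> real \<times> 'x) measure" where
  "labelling I M \<equiv> PiM I (\<lambda>_. label_space M)"

definition minimisers :: "'i set \<Rightarrow> ('i \<Rightarrow> real \<times> 'x) \<Rightarrow> 'i set" where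
  "minimisers S \<omega> = {h\<in>S. \<forall>h'\<in>S. fst (\<omega> h) \<le> fst (\<omega> h')}"

text \<open>
  The choice is made from the set of all minimisers and not from \<open>S\<close>. Thus two sets with the same
  minimisers have the same cell even when priorities are tied, and ties never need to be excluded.
\<close>

definition cell :: "'i set \<Rightarrow> ('i \<Rightarrow> real \<times> 'x) \<Rightarrow> 'i" where
  "cell S \<omega> = (SOME h. h \<in> minimisers S \<omega>)"

lemma minimisers_nonempty:
  assumes "finite S" "S \<noteq> {}" shows "minimisers S \<omega> \<noteq> {}"
proof -
  have "arg_min_on (\<lambda>h. fst (\<omega> h)) S \<in> minimisers S \<omega>"
    using arg_min_if_finite[OF assms, of "\<lambda>h. fst (\<omega> h)"] by (auto simp: minimisers_def not_less)
  then show ?thesis by blast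
qed

lemma cell_in_minimisers:
  assumes "finite S" "S \<noteq> {}" shows "cell S \<omega> \<in> minimisers S \<omega>"
  unfolding cell_def using minimisers_nonempty[OF assms] by (meson ex_in_conv someI_ex)

lemma cell_in:
  assumes "finite S" "S \<noteq> {}" shows "cell S \<omega> \<in> S"
  using cell_in_minimisers[OF assms] by (auto simp: minimisers_def)

lemma cell_eq:
  assumes S: "finite S" "finite S'" and m: "minimisers (S \<union> S') \<omega> \<subseteq> S \<inter> S'" and ne: "S \<noteq> {}"
  shows "cell S \<omega> = cell S' \<omega>"
proof -
  obtain a where a: "a \<in> minimisers (S \<union> S') \<omega>"
    using minimisers_nonempty[of "S \<union> S'" \<omega>] S ne by auto
  have aS: "a \<in> S" "a \<in> S'" using a m by auto
  have amin: "\<forall>h\<in>S \<union> S'. fst (\<omega> a) \<le> fst (\<omega> h)" using a by (simp add: minimisers_def)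
  have "minimisers S \<omega> = minimisers (S \<union> S') \<omega>"
    using amin aS m by (fastforce simp: minimisers_def intro: order_trans)
  moreover have "minimisers S' \<omega> = minimisers (S \<union> S') \<omega>"
    using amin aS m by (fastforce simp: minimisers_def intro: order_trans)
  ultimately show ?thesis by (simp add: cell_def)
qed

lemma minimisers_cong: "(\<And>h. h \<in> S \<Longrightarrow> fst (\<omega> h) = fst (\<omega>' h)) \<Longrightarrow> minimisers S \<omega> = minimisers S \<omega>'"
  by (auto simp: minimisers_def)

lemma cell_cong: "(\<And>h. h \<in> S \<Longrightarrow> fst (\<omega> h) = fst (\<omega>' h)) \<Longrightarrow> cell S \<omega> = cell S \<omega>'"
  unfolding cell_def using minimisers_cong by metis

lemma prob_space_uniform01: "prob_space (uniform_measure lborel {0..1::real})"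
  by (rule prob_space_uniform_measure) auto

lemma prob_space_label_space: "prob_space M \<Longrightarrow> prob_space (label_space M)"
proof -
  assume "prob_space M"
  then interpret M: prob_space M .
  interpret U: prob_space "uniform_measure lborel {0..1::real}" by (rule prob_space_uniform01)
  interpret pair_prob_space "uniform_measure lborel {0..1::real}" M ..
  show ?thesis by unfold_locales
qed

lemma measurable_fst_coord [measurable]:
  assumes "h \<in> I" shows "(\<lambda>\<omega>. fst (\<omega> h)) \<in> borel_measurable (labelling I M)"
proof -
  have "fst \<in> measurable (label_space M) borel"
    using measurable_fst[of "uniform_measure lborel {0..1::real}" M]
    by (simp cong: measurable_cong_sets)
  from measurable_compose[OF measurable_component_singleton[OF assms] this] show ?thesis .
qed

lemma measurable_snd_coord [measurable]:
  assumes "h \<in> I" shows "(\<lambda>\<omega>. snd (\<omega> h)) \<in> measurable (labelling I M) M"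
  by (rule measurable_compose[OF measurable_component_singleton[OF assms] measurable_snd])

lemma minimisers_measurable:
  assumes "finite S" "S \<subseteq> I"
  shows "{\<omega>\<in>space (labelling I M). h \<in> minimisers S \<omega>} \<in> sets (labelling I M)"
proof (cases "h \<in> S")
  case True
  then have "{\<omega>\<in>space (labelling I M). h \<in> minimisers S \<omega>} = {\<omega>\<in>space (labelling I M). \<forall>h'\<in>S. fst (\<omega> h) \<le> fst (\<omega> h')}"
    by (auto simp: minimisers_def)
  also have "\<dots> \<in> sets (labelling I M)"
    using assms True by (intro sets.sets_Collect_finite_All borel_measurable_le measurable_fst_coord) auto
  finally show ?thesis .
qed (auto simp: minimisers_def)

lemma cell_measurable:
  assumes S: "finite S" "S \<subseteq> I"
  shows "{\<omega>\<in>space (labelling I M). cell S \<omega> = h} \<in> sets (labelling I M)"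
proof -
  let ?P = "labelling I M"
  have "{\<omega>\<in>space ?P. minimisers S \<omega> = A} \<in> sets ?P" if "A \<subseteq> S" for A
  proof -
    have "{\<omega>\<in>space ?P. minimisers S \<omega> = A} =
       {\<omega>\<in>space ?P. \<forall>a\<in>S. (a \<in> minimisers S \<omega>) = (a \<in> A)}"
      using that by (auto simp: minimisers_def)
    also have "\<dots> \<in> sets ?P"
    proof (intro sets.sets_Collect_finite_All S(1))
      fix a
      show "{\<omega>\<in>space ?P. (a \<in> minimisers S \<omega>) = (a \<in> A)} \<in> sets ?P"
      proof (cases "a \<in> A")
        case False
        then show ?thesis using sets.sets_Collect_neg[OF minimisers_measurable[OF S, of M a]] by simp
      qed (simp add: minimisers_measurable[OF S])
    qed
    finally show ?thesis .
  qed
  moreover have "{\<omega>\<in>space ?P. cell S \<omega> = h} = (\<Union>A\<in>{A\<in>Pow S. (SOME h. h \<in> A) = h}. {\<omega>\<in>space ?P. minimisers S \<omega> = A})"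
    by (auto simp: cell_def minimisers_def)
  ultimately show ?thesis using S(1) by (auto intro!: sets.finite_UN)
qed

text \<open>
  Conditionally on the priority \<open>u\<close> of \<open>h\<close>, the other \<open>n\<close> priorities exceed \<open>u\<close> with probability
  \<open>(1 - u) ^ n\<close>, whose integral over \<open>[0,1]\<close> is \<open>1 / (n + 1)\<close>. The conditioning is done by resampling:
  replacing the label of \<open>h\<close> by an independent copy preserves the product measure.
\<close>

lemma prob_minimiser:
  fixes M :: "'x measure" and I :: "'i set"
  assumes M: "prob_space M" and S: "finite S" "S \<subseteq> I" "h \<in> S"
  shows "measure (labelling I M) {\<omega>\<in>space (labelling I M). h \<in> minimisers S \<omega>} = 1 / card S"
proof -
  let ?N = "label_space M"
  let ?P = "PiM I (\<lambda>_. ?N)"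
  let ?up = "\<lambda>(x, \<omega>). fun_upd \<omega> h x :: 'i \<Rightarrow> real \<times> 'x"
  let ?U = "uniform_measure lborel {0..1::real}"
  interpret M: prob_space M by fact
  have N: "prob_space ?N" using M by (rule prob_space_label_space)
  interpret N: prob_space ?N by (rule N)
  interpret P: prob_space ?P using N by (intro prob_space_PiM)
  interpret PP: product_prob_space "\<lambda>_. ?N" I ..
  have hI: "h \<in> I" using S by auto
  define n where "n = card S - 1"
  have "card S > 0" using S(1,3) card_gt_0_iff by blast
  then have cS: "card S = Suc n" by (simp add: n_def)
  have cn: "card (S - {h}) = n" using S by (simp add: n_def)
  let ?A = "{\<omega>\<in>space ?P. h \<in> minimisers S \<omega>}"
  have A: "?A \<in> sets ?P" using S by (intro minimisers_measurable) auto
  \<comment> \<open>Resampling the label of \<open>h\<close>.\<close>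
  have mup: "?up \<in> measurable (?N \<Otimes>\<^sub>M ?P) ?P"
    unfolding split_beta' by (rule measurable_fun_upd[where J = I]) (use hI in auto)
  have Pd: "distr (?N \<Otimes>\<^sub>M ?P) ?P ?up = ?P"
    using distr_pair_PiM_eq_PiM[of I "\<lambda>_. ?N" h] N hI by (simp add: insert_absorb)
  have U1: "emeasure ?U {u..} = ennreal (1 - max 0 u)" for u :: real
  proof -
    have "{0..1} \<inter> {u..} = {max 0 u..1}" by auto
    then show ?thesis by (cases "max 0 u \<le> 1") (simp_all add: emeasure_uniform_measure ennreal_neg divide_ennreal_def)
  qed
  have upper: "emeasure ?N {z\<in>space ?N. u \<le> fst z} = emeasure ?U {u..}" for u
  proof -
    have "{z\<in>space ?N. u \<le> fst z} = {u..} \<times> space M" by (auto simp: space_pair_measure)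
    then show ?thesis by (simp add: M.emeasure_pair_measure_Times M.emeasure_space_1)
  qed
  have slice: "emeasure ?P {\<omega>\<in>space ?P. fun_upd \<omega> h y \<in> ?A} = emeasure ?U {fst y..} ^ n" if y: "y \<in> space ?N" for y
  proof -
    have "{\<omega>\<in>space ?P. fun_upd \<omega> h y \<in> ?A} = {\<omega>\<in>space ?P. \<forall>i\<in>S - {h}. \<omega> i \<in> {z\<in>space ?N. fst y \<le> fst z}}"
      using y hI S by (auto simp: minimisers_def space_PiM PiE_iff extensional_def subset_iff)
    also have "emeasure ?P \<dots> = (\<Prod>i\<in>S - {h}. emeasure ?N {z\<in>space ?N. fst y \<le> fst z})"
    proof (rule PP.emeasure_PiM_Collect)
      have "{z\<in>space ?N. fst y \<le> fst z} = {fst y..} \<times> space M" by (auto simp: space_pair_measure)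
      then show "{z\<in>space ?N. fst y \<le> fst z} \<in> sets ?N" by auto
    qed (use S in auto)
    finally show ?thesis by (simp add: upper cn)
  qed
  have "emeasure ?P ?A = emeasure (distr (?N \<Otimes>\<^sub>M ?P) ?P ?up) ?A" by (simp add: Pd)
  also have "\<dots> = emeasure (?N \<Otimes>\<^sub>M ?P) (?up -` ?A \<inter> space (?N \<Otimes>\<^sub>M ?P))"
    by (rule emeasure_distr[OF mup A])
  also have "\<dots> = (\<integral>\<^sup>+ y. emeasure ?P (Pair y -` (?up -` ?A \<inter> space (?N \<Otimes>\<^sub>M ?P))) \<partial>?N)"
    by (rule P.emeasure_pair_measure_alt[OF measurable_sets[OF mup A]])
  also have "\<dots> = (\<integral>\<^sup>+ y. emeasure ?U {fst y..} ^ n \<partial>?N)"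
  proof (rule nn_integral_cong)
    fix y assume y: "y \<in> space ?N"
    have "Pair y -` (?up -` ?A \<inter> space (?N \<Otimes>\<^sub>M ?P)) = {\<omega>\<in>space ?P. fun_upd \<omega> h y \<in> ?A}"
      using y by (auto simp: space_pair_measure)
    then show "emeasure ?P (Pair y -` (?up -` ?A \<inter> space (?N \<Otimes>\<^sub>M ?P))) = emeasure ?U {fst y..} ^ n"
      using slice[OF y] by simp
  qed
  also have "\<dots> = (\<integral>\<^sup>+ u. emeasure ?U {u..} ^ n \<partial>?U)"
  proof -
    have "(\<integral>\<^sup>+ y. emeasure ?U {fst y..} ^ n \<partial>?N) = (\<integral>\<^sup>+ u. (\<integral>\<^sup>+ x. emeasure ?U {u..} ^ n \<partial>M) \<partial>?U)"
      unfolding U1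
      by (subst M.nn_integral_fst[symmetric]) auto
    then show ?thesis by (simp add: M.emeasure_space_1)
  qed
  also have "\<dots> = (\<integral>\<^sup>+ u. ennreal ((1 - u) ^ n) * indicator {0..1} u \<partial>lborel)"
  proof -
    have "(\<integral>\<^sup>+ u. emeasure ?U {u..} ^ n \<partial>?U) = (\<integral>\<^sup>+ u. emeasure ?U {u..} ^ n * indicator {0..1} u \<partial>lborel)"
      by (subst nn_integral_uniform_measure) (simp_all add: U1 divide_ennreal_def)
    also have "\<dots> = (\<integral>\<^sup>+ u. ennreal ((1 - u) ^ n) * indicator {0..1} u \<partial>lborel)"
      by (intro nn_integral_cong) (simp add: U1 ennreal_power indicator_def max_def)
    finally show ?thesis .
  qed
  also have "\<dots> = ennreal (1 / Suc n)"
  proof -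
    have "((\<lambda>u. - ((1 - u) ^ Suc n) / Suc n) has_real_derivative (1 - u) ^ n) (at u)" for u :: real
      by (auto intro!: derivative_eq_intros simp del: power_Suc of_nat_Suc)
    then have "(\<integral>\<^sup>+ u. ennreal ((1 - u) ^ n) * indicator {0..1} u \<partial>lborel)
        = ennreal ((- ((1 - 1) ^ Suc n) / Suc n) - (- ((1 - 0) ^ Suc n) / Suc n))"
      by (intro nn_integral_FTC_Icc) (auto intro: has_field_derivative_at_within)
    then show ?thesis by simp
  qed
  finally show ?thesis by (simp add: measure_def cS)
qed

text \<open>
  The cells can differ only if some minimiser on the union lies in just one of the two sets, and each
  point of the union is a minimiser with probability \<open>1 / card (S \<union> S')\<close>.
\<close>

lemma prob_cell_neq:
  assumes M: "prob_space M" and S: "finite S" "finite S'" "S \<subseteq> I" "S' \<subseteq> I" "S \<noteq> {}"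
  shows "measure (labelling I M) {\<omega>\<in>space (labelling I M). cell S \<omega> \<noteq> cell S' \<omega>}
      \<le> real (card (sym_diff S S')) / real (card S)"
proof -
  let ?P = "labelling I M"
  interpret P: prob_space ?P using M by (intro prob_space_PiM prob_space_label_space)
  let ?A = "\<lambda>h. {\<omega>\<in>space ?P. h \<in> minimisers (S \<union> S') \<omega>}"
  have A: "?A h \<in> P.events" for h using S by (intro minimisers_measurable) auto
  have "{\<omega>\<in>space ?P. cell S \<omega> \<noteq> cell S' \<omega>} \<subseteq> (\<Union>h\<in>sym_diff S S'. ?A h)"
  proof
    fix \<omega> assume "\<omega> \<in> {\<omega>\<in>space ?P. cell S \<omega> \<noteq> cell S' \<omega>}"
    then have w: "\<omega> \<in> space ?P" and "\<not> minimisers (S \<union> S') \<omega> \<subseteq> S \<inter> S'"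
      using cell_eq[OF S(1,2) _ S(5)] by auto
    then obtain h where "h \<in> minimisers (S \<union> S') \<omega>" "h \<notin> S \<inter> S'" by auto
    moreover from this have "h \<in> sym_diff S S'" by (auto simp: minimisers_def)
    ultimately show "\<omega> \<in> (\<Union>h\<in>sym_diff S S'. ?A h)" using w by auto
  qed
  then have "P.prob {\<omega>\<in>space ?P. cell S \<omega> \<noteq> cell S' \<omega>} \<le> P.prob (\<Union>h\<in>sym_diff S S'. ?A h)"
    using A S by (intro P.finite_measure_mono) (auto intro!: sets.finite_UN)
  also have "\<dots> \<le> (\<Sum>h\<in>sym_diff S S'. P.prob (?A h))"
    using A S by (intro P.finite_measure_subadditive_finite) auto
  also have "\<dots> = (\<Sum>h\<in>sym_diff S S'. 1 / card (S \<union> S'))"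
    using M S by (intro sum.cong refl prob_minimiser) auto
  also have "\<dots> = real (card (sym_diff S S')) / card (S \<union> S')" by simp
  also have "\<dots> \<le> real (card (sym_diff S S')) / real (card S)"
    using S by (intro divide_left_mono mult_pos_pos) (auto intro!: card_mono simp: card_gt_0_iff)
  finally show ?thesis .
qed

text \<open>
  An event that is determined by priorities is independent of the points. The point attached to \<open>h\<close> can
  therefore be integrated out first, again by resampling the label of \<open>h\<close>.
\<close>

lemma expectation_label_on_cell_event:
  fixes y :: "'x \<Rightarrow> real" and I :: "'i set"
  assumes M: "prob_space M" and h: "h \<in> I" and Q: "Q \<in> sets (labelling I M)"
    and dep: "\<And>\<omega> \<omega>'. (\<And>i. i \<in> I \<Longrightarrow> fst (\<omega> i) = fst (\<omega>' i)) \<Longrightarrow> \<omega> \<in> space (labelling I M) \<Longrightarrow>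
        \<omega>' \<in> space (labelling I M) \<Longrightarrow> \<omega> \<in> Q \<Longrightarrow> \<omega>' \<in> Q"
    and y: "y \<in> borel_measurable M" "\<And>x. x \<in> space M \<Longrightarrow> \<bar>y x\<bar> \<le> 1" "(\<integral>x. y x \<partial>M) = 0"
  shows "(\<integral>\<omega>. indicator Q \<omega> * y (snd (\<omega> h)) \<partial>labelling I M) = 0"
proof -
  let ?up = "\<lambda>(z, \<omega>). fun_upd \<omega> h z :: 'i \<Rightarrow> real \<times> 'x"
  let ?U = "uniform_measure lborel {0..1::real}"
  let ?N = "label_space M"
  let ?P = "PiM I (\<lambda>_. ?N)"
  interpret M: prob_space M by fact
  interpret U: prob_space ?U by (rule prob_space_uniform01)
  have N: "prob_space ?N" using M by (rule prob_space_label_space)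
  interpret N: prob_space ?N by (rule N)
  interpret P: prob_space ?P using N by (intro prob_space_PiM)
  interpret NP: pair_prob_space ?N ?P ..
  interpret UM: pair_prob_space ?U M ..
  have mup: "?up \<in> measurable (?N \<Otimes>\<^sub>M ?P) ?P"
    unfolding split_beta' by (rule measurable_fun_upd[where J = I]) (use h in auto)
  have Pd: "distr (?N \<Otimes>\<^sub>M ?P) ?P ?up = ?P"
    using distr_pair_PiM_eq_PiM[of I "\<lambda>_. ?N" h] N h by (simp add: insert_absorb)
  define F where "F \<omega> = indicator Q \<omega> * y (snd (\<omega> h))" for \<omega>
  have Fm: "F \<in> borel_measurable ?P"
    unfolding F_def using Q y(1) measurable_compose[OF measurable_snd_coord[OF h] y(1)]
    by (intro borel_measurable_times) auto
  have Fb: "\<bar>F \<omega>\<bar> \<le> 1" if "\<omega> \<in> space ?P" for \<omega>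
    using y(2)[of "snd (\<omega> h)"] that h
    by (auto simp: F_def indicator_def space_PiM space_pair_measure PiE_iff)
  have Gm: "(\<lambda>(z, \<omega>). F (fun_upd \<omega> h z)) \<in> borel_measurable (?N \<Otimes>\<^sub>M ?P)"
    using measurable_compose[OF mup Fm] by (simp add: split_beta')
  have upd: "fun_upd \<omega> h z \<in> space ?P" if "z \<in> space ?N" "\<omega> \<in> space ?P" for z \<omega>
    using that h by (auto simp: space_PiM PiE_iff extensional_def)
  have Gi: "integrable (?N \<Otimes>\<^sub>M ?P) (\<lambda>(z, \<omega>). F (fun_upd \<omega> h z))"
    by (rule NP.integrable_const_bound[OF _ Gm, where B = 1])
       (auto simp: space_pair_measure intro!: Fb upd)
  have inner: "(\<integral>z. F (fun_upd \<omega> h z) \<partial>?N) = 0" if w: "\<omega> \<in> space ?P" for \<omega>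
  proof -
    have Hm: "(\<lambda>z. F (fun_upd \<omega> h z)) \<in> borel_measurable ?N"
      using measurable_compose[OF measurable_Pair2'[OF w] Gm] by simp
    have Hi: "integrable ?N (\<lambda>z. F (fun_upd \<omega> h z))"
      using w by (intro N.integrable_const_bound[OF _ Hm, where B = 1] AE_I2) (auto intro!: Fb upd)
    have "(\<integral>x. F (fun_upd \<omega> h (u, x)) \<partial>M) = 0" for u
    proof -
      obtain x0 where x0: "x0 \<in> space M" using M.not_empty by auto
      have "(\<integral>x. F (fun_upd \<omega> h (u, x)) \<partial>M) = (\<integral>x. indicator Q (fun_upd \<omega> h (u, x0)) * y x \<partial>M)"
      proof (rule Bochner_Integration.integral_cong[OF refl])
        fix x assume x: "x \<in> space M"
        have s: "fun_upd \<omega> h (u, x) \<in> space ?P" "fun_upd \<omega> h (u, x0) \<in> space ?P"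
          using x x0 w by (auto intro!: upd simp: space_pair_measure)
        have "fun_upd \<omega> h (u, x) \<in> Q \<longleftrightarrow> fun_upd \<omega> h (u, x0) \<in> Q"
          using dep[OF _ s] dep[OF _ s(2,1)] by auto
        then show "F (fun_upd \<omega> h (u, x)) = indicator Q (fun_upd \<omega> h (u, x0)) * y x"
          by (simp add: F_def indicator_def)
      qed
      then show ?thesis using y(3) by simp
    qed
    then show ?thesis
      using UM.integral_fst'[OF Hi] by simp
  qed
  have "(\<integral>\<omega>. F \<omega> \<partial>?P) = (\<integral>\<omega>. F \<omega> \<partial>distr (?N \<Otimes>\<^sub>M ?P) ?P ?up)"
    by (simp add: Pd)
  also have "\<dots> = (\<integral>p. F (case p of (z, \<omega>) \<Rightarrow> fun_upd \<omega> h z) \<partial>(?N \<Otimes>\<^sub>M ?P))"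
    by (rule integral_distr[OF mup Fm])
  also have "\<dots> = (\<integral>p. (case p of (z, \<omega>) \<Rightarrow> F (fun_upd \<omega> h z)) \<partial>(?N \<Otimes>\<^sub>M ?P))"
    by (intro Bochner_Integration.integral_cong) auto
  also have "\<dots> = (\<integral>\<omega>. (\<integral>z. F (fun_upd \<omega> h z) \<partial>?N) \<partial>?P)"
    using NP.integral_snd[OF Gi] by simp
  also have "\<dots> = (\<integral>\<omega>. 0 \<partial>?P)" by (rule Bochner_Integration.integral_cong[OF refl inner])
  finally show ?thesis by (simp add: F_def)
qed

section \<open>Random sequences sampled from a measure preserving system\<close>

lemma image_sym_diff:
  assumes "inj_on f C" "A \<subseteq> C" "B \<subseteq> C" shows "f ` sym_diff A B = sym_diff (f ` A) (f ` B)"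
proof -
  have "A - B \<subseteq> C" "B - A \<subseteq> C" using assms by auto
  then show ?thesis using assms by (simp add: image_Un inj_on_image_set_diff[OF assms(1)])
qed

text \<open>
  The inverse of a left Folner set is almost invariant on the right.
\<close>

lemma (in group) right_Folner_set_exists:
  fixes e :: real
  assumes F: "left_Folner_seq G F" and K: "finite K" "K \<subseteq> carrier G" and e: "e > 0"
  shows "\<exists>T. finite T \<and> T \<noteq> {} \<and> T \<subseteq> carrier G \<and> (\<forall>k\<in>K. real (card (sym_diff T (T #> k))) \<le> e * card T)"
proof -
  have Fn: "finite (F n)" "F n \<noteq> {}" "F n \<subseteq> carrier G" for n using F by (auto simp: left_Folner_seq_def)
  have "\<forall>\<^sub>F n in sequentially. \<forall>k\<in>K. real (card (sym_diff (F n) (inv k <# F n))) / real (card (F n)) < e"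
    using F K e by (intro eventually_ball_finite K ballI order_tendstoD(2)[of _ 0]) (auto simp: left_Folner_seq_def)
  then obtain n where n: "\<forall>k\<in>K. real (card (sym_diff (F n) (inv k <# F n))) / real (card (F n)) < e"
    by (auto simp: eventually_sequentially)
  have inj: "inj_on (m_inv G) (carrier G)" by (rule inj_on_inverseI[where g = "m_inv G"]) simp
  define T where "T = m_inv G ` F n"
  have cT: "card T = card (F n)" unfolding T_def using inj Fn by (intro card_image) (meson inj_on_subset)
  have "real (card (sym_diff T (T #> k))) \<le> e * card T" if k: "k \<in> K" for k
  proof -
    have kc: "k \<in> carrier G" using k K by auto
    have "T #> k = m_inv G ` (inv k <# F n)"
      using Fn kc by (force simp: T_def r_coset_def l_coset_def inv_mult_group subset_iff)
    then have "sym_diff T (T #> k) = m_inv G ` (sym_diff (F n) (inv k <# F n))"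
      using inj Fn(3)[of n] kc l_coset_subset_G[OF Fn(3)[of n], of "inv k"]
      by (simp add: T_def image_sym_diff[OF inj])
    moreover have "card (m_inv G ` (sym_diff (F n) (inv k <# F n))) = card (sym_diff (F n) (inv k <# F n))"
      using inj Fn(3)[of n] kc l_coset_subset_G[OF Fn(3)[of n], of "inv k"] by (intro card_image) (auto intro: inj_on_subset)
    moreover have "real (card (sym_diff (F n) (inv k <# F n))) < e * card (F n)"
      using n k Fn[of n] card_gt_0_iff[of "F n"] by (simp add: pos_divide_less_eq)
    ultimately show ?thesis by (simp add: cT)
  qed
  then show ?thesis using Fn[of n] by (intro exI[of _ T]) (auto simp: T_def)
qed

lemma (in group) sym_diff_r_coset:
  assumes T: "T \<subseteq> carrier G" "finite T" and k: "k \<in> carrier G" and g: "g \<in> carrier G"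
  shows "card (sym_diff (T #> g) (T #> (k \<otimes> g))) = card (sym_diff T (T #> k))" and "card (T #> g) = card T"
proof -
  have inj: "inj_on (\<lambda>h. h \<otimes> g) (carrier G)" using g by (intro inj_onI) simp
  have rc: "A #> g = (\<lambda>h. h \<otimes> g) ` A" for A by (auto simp: r_coset_def)
  have "T #> (k \<otimes> g) = (T #> k) #> g" using coset_mult_assoc[OF T(1) k g] by simp
  then have "sym_diff (T #> g) (T #> (k \<otimes> g)) = (\<lambda>h. h \<otimes> g) ` sym_diff T (T #> k)"
    using T r_coset_subset_G[OF T(1) k] by (simp add: rc image_sym_diff[OF inj])
  then show "card (sym_diff (T #> g) (T #> (k \<otimes> g))) = card (sym_diff T (T #> k))"
    using T r_coset_subset_G[OF T(1) k] by (simp only:) (intro card_image inj_on_subset[OF inj], auto)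
  show "card (T #> g) = card T" unfolding rc using T by (intro card_image inj_on_subset[OF inj])
qed

type_synonym 'g observable = "'g \<times> (complex \<Rightarrow> complex \<Rightarrow> real)"

lemma compact_sphere_functions: "compact {c :: 'g \<Rightarrow> complex. \<forall>g. c g \<in> sphere 0 1}"
proof -
  have "compactin (product_topology (\<lambda>_. euclidean) UNIV) (PiE UNIV (\<lambda>_::'g. sphere (0::complex) 1))"
    by (subst compactin_PiE) auto
  then have "compact (PiE UNIV (\<lambda>_::'g. sphere (0::complex) 1))"
    by (simp add: euclidean_product_topology)
  then show ?thesis by (simp add: PiE_UNIV_domain Pi_def)
qed

context measure_preserving_system
begin

lemma acting_group: "group G"
  using group_hom by (simp add: group_hom_def)

abbreviation group_mult (infixl "\<cdot>" 70) where "g \<cdot> h \<equiv> g \<otimes>\<^bsub>G\<^esub> h"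
abbreviation right_coset (infixl "\<odot>" 60) where "T \<odot> g \<equiv> T #>\<^bsub>G\<^esub> g"

lemma action_in_space: "g \<in> carrier G \<Longrightarrow> x \<in> space M \<Longrightarrow> \<tau> g x \<in> space M"
  by (rule element_image) auto

lemma action_mult: "g \<in> carrier G \<Longrightarrow> h \<in> carrier G \<Longrightarrow> x \<in> space M \<Longrightarrow> \<tau> (g \<cdot> h) x = \<tau> g (\<tau> h x)"
  by (rule composition_rule)

text \<open>
  The definition of a system asks for invariance under images; for the bijection \<open>\<tau> g\<close> the preimage of
  a set is its image under \<open>\<tau> (inv g)\<close>.
\<close>

lemma distr_action:
  assumes g: "g \<in> carrier G" shows "distr M M (\<tau> g) = M"
proof (rule measure_eqI)
  interpret group G by (rule acting_group)
  fix A assume "A \<in> sets (distr M M (\<tau> g))"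
  then have A: "A \<in> sets M" by simp
  have "\<tau> g -` A \<inter> space M = \<tau> (inv\<^bsub>G\<^esub> g) ` A"
  proof (intro Set.set_eqI iffI)
    fix x assume x: "x \<in> \<tau> g -` A \<inter> space M"
    then have "\<tau> (inv\<^bsub>G\<^esub> g) (\<tau> g x) = x" using g orbit_sym_aux by blast
    then show "x \<in> \<tau> (inv\<^bsub>G\<^esub> g) ` A" using x by force
  next
    fix x assume "x \<in> \<tau> (inv\<^bsub>G\<^esub> g) ` A"
    then obtain a where a: "a \<in> A" "x = \<tau> (inv\<^bsub>G\<^esub> g) a" by auto
    then have as: "a \<in> space M" using sets.sets_into_space[OF A] by auto
    have "\<tau> g x = a" using g a as orbit_sym_aux[of "inv\<^bsub>G\<^esub> g" a x] by auto
    then show "x \<in> \<tau> g -` A \<inter> space M" using a as g action_in_space by auto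
  qed
  then show "emeasure (distr M M (\<tau> g)) A = emeasure M A"
    using A g measurable_action[OF g] measure_preserving[of "inv\<^bsub>G\<^esub> g" A] by (simp add: emeasure_distr)
qed simp

lemma integral_action:
  fixes y :: "'x \<Rightarrow> 'r :: {banach, second_countable_topology}"
  assumes g: "g \<in> carrier G" and y: "y \<in> borel_measurable M"
  shows "(\<integral>x. y (\<tau> g x) \<partial>M) = (\<integral>x. y x \<partial>M)"
  using integral_distr[OF measurable_action[OF g] y] by (simp add: distr_action[OF g])

text \<open>
  An observable is a pair \<open>(v, \<psi>)\<close>, standing for the random variable \<open>\<psi> (f (\<tau> v x)) (f x)\<close>. Correlations
  and means are both of this kind, up to taking real and imaginary parts and rescaling, so that a single
  construction controls all of them.
\<close>

definition centred_observable :: "('x \<Rightarrow> complex) \<Rightarrow> 'g observable \<Rightarrow> bool" where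
  "centred_observable f j \<longleftrightarrow> fst j \<in> carrier G \<and> continuous_on UNIV (\<lambda>z. snd j (fst z) (snd z)) \<and>
     (\<forall>z\<in>sphere 0 1. \<forall>w\<in>sphere 0 1. \<bar>snd j z w\<bar> \<le> 1) \<and> (\<integral>x. snd j (f (\<tau> (fst j) x)) (f x) \<partial>M) = 0"

end

definition obs :: "('g, 'b) monoid_scheme \<Rightarrow> ('g \<Rightarrow> complex) \<Rightarrow> 'g observable \<Rightarrow> 'g \<Rightarrow> real" where
  "obs G c j g = snd j (c (fst j \<otimes>\<^bsub>G\<^esub> g)) (c g)"

context measure_preserving_system
begin

text \<open>
  Every cell decides from the position of its centre \<open>h\<close> whether it copies the given sequence \<open>c'\<close> or
  follows the orbit of the random point attached to \<open>h\<close>.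
\<close>

definition cell_field :: "('x \<Rightarrow> complex) \<Rightarrow> 'g set \<Rightarrow> 'g set \<Rightarrow> ('g \<Rightarrow> complex) \<Rightarrow> ('g \<Rightarrow> real \<times> 'x) \<Rightarrow> 'g \<Rightarrow> complex" where
  "cell_field f T A c' \<omega> g = (let h = cell (T \<odot> g) \<omega> in if h \<in> A then c' g else f (\<tau> g (snd (\<omega> h))))"

context
  fixes f :: "'x \<Rightarrow> complex" and T A :: "'g set" and c' :: "'g \<Rightarrow> complex"
  assumes f: "f \<in> measurable M (restrict_space borel (sphere 0 1))"
    and T: "finite T" "T \<noteq> {}" "T \<subseteq> carrier G" and c': "\<And>g. c' g \<in> sphere 0 1"
begin

interpretation grp: group G by (rule acting_group)

private abbreviation "P \<equiv> labelling (carrier G) M"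

interpretation P: prob_space P
  using prob_space_axioms by (intro prob_space_PiM prob_space_label_space)

lemma f_sphere: "x \<in> space M \<Longrightarrow> f x \<in> sphere 0 1"
  using measurable_space[OF f] by (simp add: space_restrict_space)

lemma f_borel: "f \<in> borel_measurable M"
  using f by (simp add: measurable_restrict_space2_iff)

lemma coset_facts:
  assumes "g \<in> carrier G"
  shows "finite (T \<odot> g)" "T \<odot> g \<noteq> {}" "T \<odot> g \<subseteq> carrier G"
  using T grp.r_coset_subset_G[OF T(3) assms] by (auto simp: r_coset_def)

lemma cell_in_coset: "g \<in> carrier G \<Longrightarrow> cell (T \<odot> g) \<omega> \<in> T \<odot> g"
  using coset_facts by (intro cell_in) auto

lemma label_space_snd: "\<omega> \<in> space P \<Longrightarrow> h \<in> carrier G \<Longrightarrow> snd (\<omega> h) \<in> space M"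
  by (auto simp: space_PiM PiE_iff space_pair_measure)

lemma cell_field_sphere:
  assumes "g \<in> carrier G" "\<omega> \<in> space P" shows "cell_field f T A c' \<omega> g \<in> sphere 0 1"
proof -
  have "cell (T \<odot> g) \<omega> \<in> carrier G" using cell_in_coset[OF assms(1)] coset_facts[OF assms(1)] by auto
  then show ?thesis
    using c'[of g] f_sphere[OF action_in_space[OF assms(1) label_space_snd[OF assms(2)]]]
    by (auto simp: cell_field_def Let_def)
qed

lemma cell_field_measurable:
  assumes g: "g \<in> carrier G" shows "(\<lambda>\<omega>. cell_field f T A c' \<omega> g) \<in> borel_measurable P"
proof -
  define H where "H h \<omega> = (if h \<in> A then c' g else f (\<tau> g (snd (\<omega> h))))" for h and \<omega> :: "'g \<Rightarrow> real \<times> 'x"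
  have "(\<lambda>\<omega>. H (cell (T \<odot> g) \<omega>) \<omega>) \<in> borel_measurable P"
  proof (rule measurable_compose_countable'[where I = "T \<odot> g"])
    fix h assume "h \<in> T \<odot> g"
    then have "h \<in> carrier G" using coset_facts[OF g] by auto
    from measurable_compose[OF measurable_snd_coord[OF this] measurable_compose[OF measurable_action[OF g] f_borel]]
    show "H h \<in> borel_measurable P" by (cases "h \<in> A") (auto simp: H_def[abs_def])
  next
    show "cell (T \<odot> g) \<in> measurable P (count_space (T \<odot> g))"
    proof (subst measurable_count_space_eq2[OF coset_facts(1)[OF g]], intro conjI ballI)
      fix h assume "h \<in> T \<odot> g"
      have "cell (T \<odot> g) -` {h} \<inter> space P = {\<omega>\<in>space P. cell (T \<odot> g) \<omega> = h}" by auto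
      then show "cell (T \<odot> g) -` {h} \<inter> space P \<in> sets P"
        using cell_measurable[OF coset_facts(1,3)[OF g]] by simp
    qed (use cell_in_coset[OF g] in auto)
  qed (use coset_facts[OF g] in \<open>auto intro: countable_finite\<close>)
  then show ?thesis by (simp add: H_def cell_field_def Let_def)
qed

lemma cell_field_depends:
  assumes "g \<in> carrier G" "\<And>h. h \<in> T \<odot> g \<Longrightarrow> \<omega> h = \<omega>' h"
  shows "cell_field f T A c' \<omega> g = cell_field f T A c' \<omega>' g"
proof -
  have "cell (T \<odot> g) \<omega> = cell (T \<odot> g) \<omega>'" using assms by (intro cell_cong) simp
  moreover have "\<omega> (cell (T \<odot> g) \<omega>') = \<omega>' (cell (T \<odot> g) \<omega>')" by (intro assms(2) cell_in_coset assms(1))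
  ultimately show ?thesis by (simp add: cell_field_def Let_def)
qed

lemma cell_event_measurable:
  assumes g: "g \<in> carrier G" shows "{\<omega>\<in>space P. cell (T \<odot> g) \<omega> \<in> B} \<in> sets P"
proof -
  have "{\<omega>\<in>space P. cell (T \<odot> g) \<omega> \<in> B} = (\<Union>h\<in>(T \<odot> g) \<inter> B. {\<omega>\<in>space P. cell (T \<odot> g) \<omega> = h})"
    using cell_in_coset[OF g] by auto
  then show ?thesis using cell_measurable[OF coset_facts(1,3)[OF g]] coset_facts(1)[OF g] by (auto intro!: sets.finite_UN)
qed

lemma cell_neq_measurable:
  assumes g: "g \<in> carrier G" "k \<in> carrier G"
  shows "{\<omega>\<in>space P. cell (T \<odot> g) \<omega> \<noteq> cell (T \<odot> k) \<omega>} \<in> sets P"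
proof -
  have "{\<omega>\<in>space P. cell (T \<odot> g) \<omega> \<noteq> cell (T \<odot> k) \<omega>} =
     (\<Union>h\<in>(T \<odot> g). {\<omega>\<in>space P. cell (T \<odot> g) \<omega> \<in> {h}} \<inter> {\<omega>\<in>space P. cell (T \<odot> k) \<omega> \<in> - {h}})"
    using cell_in_coset[OF g(1)] by auto
  also have "\<dots> \<in> sets P"
    by (intro sets.finite_UN sets.Int cell_event_measurable g coset_facts(1))
  finally show ?thesis .
qed

text \<open>
  If \<open>g\<close> and \<open>vg\<close> share their cell \<open>h\<close>, then the observable at \<open>g\<close> is that of \<open>c'\<close> for \<open>h \<in> A\<close>, and
  otherwise it is a function of the point attached to \<open>h\<close> whose mean vanishes by invariance of the
  measure. The error is bounded by twice the probability that the cells differ.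
\<close>

lemma cell_field_expectation:
  assumes j: "centred_observable f j" and g: "g \<in> carrier G"
  shows "\<bar>P.expectation (\<lambda>\<omega>. obs G (cell_field f T A c' \<omega>) j g)
            - P.prob {\<omega>\<in>space P. cell (T \<odot> g) \<omega> \<in> A} * obs G c' j g\<bar>
         \<le> 2 * (card (sym_diff T (T \<odot> fst j)) / card T)"
proof -
  obtain v \<psi> where j_eq: "j = (v, \<psi>)" by (cases j)
  have v: "v \<in> carrier G" and cont: "continuous_on UNIV (\<lambda>z. \<psi> (fst z) (snd z))"
    and bd: "\<And>z w. z \<in> sphere 0 1 \<Longrightarrow> w \<in> sphere 0 1 \<Longrightarrow> \<bar>\<psi> z w\<bar> \<le> 1"
    and mean: "(\<integral>x. \<psi> (f (\<tau> v x)) (f x) \<partial>M) = 0"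
    using j by (auto simp: centred_observable_def j_eq)
  have vg: "v \<cdot> g \<in> carrier G" using v g by simp
  let ?cg = "cell (T \<odot> g)" and ?cv = "cell (T \<odot> (v \<cdot> g))"
  define b where "b \<omega> = obs G (cell_field f T A c' \<omega>) j g" for \<omega>
  define b' where "b' = obs G c' j g"
  define Y where "Y x = \<psi> (f (\<tau> (v \<cdot> g) x)) (f (\<tau> g x))" for x
  define D where "D = {\<omega>\<in>space P. ?cg \<omega> \<noteq> ?cv \<omega>}"
  define Q where "Q h = {\<omega>\<in>space P. ?cg \<omega> \<in> {h}}" for h
  \<comment> \<open>The value that the observable would take if \<open>g\<close> and \<open>vg\<close> always shared their cell.\<close>
  define R where "R \<omega> = indicator {\<omega>\<in>space P. ?cg \<omega> \<in> A} \<omega> * b' + (\<Sum>h\<in>(T \<odot> g) - A. indicator (Q h) \<omega> * Y (snd (\<omega> h)))" for \<omega>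
  have fa: "(\<lambda>x. f (\<tau> u x)) \<in> borel_measurable M" if "u \<in> carrier G" for u
    by (rule measurable_compose[OF measurable_action[OF that] f_borel])
  have Ym: "Y \<in> borel_measurable M"
    unfolding Y_def by (rule borel_measurable_continuous_Pair[OF fa[OF vg] fa[OF g] cont])
  have Yb: "\<bar>Y x\<bar> \<le> 1" if "x \<in> space M" for x
    unfolding Y_def using that by (intro bd f_sphere action_in_space vg g)
  have Y0: "(\<integral>x. Y x \<partial>M) = 0"
  proof -
    have "(\<integral>x. Y x \<partial>M) = (\<integral>x. (\<lambda>x. \<psi> (f (\<tau> v x)) (f x)) (\<tau> g x) \<partial>M)"
      unfolding Y_def using v g by (intro Bochner_Integration.integral_cong refl) (simp add: action_mult)
    also have "\<dots> = (\<integral>x. \<psi> (f (\<tau> v x)) (f x) \<partial>M)"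
      by (rule integral_action[OF g borel_measurable_continuous_Pair[OF fa[OF v] f_borel cont]])
    also have "\<dots> = 0" by (rule mean)
    finally show ?thesis .
  qed
  have bm: "b \<in> borel_measurable P"
    unfolding b_def obs_def j_eq fst_conv snd_conv
    by (rule borel_measurable_continuous_Pair[OF cell_field_measurable[OF vg] cell_field_measurable[OF g] cont])
  have bb: "\<bar>b \<omega>\<bar> \<le> 1" if "\<omega> \<in> space P" for \<omega>
    unfolding b_def obs_def j_eq fst_conv snd_conv using that by (intro bd cell_field_sphere vg g)
  have b'b: "\<bar>b'\<bar> \<le> 1"
    unfolding b'_def obs_def j_eq fst_conv snd_conv by (intro bd c')
  have Qm: "Q h \<in> sets P" for h unfolding Q_def by (rule cell_event_measurable[OF g])
  have Dm: "D \<in> sets P" unfolding D_def by (rule cell_neq_measurable[OF g vg])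
  have Ycm: "(\<lambda>\<omega>. indicator (Q h) \<omega> * Y (snd (\<omega> h))) \<in> borel_measurable P" if "h \<in> T \<odot> g" for h
    using Qm measurable_compose[OF measurable_snd_coord Ym, of h "carrier G"] that coset_facts[OF g]
    by (intro borel_measurable_times) auto
  have Yci: "integrable P (\<lambda>\<omega>. indicator (Q h) \<omega> * Y (snd (\<omega> h)))" if "h \<in> T \<odot> g" for h
    using that coset_facts[OF g]
    by (intro P.integrable_const_bound[OF _ Ycm, where B = 1] AE_I2)
       (auto simp: indicator_def intro!: Yb label_space_snd)
  have Am: "{\<omega>\<in>space P. ?cg \<omega> \<in> A} \<in> sets P" by (rule cell_event_measurable[OF g])
  have Ai: "integrable P (indicator {\<omega>\<in>space P. ?cg \<omega> \<in> A} :: _ \<Rightarrow> real)"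
    by (rule integrable_real_indicator[OF Am]) (simp add: less_top[symmetric])
  have Ri: "integrable P R"
    unfolding R_def using Yci Ai by (intro Bochner_Integration.integrable_add Bochner_Integration.integrable_sum) auto
  have bi: "integrable P b"
    using bb by (intro P.integrable_const_bound[OF _ bm, where B = 1] AE_I2) auto
  have Rval: "R \<omega> = (if ?cg \<omega> \<in> A then b' else Y (snd (\<omega> (?cg \<omega>))))" if w: "\<omega> \<in> space P" for \<omega>
  proof -
    have "(\<Sum>h\<in>(T \<odot> g) - A. indicator (Q h) \<omega> * Y (snd (\<omega> h))) =
       (\<Sum>h\<in>(T \<odot> g) - A. if h = ?cg \<omega> then Y (snd (\<omega> h)) else 0)"
      using w by (intro sum.cong refl) (auto simp: Q_def indicator_def)
    also have "\<dots> = (if ?cg \<omega> \<in> A then 0 else Y (snd (\<omega> (?cg \<omega>))))"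
      using cell_in_coset[OF g] coset_facts[OF g] by (subst sum.delta) auto
    finally show ?thesis using w by (simp add: R_def)
  qed
  have diff: "\<bar>b \<omega> - R \<omega>\<bar> \<le> 2 * indicator D \<omega>" if w: "\<omega> \<in> space P" for \<omega>
  proof (cases "\<omega> \<in> D")
    case False
    then have same: "?cv \<omega> = ?cg \<omega>" using w by (simp add: D_def)
    have "b \<omega> = R \<omega>"
      by (simp add: Rval[OF w] b_def b'_def obs_def j_eq cell_field_def Let_def same Y_def)
    then show ?thesis by simp
  next
    case True
    have "cell (T \<odot> g) \<omega> \<in> carrier G" using cell_in_coset[OF g] coset_facts[OF g] by auto
    then have "\<bar>R \<omega>\<bar> \<le> 1" using Rval[OF w] b'b Yb label_space_snd[OF w] by auto
    then show ?thesis using bb[OF w] True by simp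
  qed
  have "P.expectation R = P.prob {\<omega>\<in>space P. ?cg \<omega> \<in> A} * b' + (\<Sum>h\<in>(T \<odot> g) - A. P.expectation (\<lambda>\<omega>. indicator (Q h) \<omega> * Y (snd (\<omega> h))))"
    unfolding R_def using Yci Am Ai by (subst Bochner_Integration.integral_add) (auto simp: Int_absorb1 sets.sets_into_space)
  also have "(\<Sum>h\<in>(T \<odot> g) - A. P.expectation (\<lambda>\<omega>. indicator (Q h) \<omega> * Y (snd (\<omega> h)))) = 0"
  proof (intro sum.neutral ballI)
    fix h assume "h \<in> (T \<odot> g) - A"
    then have h: "h \<in> carrier G" using coset_facts[OF g] by auto
    show "P.expectation (\<lambda>\<omega>. indicator (Q h) \<omega> * Y (snd (\<omega> h))) = 0"
    proof (rule expectation_label_on_cell_event[OF prob_space_axioms h Qm _ Ym Yb Y0])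
      fix \<omega> \<omega>' assume "\<And>i. i \<in> carrier G \<Longrightarrow> fst (\<omega> i) = fst (\<omega>' i)" "\<omega>' \<in> space P" "\<omega> \<in> Q h"
      moreover from this have "?cg \<omega> = ?cg \<omega>'" using coset_facts[OF g] by (intro cell_cong) auto
      ultimately show "\<omega>' \<in> Q h" by (simp add: Q_def)
    qed
  qed
  finally have ER: "P.expectation R = P.prob {\<omega>\<in>space P. ?cg \<omega> \<in> A} * b'" by simp
  have "\<bar>P.expectation b - P.expectation R\<bar> = \<bar>P.expectation (\<lambda>\<omega>. b \<omega> - R \<omega>)\<bar>"
    using bi Ri by simp
  also have "\<dots> \<le> P.expectation (\<lambda>\<omega>. \<bar>b \<omega> - R \<omega>\<bar>)" by (rule integral_abs_bound)
  also have "\<dots> \<le> P.expectation (\<lambda>\<omega>. 2 * indicator D \<omega>)"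
  proof (rule integral_mono)
    have "integrable P (indicator D :: _ \<Rightarrow> real)"
      by (rule integrable_real_indicator[OF Dm]) (simp add: less_top[symmetric])
    then show "integrable P (\<lambda>\<omega>. 2 * indicator D \<omega> :: real)" by simp
  qed (use bi Ri diff in auto)
  also have "\<dots> = 2 * P.prob D" using Dm by (simp add: Int_absorb1 sets.sets_into_space)
  also have "P.prob D \<le> card (sym_diff (T \<odot> g) (T \<odot> (v \<cdot> g))) / card (T \<odot> g)"
    unfolding D_def using coset_facts[OF g] coset_facts[OF vg] by (intro prob_cell_neq prob_space_axioms) auto
  also have "\<dots> = card (sym_diff T (T \<odot> v)) / card T"
    using grp.sym_diff_r_coset[OF T(3,1) v g] by simp
  finally show ?thesis by (simp add: ER b_def b'_def j_eq)
qed

end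

end

section \<open>Interpolation between two sequences\<close>

abbreviation discrepancy ::
    "('g, 'b) monoid_scheme \<Rightarrow> 'g set \<Rightarrow> ('g \<Rightarrow> real) \<Rightarrow> ('g \<Rightarrow> complex) \<Rightarrow> ('g \<Rightarrow> complex) \<Rightarrow>
     'g observable \<Rightarrow> 'g \<Rightarrow> real" where
  "discrepancy G W s c' c j g \<equiv>
     \<bar>\<Sum>w\<in>W. obs G c j (w \<otimes>\<^bsub>G\<^esub> g) - s (w \<otimes>\<^bsub>G\<^esub> g) * obs G c' j (w \<otimes>\<^bsub>G\<^esub> g)\<bar>"

text \<open>
  The sequence \<open>c\<close> agrees with \<open>c'\<close> deep inside \<open>A\<close>, and \<open>s\<close> is the local proportion of \<open>c'\<close> in \<open>c\<close>: up
  to \<open>e\<close>, every average over a window \<open>Wg\<close> of an observable of \<open>c\<close> is the average of \<open>s\<close> times the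
  observable of \<open>c'\<close>. The weight \<open>s\<close> changes by at most \<open>e\<close> under translation by \<open>K\<close>, and it vanishes
  away from \<open>A\<close>.
\<close>

definition interpolates ::
    "('g, 'b) monoid_scheme \<Rightarrow> 'g observable set \<Rightarrow> 'g set \<Rightarrow> real \<Rightarrow> 'g set \<Rightarrow>
     'g set \<Rightarrow> 'g set \<Rightarrow> ('g \<Rightarrow> complex) \<Rightarrow> ('g \<Rightarrow> complex) \<Rightarrow> ('g \<Rightarrow> real) \<Rightarrow> bool" where
  "interpolates G B K e T W A c' c s \<longleftrightarrow>
     (\<forall>g. c g \<in> sphere 0 1) \<and>
     (\<forall>g\<in>carrier G. T #>\<^bsub>G\<^esub> g \<subseteq> A \<longrightarrow> c g = c' g) \<and>
     (\<forall>g\<in>carrier G. 0 \<le> s g \<and> s g \<le> 1) \<and>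
     (\<forall>g\<in>carrier G. (T #>\<^bsub>G\<^esub> g) \<inter> A = {} \<longrightarrow> s g = 0) \<and>
     (\<forall>g\<in>carrier G. \<forall>k\<in>K. \<bar>s (k \<otimes>\<^bsub>G\<^esub> g) - s g\<bar> \<le> e) \<and>
     (\<forall>g\<in>carrier G. \<forall>j\<in>B.
        discrepancy G W s c' c j g \<le> e * card W)"

context measure_preserving_system
begin

text \<open>
  The weight \<open>s g\<close> is the probability that the cell of \<open>g\<close> lies in \<open>A\<close>; it varies slowly because the cells of
  \<open>g\<close> and \<open>kg\<close> rarely differ. Combining \<open>cell_field_expectation\<close> with \<open>window_concentration\<close> gives, for any
  finite set of places, a sequence whose windows there are all good. The requirements are closed conditions
  on a compact space, so they can be met everywhere at once. The sets \<open>T\<close> and \<open>W\<close> do not depend on \<open>A\<close> or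
  on \<open>c'\<close>.
\<close>

lemma interpolating_sequences_exist:
  fixes B :: "'g observable set" and e :: real
  assumes inf: "infinite (carrier G)" and F: "left_Folner_seq G F"
    and f: "f \<in> measurable M (restrict_space borel (sphere 0 1))"
    and B0: "finite B" "\<forall>j\<in>B. centred_observable f j"
    and K: "finite K" "K \<subseteq> carrier G" and e: "e > 0"
  shows "\<exists>T W. finite T \<and> T \<noteq> {} \<and> T \<subseteq> carrier G \<and> finite W \<and> W \<noteq> {} \<and> W \<subseteq> carrier G \<and>
    (\<forall>A c'. (\<forall>g. c' g \<in> sphere 0 1) \<longrightarrow> (\<exists>c s. interpolates G B K e T W A c' c s))"
proof -
  have B: "finite B" "\<And>j. j \<in> B \<Longrightarrow> centred_observable f j" using B0 by auto
  interpret grp: group G by (rule acting_group)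
  let ?P = "labelling (carrier G) M"
  interpret P: prob_space ?P
    using prob_space_axioms by (intro prob_space_PiM prob_space_label_space)
  \<comment> \<open>One quarter for the deviation of window sums, two for the expectations.\<close>
  define \<delta> where "\<delta> = e / 4"
  have \<delta>: "\<delta> > 0" using e by (simp add: \<delta>_def)
  have Bv: "fst j \<in> carrier G" if "j \<in> B" for j using B(2)[OF that] by (simp add: centred_observable_def)
  have KB: "finite (K \<union> fst ` B)" "K \<union> fst ` B \<subseteq> carrier G" using K B Bv by auto
  obtain T where T: "finite T" "T \<noteq> {}" "T \<subseteq> carrier G"
    and Tinv: "\<And>k. k \<in> K \<union> fst ` B \<Longrightarrow> real (card (sym_diff T (T \<odot> k))) \<le> \<delta> * card T"
    using grp.right_Folner_set_exists[OF F KB \<delta>] by auto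
  have cT: "card T > 0" using T by (simp add: card_gt_0_iff)
  have Tinv': "real (card (sym_diff T (T \<odot> k))) / card T \<le> \<delta>" if "k \<in> K \<union> fst ` B" for k
    using Tinv[OF that] cT by (simp add: pos_divide_le_eq)
  \<comment> \<open>The observables at \<open>g\<close> depend on the labels in \<open>Lg\<close> only.\<close>
  define L where "L = T \<union> (\<Union>j\<in>B. T \<odot> fst j)"
  have Tc: "T \<odot> v \<subseteq> carrier G" "finite (T \<odot> v)" if "v \<in> carrier G" for v
    using grp.r_coset_subset_G[OF T(3) that] T by (auto simp: r_coset_def)
  have L: "finite L" "L \<subseteq> carrier G"
    unfolding L_def using T(1,3) B(1) Tc(2)[OF Bv] Tc(1)[OF Bv] by (blast, intro Un_least UN_least) simp_all
  obtain W where W: "finite W" "W \<noteq> {}" "W \<subseteq> carrier G"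
    and conc: "\<forall>(N :: (real \<times> 'x) measure) (B' :: 'g observable set) b D. prob_space N \<longrightarrow> finite B' \<longrightarrow> card B' \<le> card B \<longrightarrow>
       finite D \<longrightarrow> D \<subseteq> carrier G \<longrightarrow>
       local_family G N L B' b \<longrightarrow>
       (\<exists>\<omega>\<in>space (PiM (carrier G) (\<lambda>_. N)). \<forall>g\<in>D. \<forall>j\<in>B'.
          \<bar>\<Sum>w\<in>W. b j (w \<cdot> g) \<omega> - integral\<^sup>L (PiM (carrier G) (\<lambda>_. N)) (b j (w \<cdot> g))\<bar> \<le> \<delta> * card W)"
    using grp.window_concentration[OF inf L \<delta>, of "card B"] by (elim exE conjE) (rule that, assumption+)
  show ?thesis
  proof (rule exI[of _ T], rule exI[of _ W], intro conjI T W allI impI)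
    fix A and c' :: "'g \<Rightarrow> complex" assume c': "\<forall>g. c' g \<in> sphere (0::complex) 1"
    let ?cf = "cell_field f T A c'"
    define s where "s g = P.prob {\<omega>\<in>space ?P. cell (T \<odot> g) \<omega> \<in> A}" for g
    define b where "b j g \<omega> = obs G (?cf \<omega>) j g" for j g \<omega>
    have c'': "c' g \<in> sphere 0 1" for g using c' by blast
    note cf_sphere = cell_field_sphere[where c' = c' and A = A, OF f T c'']
      and cf_meas = cell_field_measurable[where c' = c' and A = A, OF f T c'']
      and cf_dep = cell_field_depends[where c' = c' and A = A, OF f T c'']
      and cf_exp = cell_field_expectation[where c' = c' and A = A, OF f T c'']
      and in_coset = cell_in_coset[where c' = c', OF f T c'']
      and cosets = coset_facts[where c' = c', OF f T c'']
      and event_meas = cell_event_measurable[where c' = c', OF f T c'']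
      and neq_meas = cell_neq_measurable[where c' = c', OF f T c'']
    define good where "good g = {c. (T \<odot> g \<subseteq> A \<longrightarrow> c g = c' g) \<and>
        (\<forall>j\<in>B. discrepancy G W s c' c j g \<le> e * card W)}" for g
    have bprop: "b j g \<in> borel_measurable ?P \<and> (\<forall>\<omega>\<in>space ?P. \<bar>b j g \<omega>\<bar> \<le> 1) \<and> depends_on (space ?P) (L \<odot> g) (b j g)"
      if j: "j \<in> B" and g: "g \<in> carrier G" for j g
    proof -
      obtain v \<psi> where j_eq: "j = (v, \<psi>)" by (cases j)
      have v: "v \<in> carrier G" and cont: "continuous_on UNIV (\<lambda>z. \<psi> (fst z) (snd z))"
        and bd: "\<And>z w. z \<in> sphere 0 1 \<Longrightarrow> w \<in> sphere 0 1 \<Longrightarrow> \<bar>\<psi> z w\<bar> \<le> 1"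
        using B(2)[OF j] by (auto simp: centred_observable_def j_eq)
      have vg: "v \<cdot> g \<in> carrier G" using v g by simp
      have 1: "b j g \<in> borel_measurable ?P"
        unfolding b_def obs_def j_eq fst_conv snd_conv
        by (rule borel_measurable_continuous_Pair[OF cf_meas[OF vg] cf_meas[OF g] cont])
      have 2: "\<bar>b j g \<omega>\<bar> \<le> 1" if "\<omega> \<in> space ?P" for \<omega>
        unfolding b_def obs_def j_eq fst_conv snd_conv using cf_sphere that vg g by (intro bd) auto
      have "T \<odot> g \<subseteq> L \<odot> g" by (auto simp: r_coset_def L_def)
      moreover have "T \<odot> (v \<cdot> g) \<subseteq> L \<odot> g"
      proof -
        have "T \<odot> v \<subseteq> L" using j by (auto simp: L_def j_eq)
        then have "(T \<odot> v) \<odot> g \<subseteq> L \<odot> g" by (auto simp: r_coset_def)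
        then show ?thesis using grp.coset_mult_assoc[OF T(3) v g] by simp
      qed
      ultimately have 3: "b j g \<omega> = b j g \<omega>'" if "\<forall>i\<in>L \<odot> g. \<omega> i = \<omega>' i" for \<omega> \<omega>'
        using that cf_dep[OF vg, of \<omega> \<omega>'] cf_dep[OF g, of \<omega> \<omega>']
        by (auto simp: b_def obs_def j_eq subset_iff)
      show ?thesis using 1 2 3 by (auto simp: depends_on_def)
    qed
    have lf: "local_family G (label_space M) L B b" using bprop by (simp add: local_family_def)
    have bexp: "\<bar>P.expectation (b j g) - s g * obs G c' j g\<bar> \<le> 2 * \<delta>" if j: "j \<in> B" and g: "g \<in> carrier G" for j g
      using cf_exp[OF B(2)[OF j] g] Tinv'[of "fst j"] j
      unfolding b_def s_def by fastforce
    have fin: "{c. \<forall>g. c g \<in> sphere 0 1} \<inter> (\<Inter>g\<in>D. good g) \<noteq> {}" if D: "finite D" "D \<subseteq> carrier G" for D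
    proof -
      obtain \<omega> where w: "\<omega> \<in> space ?P" and dev: "\<And>g j. g \<in> D \<Longrightarrow> j \<in> B \<Longrightarrow>
          \<bar>\<Sum>w\<in>W. b j (w \<cdot> g) \<omega> - P.expectation (b j (w \<cdot> g))\<bar> \<le> \<delta> * card W"
        using conc[rule_format, OF prob_space_label_space[OF prob_space_axioms] B(1) le_refl D lf] by blast
      define c where "c g = (if g \<in> carrier G then ?cf \<omega> g else 1)" for g
      have cs: "c g \<in> sphere 0 1" for g
        using cf_sphere[OF _ w, of g] by (auto simp: c_def)
      have "c \<in> good g" if g: "g \<in> D" for g
      proof -
        have gc: "g \<in> carrier G" using g D by auto
        have wg: "w \<cdot> g \<in> carrier G" if "w \<in> W" for w using gc that W by auto
        have "c g = c' g" if "T \<odot> g \<subseteq> A"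
          using that in_coset[OF gc, of \<omega>] gc by (auto simp: c_def cell_field_def Let_def)
        moreover have "discrepancy G W s c' c j g \<le> e * card W"
          if j: "j \<in> B" for j
        proof -
          have ob: "obs G c j (w \<cdot> g) = b j (w \<cdot> g) \<omega>" if "w \<in> W" for w
            using wg[OF that] Bv[OF j] by (simp add: obs_def b_def c_def)
          have "(\<Sum>w\<in>W. obs G c j (w \<cdot> g) - s (w \<cdot> g) * obs G c' j (w \<cdot> g)) =
            (\<Sum>w\<in>W. b j (w \<cdot> g) \<omega> - P.expectation (b j (w \<cdot> g))) +
            (\<Sum>w\<in>W. P.expectation (b j (w \<cdot> g)) - s (w \<cdot> g) * obs G c' j (w \<cdot> g))"
            by (simp add: ob flip: sum.distrib cong: sum.cong)
          also have "\<bar>\<dots>\<bar> \<le> \<delta> * card W + (\<Sum>w\<in>W. 2 * \<delta>)"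
          proof -
            have "\<bar>\<Sum>w\<in>W. P.expectation (b j (w \<cdot> g)) - s (w \<cdot> g) * obs G c' j (w \<cdot> g)\<bar> \<le> (\<Sum>w\<in>W. 2 * \<delta>)"
              using bexp[OF j wg] by (intro order_trans[OF sum_abs] sum_mono)
            then show ?thesis using dev[OF g j] by linarith
          qed
          also have "\<dots> \<le> e * card W" using e by (simp add: \<delta>_def algebra_simps)
          finally show ?thesis .
        qed
        ultimately show ?thesis by (simp add: good_def)
      qed
      then show ?thesis using cs by blast
    qed
    have closed: "closed (good g)" if g: "g \<in> carrier G" for g
    proof -
      have e: "continuous_on UNIV (\<lambda>c :: 'g \<Rightarrow> complex. c h)" for h by (rule continuous_on_product_coordinates)
      have "continuous_on UNIV (\<lambda>c. obs G c j h)" if j: "j \<in> B" for j h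
      proof -
        have "continuous_on UNIV (\<lambda>z. snd j (fst z) (snd z))" using B(2)[OF j] by (auto simp: centred_observable_def)
        from continuous_on_compose2[OF this continuous_on_Pair[OF e[of "fst j \<cdot> h"] e[of h]]]
        show ?thesis by (simp add: obs_def)
      qed
      then have "closed {c. discrepancy G W s c' c j g \<le> e * card W}"
        if "j \<in> B" for j
        using that by (intro closed_Collect_le continuous_intros) auto
      moreover have "closed {c. T \<odot> g \<subseteq> A \<longrightarrow> c g = c' g}"
        by (cases "T \<odot> g \<subseteq> A") (auto intro!: closed_Collect_eq e continuous_intros)
      ultimately have "closed ({c. T \<odot> g \<subseteq> A \<longrightarrow> c g = c' g} \<inter> (\<Inter>j\<in>B. {c. discrepancy G W s c' c j g \<le> e * card W}))"
        by (intro closed_Int closed_INT) auto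
      moreover have "good g = {c. T \<odot> g \<subseteq> A \<longrightarrow> c g = c' g} \<inter> (\<Inter>j\<in>B. {c. discrepancy G W s c' c j g \<le> e * card W})"
        by (auto simp: good_def)
      ultimately show ?thesis by simp
    qed
    have "{c. \<forall>g. c g \<in> sphere 0 1} \<inter> (\<Inter>g\<in>carrier G. good g) \<noteq> {}"
      by (rule compact_imp_fip_image[OF compact_sphere_functions closed fin])
    then obtain c where c: "\<forall>g. c g \<in> sphere 0 1" and cg: "\<And>g. g \<in> carrier G \<Longrightarrow> c \<in> good g" by blast
    have s01: "0 \<le> s g \<and> s g \<le> 1" for g by (simp add: s_def)
    have s0: "s g = 0" if "g \<in> carrier G" "(T \<odot> g) \<inter> A = {}" for g
    proof -
      have "{\<omega>\<in>space ?P. cell (T \<odot> g) \<omega> \<in> A} = {}" using in_coset[OF that(1)] that(2) by auto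
      then show ?thesis unfolding s_def by (simp only: measure_empty)
    qed
    have slow: "\<bar>s (k \<cdot> g) - s g\<bar> \<le> e" if g: "g \<in> carrier G" and k: "k \<in> K" for g k
    proof -
      have kc: "k \<in> carrier G" using k K by auto
      have kg: "k \<cdot> g \<in> carrier G" using kc g by simp
      let ?E = "\<lambda>g. {\<omega>\<in>space ?P. cell (T \<odot> g) \<omega> \<in> A}"
      let ?D = "{\<omega>\<in>space ?P. cell (T \<odot> g) \<omega> \<noteq> cell (T \<odot> (k \<cdot> g)) \<omega>}"
      have m: "?E g \<in> P.events" "?E (k \<cdot> g) \<in> P.events" "?D \<in> P.events"
        using event_meas[OF g] event_meas[OF kg] neq_meas[OF g kg] by auto
      have "s g \<le> P.prob (?E (k \<cdot> g) \<union> ?D)" unfolding s_def by (intro P.finite_measure_mono sets.Un m) auto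
      also have "\<dots> \<le> s (k \<cdot> g) + P.prob ?D" unfolding s_def by (intro measure_Un_le m)
      finally have 1: "s g \<le> s (k \<cdot> g) + P.prob ?D" .
      have "s (k \<cdot> g) \<le> P.prob (?E g \<union> ?D)" unfolding s_def by (intro P.finite_measure_mono sets.Un m) auto
      also have "\<dots> \<le> s g + P.prob ?D" unfolding s_def by (intro measure_Un_le m)
      finally have 2: "s (k \<cdot> g) \<le> s g + P.prob ?D" .
      have "P.prob ?D \<le> card (sym_diff (T \<odot> g) (T \<odot> (k \<cdot> g))) / card (T \<odot> g)"
        using Tc[OF g] Tc[OF kg] cosets(2)[OF g] by (intro prob_cell_neq prob_space_axioms) auto
      also have "\<dots> = card (sym_diff T (T \<odot> k)) / card T"
        using grp.sym_diff_r_coset[OF T(3,1) kc g] by simp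
      also have "\<dots> \<le> \<delta>" using Tinv' k by blast
      also have "\<delta> \<le> e" using e by (simp add: \<delta>_def)
      finally show ?thesis using 1 2 by linarith
    qed
    show "\<exists>c s. interpolates G B K e T W A c' c s"
      using c cg s01 s0 slow
      by (intro exI[of _ c] exI[of _ s]) (auto simp: good_def interpolates_def)
  qed
qed

end

section \<open>Sequences with prescribed averages along a Folner sequence\<close>

text \<open>
  Window averages are small off a finite set. Unlike the averages along \<open>F\<close>, this property survives
  multiplication by slowly varying weights.
\<close>

definition window_uniform :: "('g, 'b) monoid_scheme \<Rightarrow> ('g \<Rightarrow> complex) \<Rightarrow> 'g observable set \<Rightarrow> real \<Rightarrow> bool" where
  "window_uniform G c B e \<longleftrightarrow> (\<exists>W Z. finite W \<and> W \<noteq> {} \<and> W \<subseteq> carrier G \<and> finite Z \<and>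
     (\<forall>g\<in>carrier G - Z. \<forall>j\<in>B. \<bar>\<Sum>w\<in>W. obs G c j (w \<otimes>\<^bsub>G\<^esub> g)\<bar> \<le> e * card W))"

text \<open>
  Averages over \<open>A\<close> may be replaced by averages of window averages, uniformly over all functions bounded by
  one.
\<close>

definition averages_windows :: "('g, 'b) monoid_scheme \<Rightarrow> 'g set \<Rightarrow> 'g set \<Rightarrow> real \<Rightarrow> bool" where
  "averages_windows G A W e \<longleftrightarrow> (\<forall>\<phi> :: 'g \<Rightarrow> real. (\<forall>g\<in>carrier G. \<bar>\<phi> g\<bar> \<le> 1) \<longrightarrow>
     \<bar>(\<Sum>g\<in>A. \<Sum>w\<in>W. \<phi> (w \<otimes>\<^bsub>G\<^esub> g)) - card W * (\<Sum>g\<in>A. \<phi> g)\<bar> \<le> e * real (card W) * real (card A))"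

context group
begin

lemma Folner_eventually_invariant:
  fixes e :: real
  assumes F: "left_Folner_seq G F" and K: "finite K" "K \<subseteq> carrier G" and e: "e > 0"
  shows "\<forall>\<^sub>F n in sequentially. \<forall>k\<in>K. real (card (sym_diff (F n) (k <# F n))) \<le> e * card (F n)"
proof -
  have "\<forall>\<^sub>F n in sequentially. \<forall>k\<in>K. real (card (sym_diff (F n) (k <# F n))) / real (card (F n)) < e"
    using F K e by (intro eventually_ball_finite K ballI order_tendstoD(2)[of _ 0]) (auto simp: left_Folner_seq_def)
  then show ?thesis
  proof eventually_elim
    case (elim n)
    have "card (F n) > 0" using F by (auto simp: left_Folner_seq_def card_gt_0_iff)
    then show ?case using elim by (simp add: pos_divide_less_eq less_imp_le)
  qed
qed

text \<open>
  A set of fewer than \<open>m\<close> points that is moved by each element of \<open>K\<close> in less than one point is invariant under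
  \<open>K\<close>, so it contains a translate of \<open>K\<close>, which is too large if \<open>card K = m + 1\<close>.
\<close>

lemma Folner_card_at_top:
  assumes inf: "infinite (carrier G)" and F: "left_Folner_seq G F"
  shows "filterlim (\<lambda>n. card (F n)) at_top sequentially"
proof (subst filterlim_at_top, intro allI)
  fix m :: nat
  obtain K where K: "K \<subseteq> carrier G" "finite K" "card K = Suc m"
    using infinite_arbitrarily_large[OF inf] by blast
  have "\<forall>\<^sub>F n in sequentially. \<forall>k\<in>K. real (card (sym_diff (F n) (k <# F n))) \<le> 1 / Suc m * card (F n)"
    by (rule Folner_eventually_invariant[OF F K(2,1)]) simp
  then show "\<forall>\<^sub>F n in sequentially. m \<le> card (F n)"
  proof eventually_elim
    case (elim n)
    have Fn: "finite (F n)" "F n \<noteq> {}" "F n \<subseteq> carrier G" using F by (auto simp: left_Folner_seq_def)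
    show ?case
    proof (rule ccontr)
      assume less: "\<not> m \<le> card (F n)"
      obtain x where x: "x \<in> F n" using Fn by auto
      have xc: "x \<in> carrier G" using x Fn by auto
      have "k \<otimes> x \<in> F n" if k: "k \<in> K" for k
      proof -
        have "real (card (sym_diff (F n) (k <# F n))) \<le> 1 / Suc m * card (F n)" using elim k by blast
        also have "\<dots> < 1" using less by (simp add: field_simps)
        finally have "card (sym_diff (F n) (k <# F n)) = 0" by simp
        moreover have "finite (k <# F n)" using Fn by (simp add: l_coset_def)
        ultimately have "sym_diff (F n) (k <# F n) = {}" using Fn(1) by simp
        moreover have "k \<otimes> x \<in> k <# F n" using x by (auto simp: l_coset_def)
        ultimately show ?thesis by blast
      qed
      then have "(\<lambda>k. k \<otimes> x) ` K \<subseteq> F n" by auto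
      moreover have "inj_on (\<lambda>k. k \<otimes> x) K" using K xc by (intro inj_onI) (auto simp: subset_iff)
      ultimately have "card K \<le> card (F n)" using card_inj_on_le Fn by blast
      then show False using less K by simp
    qed
  qed
qed

lemma sum_translate_le:
  fixes \<phi> :: "'a \<Rightarrow> real"
  assumes A: "finite A" "A \<subseteq> carrier G" and w: "w \<in> carrier G" and \<phi>: "\<And>g. g \<in> carrier G \<Longrightarrow> \<bar>\<phi> g\<bar> \<le> 1"
  shows "\<bar>(\<Sum>g\<in>A. \<phi> (w \<otimes> g)) - (\<Sum>g\<in>A. \<phi> g)\<bar> \<le> card (sym_diff A (w <# A))"
proof -
  have wA: "w <# A = (\<lambda>g. w \<otimes> g) ` A" by (auto simp: l_coset_def)
  have inj: "inj_on (\<lambda>g. w \<otimes> g) A" using A w by (intro inj_onI) (auto simp: subset_iff)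
  have fin: "finite (w <# A)" using A by (simp add: wA)
  have wAc: "w <# A \<subseteq> carrier G" using A w by (auto simp: wA)
  have "(\<Sum>g\<in>A. \<phi> (w \<otimes> g)) = sum \<phi> (w <# A)" unfolding wA by (simp add: sum.reindex[OF inj])
  also have "\<dots> = sum \<phi> ((w <# A) - A) + sum \<phi> ((w <# A) \<inter> A)"
    using sum.Int_Diff[OF fin, of \<phi> A] by simp
  also have "sum \<phi> ((w <# A) \<inter> A) = sum \<phi> A - sum \<phi> (A - (w <# A))"
    using sum.Int_Diff[OF A(1), of \<phi> "w <# A"] by (simp add: Int_commute)
  finally have "\<bar>(\<Sum>g\<in>A. \<phi> (w \<otimes> g)) - (\<Sum>g\<in>A. \<phi> g)\<bar> = \<bar>sum \<phi> ((w <# A) - A) - sum \<phi> (A - (w <# A))\<bar>" by simp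
  also have "\<dots> \<le> \<bar>sum \<phi> ((w <# A) - A)\<bar> + \<bar>sum \<phi> (A - (w <# A))\<bar>" by linarith
  also have "\<dots> \<le> (\<Sum>g\<in>(w <# A) - A. 1) + (\<Sum>g\<in>A - (w <# A). 1)"
    using A wAc \<phi> by (intro add_mono order_trans[OF sum_abs] sum_mono) auto
  also have "\<dots> = card (sym_diff A (w <# A))"
    using fin A by (subst card_Un_disjoint) auto
  finally show ?thesis .
qed

lemma Folner_window_average:
  fixes e :: real
  assumes F: "left_Folner_seq G F" and W: "finite W" "W \<subseteq> carrier G" and e: "e > 0"
  shows "\<forall>\<^sub>F n in sequentially. averages_windows G (F n) W e"
  using Folner_eventually_invariant[OF F W e]
proof eventually_elim
  case (elim n)
  have Fn: "finite (F n)" "F n \<subseteq> carrier G" using F by (auto simp: left_Folner_seq_def)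
  show ?case
    unfolding averages_windows_def
  proof (intro allI impI)
    fix \<phi> :: "'a \<Rightarrow> real" assume \<phi>: "\<forall>g\<in>carrier G. \<bar>\<phi> g\<bar> \<le> 1"
    have "(\<Sum>g\<in>F n. \<Sum>w\<in>W. \<phi> (w \<otimes> g)) - card W * (\<Sum>g\<in>F n. \<phi> g) = (\<Sum>w\<in>W. (\<Sum>g\<in>F n. \<phi> (w \<otimes> g)) - (\<Sum>g\<in>F n. \<phi> g))"
      by (subst sum.swap) (simp add: sum_subtractf)
    also have "\<bar>\<dots>\<bar> \<le> (\<Sum>w\<in>W. e * card (F n))"
    proof (intro order_trans[OF sum_abs] sum_mono)
      fix w assume w: "w \<in> W"
      have "\<bar>(\<Sum>g\<in>F n. \<phi> (w \<otimes> g)) - (\<Sum>g\<in>F n. \<phi> g)\<bar> \<le> card (sym_diff (F n) (w <# F n))"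
        using w W Fn \<phi> by (intro sum_translate_le) auto
      also have "\<dots> \<le> e * card (F n)" using elim w by blast
      finally show "\<bar>(\<Sum>g\<in>F n. \<phi> (w \<otimes> g)) - (\<Sum>g\<in>F n. \<phi> g)\<bar> \<le> e * card (F n)" .
    qed
    finally show "\<bar>(\<Sum>g\<in>F n. \<Sum>w\<in>W. \<phi> (w \<otimes> g)) - card W * (\<Sum>g\<in>F n. \<phi> g)\<bar> \<le> e * card W * card (F n)"
      by (simp add: algebra_simps)
  qed
qed

end

context measure_preserving_system
begin

lemma obs_bound:
  assumes "centred_observable f j" "\<And>g. c g \<in> sphere 0 1"
  shows "\<bar>obs G c j g\<bar> \<le> 1"
proof -
  have "\<forall>z\<in>sphere 0 1. \<forall>w\<in>sphere 0 1. \<bar>snd j z w\<bar> \<le> 1" using assms(1) by (simp add: centred_observable_def)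
  then show ?thesis unfolding obs_def using assms(2)[of g] assms(2)[of "fst j \<cdot> g"] by blast
qed

text \<open>
  The new sequence \<open>c\<close> keeps \<open>c'\<close> on the finite set \<open>D\<close> and improves the quality from \<open>e'\<close> to \<open>e\<close> at
  infinity. What matters is that \<open>N\<close> is chosen before \<open>D\<close>: although the zone in which \<open>c\<close> passes from
  \<open>c'\<close> to the new sequence depends on \<open>D\<close>, it never disturbs the averages over \<open>F n\<close> for \<open>n \<ge> N\<close> by more
  than a multiple of \<open>e'\<close>. To see this, replace \<open>c\<close> on \<open>F n\<close> by its averages over \<open>W\<close>, hence by the
  weighted observable of \<open>c'\<close>; replace this in turn by its averages over the window \<open>W'\<close> of \<open>c'\<close>, pull the
  slowly varying weight out of them, and use that the window averages of \<open>c'\<close> are small.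
\<close>

lemma refinement_step:
  fixes e e' :: real
  assumes inf: "infinite (carrier G)" and F: "left_Folner_seq G F"
    and f: "f \<in> measurable M (restrict_space borel (sphere 0 1))"
    and B0: "finite B" "\<forall>j\<in>B. centred_observable f j" "B' \<subseteq> B"
    and e: "e > 0" "e \<le> e'"
    and c': "\<And>g. c' g \<in> sphere 0 1" "window_uniform G c' B' e'"
  shows "\<exists>N. \<forall>D. finite D \<longrightarrow> D \<subseteq> carrier G \<longrightarrow> (\<exists>c. (\<forall>g. c g \<in> sphere 0 1) \<and> (\<forall>g\<in>D. c g = c' g) \<and>
     window_uniform G c B e \<and> (\<forall>n\<ge>N. \<forall>j\<in>B'. \<bar>\<Sum>g\<in>F n. obs G c j g\<bar> \<le> 7 * e' * card (F n)))"
proof -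
  have B: "finite B" "\<And>j. j \<in> B \<Longrightarrow> centred_observable f j" "B' \<subseteq> B" using B0 by auto
  interpret grp: group G by (rule acting_group)
  have e': "e' > 0" using e by simp
  obtain W' Z' where W': "finite W'" "W' \<noteq> {}" "W' \<subseteq> carrier G" and Z': "finite Z'"
    and u': "\<And>g j. g \<in> carrier G - Z' \<Longrightarrow> j \<in> B' \<Longrightarrow> \<bar>\<Sum>w\<in>W'. obs G c' j (w \<cdot> g)\<bar> \<le> e' * card W'"
    using c'(2) unfolding window_uniform_def by blast
  obtain T W where T: "finite T" "T \<noteq> {}" "T \<subseteq> carrier G" and W: "finite W" "W \<noteq> {}" "W \<subseteq> carrier G"
    and mix: "\<forall>A c'. (\<forall>g. c' g \<in> sphere 0 1) \<longrightarrow> (\<exists>c s. interpolates G B W' e T W A c' c s)"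
    using interpolating_sequences_exist[OF inf F f B0(1,2) W'(1,3) e(1)] by (elim exE conjE) (rule that, assumption+)
  have "\<forall>\<^sub>F n in sequentially. real (card Z') / e' \<le> card (F n)"
    using filterlim_compose[OF filterlim_real_sequentially grp.Folner_card_at_top[OF inf F]]
    by (simp add: filterlim_at_top)
  with grp.Folner_window_average[OF F W(1,3) e'] grp.Folner_window_average[OF F W'(1,3) e']
  have "\<forall>\<^sub>F n in sequentially. real (card Z') \<le> e' * card (F n) \<and>
      averages_windows G (F n) W e' \<and> averages_windows G (F n) W' e'"
  proof eventually_elim
    case (elim n)
    have "real (card Z') \<le> e' * card (F n)" using elim(3) e' by (simp add: divide_le_eq mult.commute)
    then show ?case using elim(1,2) by blast
  qed
  then obtain N where N: "\<And>n. n \<ge> N \<Longrightarrow> real (card Z') \<le> e' * card (F n)"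
    "\<And>n. n \<ge> N \<Longrightarrow> averages_windows G (F n) W e'" "\<And>n. n \<ge> N \<Longrightarrow> averages_windows G (F n) W' e'"
    unfolding eventually_sequentially by blast
  show ?thesis
  proof (rule exI[of _ N], intro allI impI)
    fix D assume D: "finite D" "D \<subseteq> carrier G"
    define A where "A = (\<Union>g\<in>D. T \<odot> g)"
    have finA: "finite A" using D T by (auto simp: A_def r_coset_def)
    have Ac: "A \<subseteq> carrier G" using D T by (auto simp: A_def r_coset_def)
    obtain c s where all: "\<forall>g. c g \<in> sphere 0 1"
        "\<forall>g\<in>carrier G. T \<odot> g \<subseteq> A \<longrightarrow> c g = c' g"
        "\<forall>g\<in>carrier G. 0 \<le> s g \<and> s g \<le> 1"
        "\<forall>g\<in>carrier G. (T \<odot> g) \<inter> A = {} \<longrightarrow> s g = 0"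
        "\<forall>g\<in>carrier G. \<forall>k\<in>W'. \<bar>s (k \<cdot> g) - s g\<bar> \<le> e"
        "\<forall>g\<in>carrier G. \<forall>j\<in>B. discrepancy G W s c' c j g \<le> e * card W"
      using mix[rule_format, of c' A, OF c'(1)] unfolding interpolates_def
      by (elim exE conjE) (rule that)
    note c = all(1)[rule_format] and cc' = all(2)[rule_format]
      and s01 = conjunct1[OF all(3)[rule_format]] conjunct2[OF all(3)[rule_format]]
      and s0 = all(4)[rule_format] and slow = all(5)[rule_format] and win = all(6)[rule_format]
    \<comment> \<open>Off \<open>Z\<close> the weight vanishes on the whole window, so that \<open>c\<close> is as good as a purely random sequence.\<close>
    define Z where "Z = (\<lambda>(w, t, a). inv\<^bsub>G\<^esub> w \<cdot> (inv\<^bsub>G\<^esub> t \<cdot> a)) ` (W \<times> T \<times> A)"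
    have sZ: "s (w \<cdot> g) = 0" if g: "g \<in> carrier G - Z" and w: "w \<in> W" for g w
    proof (rule s0)
      show wg: "w \<cdot> g \<in> carrier G" using g w W by auto
      show "(T \<odot> (w \<cdot> g)) \<inter> A = {}"
      proof (rule ccontr)
        assume "(T \<odot> (w \<cdot> g)) \<inter> A \<noteq> {}"
        then obtain t where t: "t \<in> T" "t \<cdot> (w \<cdot> g) \<in> A" by (auto simp: r_coset_def)
        define a where "a = t \<cdot> (w \<cdot> g)"
        have car: "t \<in> carrier G" "w \<in> carrier G" "g \<in> carrier G" using t w g T W by auto
        have "g = inv\<^bsub>G\<^esub> w \<cdot> (inv\<^bsub>G\<^esub> t \<cdot> a)"
          using car by (simp add: a_def grp.m_assoc[symmetric])
        then have "g \<in> Z" using t w unfolding Z_def a_def by force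
        then show False using g by simp
      qed
    qed
    have "window_uniform G c B e"
      unfolding window_uniform_def
    proof (rule exI[of _ W], rule exI[of _ Z], intro conjI W ballI)
      show "finite Z" using W T finA by (simp add: Z_def)
      fix g j assume g: "g \<in> carrier G - Z" and j: "j \<in> B"
      have "(\<Sum>w\<in>W. obs G c j (w \<cdot> g)) = (\<Sum>w\<in>W. obs G c j (w \<cdot> g) - s (w \<cdot> g) * obs G c' j (w \<cdot> g))"
        using sZ[OF g] by simp
      then show "\<bar>\<Sum>w\<in>W. obs G c j (w \<cdot> g)\<bar> \<le> e * card W" using win[of g j] g j by simp
    qed
    moreover have "c g = c' g" if "g \<in> D" for g
      using that D by (intro cc') (auto simp: A_def)
    moreover have "\<bar>\<Sum>g\<in>F n. obs G c j g\<bar> \<le> 7 * e' * card (F n)" if n: "n \<ge> N" and j: "j \<in> B'" for n j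
    proof -
      have jB: "j \<in> B" using j B by auto
      have Fn: "finite (F n)" "F n \<subseteq> carrier G" using F by (auto simp: left_Folner_seq_def)
      define b where "b = obs G c j"
      define b' where "b' = obs G c' j"
      define \<phi> where "\<phi> g = s g * b' g" for g
      have b1: "\<bar>b g\<bar> \<le> 1" "\<bar>b' g\<bar> \<le> 1" for g
        unfolding b_def b'_def using obs_bound[OF B(2)[OF jB]] c c' by auto
      have \<phi>1: "\<bar>\<phi> g\<bar> \<le> 1" if "g \<in> carrier G" for g
        unfolding \<phi>_def abs_mult using s01[OF that] b1 by (intro mult_le_one) auto
      have cW: "real (card W) > 0" "real (card W') > 0" using W W' by (auto simp: card_gt_0_iff)
      have e1: "\<bar>(\<Sum>g\<in>F n. \<Sum>w\<in>W. b (w \<cdot> g)) - card W * (\<Sum>g\<in>F n. b g)\<bar> \<le> e' * card W * card (F n)"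
        using N(2)[OF n, unfolded averages_windows_def] b1 by blast
      have e3: "\<bar>(\<Sum>g\<in>F n. \<Sum>w\<in>W. \<phi> (w \<cdot> g)) - card W * (\<Sum>g\<in>F n. \<phi> g)\<bar> \<le> e' * card W * card (F n)"
        using N(2)[OF n, unfolded averages_windows_def] \<phi>1 by blast
      have e4: "\<bar>(\<Sum>g\<in>F n. \<Sum>w\<in>W'. \<phi> (w \<cdot> g)) - card W' * (\<Sum>g\<in>F n. \<phi> g)\<bar> \<le> e' * card W' * card (F n)"
        using N(3)[OF n, unfolded averages_windows_def] \<phi>1 by blast
      have e2: "\<bar>(\<Sum>g\<in>F n. \<Sum>w\<in>W. b (w \<cdot> g)) - (\<Sum>g\<in>F n. \<Sum>w\<in>W. \<phi> (w \<cdot> g))\<bar> \<le> e' * card W * card (F n)"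
      proof -
        have "\<bar>\<Sum>g\<in>F n. \<Sum>w\<in>W. b (w \<cdot> g) - \<phi> (w \<cdot> g)\<bar> \<le> (\<Sum>g\<in>F n. e * card W)"
          unfolding b_def b'_def \<phi>_def using win[OF _ jB] Fn(2) by (intro order_trans[OF sum_abs sum_mono]) auto
        also have "\<dots> \<le> e' * card W * card (F n)"
          using mult_right_mono[OF e(2), of "real (card W) * real (card (F n))"] by (simp add: mult_ac)
        finally show ?thesis by (simp add: sum_subtractf)
      qed
      have e5: "\<bar>(\<Sum>g\<in>F n. \<Sum>w\<in>W'. \<phi> (w \<cdot> g)) - (\<Sum>g\<in>F n. s g * (\<Sum>w\<in>W'. b' (w \<cdot> g)))\<bar> \<le> e' * card W' * card (F n)"
      proof -
        have "\<bar>\<phi> (w \<cdot> g) - s g * b' (w \<cdot> g)\<bar> \<le> e" if "g \<in> F n" "w \<in> W'" for g w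
        proof -
          have "\<bar>\<phi> (w \<cdot> g) - s g * b' (w \<cdot> g)\<bar> = \<bar>s (w \<cdot> g) - s g\<bar> * \<bar>b' (w \<cdot> g)\<bar>"
            by (simp add: \<phi>_def abs_mult[symmetric] algebra_simps)
          also have "\<dots> \<le> e * 1" using slow[of g w] that Fn b1 e by (intro mult_mono) auto
          finally show ?thesis by simp
        qed
        then have "\<bar>\<Sum>g\<in>F n. \<Sum>w\<in>W'. \<phi> (w \<cdot> g) - s g * b' (w \<cdot> g)\<bar> \<le> (\<Sum>g\<in>F n. \<Sum>w\<in>W'. e)"
          by (intro order_trans[OF sum_abs] sum_mono)
        also have "\<dots> \<le> e' * card W' * card (F n)"
          using mult_right_mono[OF e(2), of "real (card W') * real (card (F n))"] by (simp add: mult_ac)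
        finally show ?thesis by (simp add: sum_subtractf sum_distrib_left)
      qed
      have e6: "\<bar>\<Sum>g\<in>F n. s g * (\<Sum>w\<in>W'. b' (w \<cdot> g))\<bar> \<le> 2 * e' * card W' * card (F n)"
      proof -
        have "\<bar>s g * (\<Sum>w\<in>W'. b' (w \<cdot> g))\<bar> \<le> e' * card W' + (if g \<in> Z' then real (card W') else 0)" if g: "g \<in> F n" for g
        proof -
          have gc: "g \<in> carrier G" using g Fn by auto
          have "\<bar>s g * (\<Sum>w\<in>W'. b' (w \<cdot> g))\<bar> \<le> 1 * \<bar>\<Sum>w\<in>W'. b' (w \<cdot> g)\<bar>"
            unfolding abs_mult using s01[OF gc] by (intro mult_right_mono) auto
          also have "\<dots> \<le> e' * card W' + (if g \<in> Z' then real (card W') else 0)"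
          proof (cases "g \<in> Z'")
            case True
            have "\<bar>\<Sum>w\<in>W'. b' (w \<cdot> g)\<bar> \<le> (\<Sum>w\<in>W'. 1)"
              using b1 by (intro order_trans[OF sum_abs] sum_mono) auto
            then show ?thesis using True e' by (simp add: add_increasing)
          next
            case False
            then show ?thesis using u'[of g j] gc j by (simp add: b'_def)
          qed
          finally show ?thesis .
        qed
        then have "\<bar>\<Sum>g\<in>F n. s g * (\<Sum>w\<in>W'. b' (w \<cdot> g))\<bar> \<le> (\<Sum>g\<in>F n. e' * card W' + (if g \<in> Z' then real (card W') else 0))"
          by (intro order_trans[OF sum_abs] sum_mono)
        also have "\<dots> = e' * card W' * card (F n) + card W' * real (card (F n \<inter> Z'))"
          using Fn by (simp add: sum.distrib sum.If_cases)
        also have "\<dots> \<le> e' * card W' * card (F n) + card W' * (e' * card (F n))"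
        proof -
          have "card (F n \<inter> Z') \<le> card Z'" using Z' by (intro card_mono) auto
          then have "real (card (F n \<inter> Z')) \<le> e' * card (F n)" using N(1)[OF n] by linarith
          then show ?thesis by (intro add_left_mono mult_left_mono) auto
        qed
        finally show ?thesis by (simp add: algebra_simps)
      qed
      have "\<bar>card W' * (\<Sum>g\<in>F n. \<phi> g)\<bar> \<le> 4 * e' * card W' * card (F n)" using e4 e5 e6 by linarith
      then have "card W' * \<bar>\<Sum>g\<in>F n. \<phi> g\<bar> \<le> card W' * (4 * e' * card (F n))" by (simp add: abs_mult algebra_simps)
      then have s1: "\<bar>\<Sum>g\<in>F n. \<phi> g\<bar> \<le> 4 * e' * card (F n)" using cW(2) by (simp only: mult_le_cancel_left_pos)
      have "\<bar>card W * (\<Sum>g\<in>F n. b g) - card W * (\<Sum>g\<in>F n. \<phi> g)\<bar> \<le> 3 * e' * card W * card (F n)" using e1 e2 e3 by linarith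
      then have "card W * \<bar>(\<Sum>g\<in>F n. b g) - (\<Sum>g\<in>F n. \<phi> g)\<bar> \<le> card W * (3 * e' * card (F n))"
        unfolding right_diff_distrib[symmetric] abs_mult by (simp add: mult_ac)
      then have s2: "\<bar>(\<Sum>g\<in>F n. b g) - (\<Sum>g\<in>F n. \<phi> g)\<bar> \<le> 3 * e' * card (F n)" using cW(1) by (simp only: mult_le_cancel_left_pos)
      show ?thesis using s1 s2 unfolding b_def by linarith
    qed
    ultimately show "\<exists>c. (\<forall>g. c g \<in> sphere 0 1) \<and> (\<forall>g\<in>D. c g = c' g) \<and>
     window_uniform G c B e \<and> (\<forall>n\<ge>N. \<forall>j\<in>B'. \<bar>\<Sum>g\<in>F n. obs G c j g\<bar> \<le> 7 * e' * card (F n))"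
      using c by blast
  qed
qed

text \<open>
  The refinement step is iterated with errors \<open>1 / (k + 1)\<close> and more and more observables. The stage \<open>c\<^sub>k\<close>
  determines a threshold \<open>N\<^sub>k\<close>, and the next stage is required to agree with \<open>c\<^sub>k\<close> on all places that
  matter for \<open>F n\<close> with \<open>n < N\<^sub>k\<close>. For \<open>n\<close> between \<open>N\<^sub>k\<close> and \<open>N\<^sub>k\<^sub>+\<^sub>1\<close> the limit sequence is thus indistinguishable
  from stage \<open>k + 1\<close> on \<open>F n\<close>, whose averages are under control from \<open>N\<^sub>k\<close> on.
\<close>

proposition uniform_sequence_exists:
  fixes J :: "nat \<Rightarrow> 'g observable"
  assumes inf: "infinite (carrier G)" and F: "left_Folner_seq G F"
    and f: "f \<in> measurable M (restrict_space borel (sphere 0 1))"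
    and J: "\<And>i. centred_observable f (J i)"
  shows "\<exists>c. (\<forall>g. c g \<in> sphere 0 1) \<and> (\<forall>i. (\<lambda>n. (\<Sum>g\<in>F n. obs G c (J i) g) / card (F n)) \<longlonglongrightarrow> 0)"
proof -
  interpret grp: group G by (rule acting_group)
  have Fn: "finite (F n)" "F n \<noteq> {}" "F n \<subseteq> carrier G" for n using F by (auto simp: left_Folner_seq_def)
  have Jc: "fst (J i) \<in> carrier G" for i using J[of i] by (simp add: centred_observable_def)
  define B where "B k = J ` {..<k}" for k :: nat
  define e where "e k = 1 / real (Suc k)" for k
  define ok where "ok k c \<longleftrightarrow> (\<forall>g. c g \<in> sphere 0 1) \<and> window_uniform G c (B k) (e k)" for k c
  define good where "good k c' N D c \<longleftrightarrow> (\<forall>g\<in>D. c g = c' g) \<and> ok (Suc k) c \<and>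
      (\<forall>n\<ge>N. \<forall>j\<in>B k. \<bar>\<Sum>g\<in>F n. obs G c j g\<bar> \<le> 7 * e k * card (F n))" for k c' N D c
  have step: "\<exists>N. \<forall>D. finite D \<longrightarrow> D \<subseteq> carrier G \<longrightarrow> (\<exists>c. good k c' N D c)" if "ok k c'" for k c'
  proof -
    have c': "\<And>g. c' g \<in> sphere 0 1" "window_uniform G c' (B k) (e k)" using that by (auto simp: ok_def)
    have "finite (B (Suc k))" "\<forall>j\<in>B (Suc k). centred_observable f j" "B k \<subseteq> B (Suc k)" "e (Suc k) > 0" "e (Suc k) \<le> e k"
      using J by (auto simp: B_def e_def field_simps)
    from refinement_step[OF inf F f this, of c', OF c'] obtain N where
      N: "\<forall>D. finite D \<longrightarrow> D \<subseteq> carrier G \<longrightarrow> (\<exists>c. (\<forall>g. c g \<in> sphere 0 1) \<and> (\<forall>g\<in>D. c g = c' g) \<and>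
        window_uniform G c (B (Suc k)) (e (Suc k)) \<and>
        (\<forall>n\<ge>N. \<forall>j\<in>B k. \<bar>\<Sum>g\<in>F n. obs G c j g\<bar> \<le> 7 * e k * card (F n)))"
      by (rule exE)
    show ?thesis
    proof (rule exI[of _ N], intro allI impI)
      fix D assume "finite D" "D \<subseteq> carrier G"
      from N[rule_format, OF this] show "\<exists>c. good k c' N D c"
        unfolding good_def ok_def by (elim exE conjE) (rule exI, intro conjI)
    qed
  qed
  define Nf where "Nf k c' = (SOME N. \<forall>D. finite D \<longrightarrow> D \<subseteq> carrier G \<longrightarrow> (\<exists>c. good k c' N D c))" for k c'
  define cf where "cf k c' D = (SOME c. good k c' (Nf k c') D c)" for k c' D
  have cf: "good k c' (Nf k c') D (cf k c' D)" if "ok k c'" "finite D" "D \<subseteq> carrier G" for k c' D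
  proof -
    have "\<forall>D. finite D \<longrightarrow> D \<subseteq> carrier G \<longrightarrow> (\<exists>c. good k c' (Nf k c') D c)"
      unfolding Nf_def by (rule someI_ex[OF step[OF that(1)]])
    then have "\<exists>c. good k c' (Nf k c') D c" using that by blast
    then show ?thesis unfolding cf_def by (rule someI_ex)
  qed
  define nbhd where "nbhd m k = (\<Union>n<m. F n \<union> (\<Union>i<k. (\<lambda>g. fst (J i) \<cdot> g) ` F n))" for m k :: nat
  have nbhd: "finite (nbhd m k)" "nbhd m k \<subseteq> carrier G" for m k
    using Fn Jc by (auto simp: nbhd_def subset_iff)
  define st where "st = rec_nat (\<lambda>_. 1, {}) (\<lambda>k (c, D). let D' = D \<union> nbhd (max (Nf k c) k) k in (cf k c D', D'))"
  define cs where "cs k = fst (st k)" for k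
  define Ds where "Ds k = snd (st (Suc k))" for k
  define Ns where "Ns k = max (Nf k (cs k)) k" for k
  have Ds_eq: "Ds k = snd (st k) \<union> nbhd (Ns k) k" for k
    by (simp add: Ds_def st_def Ns_def cs_def split_beta Let_def)
  have cs_Suc: "cs (Suc k) = cf k (cs k) (Ds k)" for k
    by (simp add: Ds_def st_def Ns_def cs_def split_beta Let_def)
  have Ds_fin: "finite (snd (st k)) \<and> snd (st k) \<subseteq> carrier G" for k
  proof (induction k)
    case 0
    show ?case by (simp add: st_def)
  next
    case (Suc k)
    then show ?case using Ds_eq[of k] nbhd[of "Ns k" k] by (simp add: Ds_def)
  qed
  have Dfin: "finite (Ds k)" "Ds k \<subseteq> carrier G" for k using Ds_fin[of "Suc k"] by (auto simp: Ds_def)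
  have okk: "ok k (cs k)" for k
  proof (induction k)
    case 0
    have "window_uniform G (\<lambda>_. 1) {} 1"
      unfolding window_uniform_def by (intro exI[of _ "{\<one>\<^bsub>G\<^esub>}"] exI[of _ "{}"]) auto
    then show ?case by (simp add: ok_def cs_def st_def B_def e_def)
  next
    case (Suc k)
    show ?case using cf[OF Suc.IH Dfin, of k] by (simp add: cs_Suc good_def)
  qed
  have gd: "good k (cs k) (Nf k (cs k)) (Ds k) (cs (Suc k))" for k
    unfolding cs_Suc by (rule cf[OF okk Dfin])
  have Dmono: "Ds k \<subseteq> Ds l" if "k \<le> l" for k l
    using that
  proof (induction rule: dec_induct)
    case (step l)
    then show ?case using Ds_eq[of "Suc l"] by (auto simp: Ds_def)
  qed simp
  have stable: "cs l g = cs k g" if "k \<le> l" "g \<in> Ds k" for k l g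
    using that(1)
  proof (induction rule: dec_induct)
    case (step l)
    have "g \<in> Ds l" using Dmono[OF step.hyps(1)] that by auto
    then have "cs (Suc l) g = cs l g" using gd[of l] by (simp add: good_def)
    then show ?case using step by simp
  qed simp
  define c where "c g = (if \<exists>k. g \<in> Ds k then cs (LEAST k. g \<in> Ds k) g else 1)" for g
  have c_eq: "c g = cs k g" if "g \<in> Ds k" for g k
  proof -
    have "g \<in> Ds (LEAST k. g \<in> Ds k)" "(LEAST k. g \<in> Ds k) \<le> k"
      using that by (auto intro: LeastI Least_le)
    then show ?thesis using stable[of "LEAST k. g \<in> Ds k" k g] that by (auto simp: c_def)
  qed
  have csph: "c g \<in> sphere 0 1" for g
    using okk by (auto simp: c_def ok_def)
  have main: "\<bar>\<Sum>g\<in>F n. obs G c (J i) g\<bar> \<le> 7 * e K * card (F n)" if n: "n \<ge> Ns K" and i: "i < K" for n K i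
  proof -
    have fin: "finite {k. Ns k \<le> n}" by (rule finite_subset[of _ "{..n}"]) (auto simp: Ns_def)
    \<comment> \<open>The stage responsible for \<open>F n\<close>.\<close>
    define k where "k = Max {k. Ns k \<le> n}"
    have k: "Ns k \<le> n" "K \<le> k" and k': "\<And>l. Ns l \<le> n \<Longrightarrow> l \<le> k"
      using Max_in[OF fin] Max_ge[OF fin] n unfolding k_def by blast+
    have "n < Ns (Suc k)" using k'[of "Suc k"] by (meson not_less Suc_n_not_le_n)
    then have sub: "F n \<subseteq> Ds (Suc k)" "(\<lambda>g. fst (J i) \<cdot> g) ` F n \<subseteq> Ds (Suc k)"
      using i k unfolding Ds_eq[of "Suc k"] nbhd_def by fastforce+
    have "(\<Sum>g\<in>F n. obs G c (J i) g) = (\<Sum>g\<in>F n. obs G (cs (Suc k)) (J i) g)"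
    proof (intro sum.cong refl)
      fix g assume "g \<in> F n"
      then have "g \<in> Ds (Suc k)" "fst (J i) \<cdot> g \<in> Ds (Suc k)" using sub by auto
      then show "obs G c (J i) g = obs G (cs (Suc k)) (J i) g" by (simp add: obs_def c_eq)
    qed
    moreover have "\<bar>\<Sum>g\<in>F n. obs G (cs (Suc k)) (J i) g\<bar> \<le> 7 * e k * card (F n)"
      using gd[of k] k i unfolding good_def B_def Ns_def by auto
    moreover have "7 * e k * card (F n) \<le> 7 * e K * card (F n)"
      using k by (intro mult_right_mono) (auto simp: e_def field_simps)
    ultimately show ?thesis by linarith
  qed
  have "(\<lambda>n. (\<Sum>g\<in>F n. obs G c (J i) g) / card (F n)) \<longlonglongrightarrow> 0" for i
  proof (rule LIMSEQ_I)
    fix r :: real assume r: "r > 0"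
    obtain K0 :: nat where K0: "7 / r < K0" using reals_Archimedean2 by blast
    define K where "K = max K0 (Suc i)"
    have eK: "7 * e K < r"
    proof -
      have "7 / r < real (Suc K)" using K0 by (simp add: K_def)
      then show ?thesis using r by (simp add: e_def field_simps)
    qed
    show "\<exists>no. \<forall>n\<ge>no. norm ((\<Sum>g\<in>F n. obs G c (J i) g) / card (F n) - 0) < r"
    proof (intro exI[of _ "Ns K"] allI impI)
      fix n assume n: "n \<ge> Ns K"
      have cF: "real (card (F n)) > 0" using Fn[of n] by (simp add: card_gt_0_iff)
      have "\<bar>\<Sum>g\<in>F n. obs G c (J i) g\<bar> \<le> 7 * e K * card (F n)" by (rule main[OF n]) (simp add: K_def)
      then have "\<bar>\<Sum>g\<in>F n. obs G c (J i) g\<bar> / card (F n) \<le> 7 * e K" using cF by (simp add: pos_divide_le_eq)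
      then show "norm ((\<Sum>g\<in>F n. obs G c (J i) g) / card (F n) - 0) < r" using eK by simp
    qed
  qed
  then show ?thesis using csph by blast
qed

end

section \<open>From vdC sets to measure preserving systems\<close>

text \<open>
  The observables are the real and imaginary parts of \<open>z * cnj w\<close> for \<open>v \<in> V\<close>, and those of
  \<open>(w - \<alpha>) / 2\<close> with \<open>\<alpha> = \<integral>f\<close>; the factor makes the latter bounded by one.
\<close>

lemma vdC_set_imp_mps_vdC_condition:
  fixes G :: "('g, 'b) monoid_scheme"
  assumes G: "countable (carrier G)" "infinite (carrier G)" and F: "left_Folner_seq G F" and V: "V \<subseteq> carrier G"
    and vdC: "vdC_set G F V"
  shows "mps_vdC_condition TYPE('x) G V"
  unfolding mps_vdC_condition_def
proof (intro allI impI)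
  fix M :: "'x measure" and \<tau> f
  assume mps: "measure_preserving_system G M \<tau>" and f: "f \<in> measurable M (restrict_space borel (sphere (0::complex) 1))"
    and orth: "\<forall>v\<in>V. L2_inner M (f \<circ> \<tau> v) f = 0"
  interpret measure_preserving_system G M \<tau> by fact
  interpret grp: group G by (rule acting_group)
  have fb: "f \<in> borel_measurable M" using f by (simp add: measurable_restrict_space2_iff)
  have fs: "norm (f x) = 1" if "x \<in> space M" for x
    using measurable_space[OF f that] by (simp add: space_restrict_space)
  have fi: "integrable M f" by (rule integrable_const_bound[where B = 1]) (use fs fb in auto)
  define \<alpha> where "\<alpha> = (\<integral>x. f x \<partial>M)"
  have "norm \<alpha> \<le> (\<integral>x. norm (f x) \<partial>M)" unfolding \<alpha>_def by (rule integral_norm_bound)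
  also have "\<dots> = (\<integral>x. 1 \<partial>M)" using fs by (intro Bochner_Integration.integral_cong) auto
  finally have \<alpha>1: "norm \<alpha> \<le> 1" by (simp add: prob_space)
  define mu where "mu p z w = (p w - p \<alpha>) / 2" for p :: "complex \<Rightarrow> real" and z w :: complex
  define co where "co p z w = p (z * cnj w)" for p :: "complex \<Rightarrow> real" and z w :: complex
  define S where "S = {(\<one>\<^bsub>G\<^esub>, mu Re), (\<one>\<^bsub>G\<^esub>, mu Im)} \<union> (\<lambda>v. (v, co Re)) ` V \<union> (\<lambda>v. (v, co Im)) ` V"
  have S: "countable S" "S \<noteq> {}" using countable_subset[OF V G(1)] by (auto simp: S_def)
  have mean: "centred_observable f (\<one>\<^bsub>G\<^esub>, mu p)" if p: "p = Re \<or> p = Im" for p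
  proof -
    have "\<bar>p w - p \<alpha>\<bar> \<le> 2" if "norm w = 1" for w
    proof -
      have "\<bar>p w - p \<alpha>\<bar> \<le> norm (w - \<alpha>)"
        using p abs_Re_le_cmod[of "w - \<alpha>"] abs_Im_le_cmod[of "w - \<alpha>"] by auto
      also have "\<dots> \<le> 1 + 1" using norm_triangle_ineq4[of w \<alpha>] that \<alpha>1 by linarith
      finally show ?thesis by simp
    qed
    moreover have "continuous_on UNIV (\<lambda>z :: complex \<times> complex. mu p (fst z) (snd z))"
      using p unfolding mu_def by (auto intro!: continuous_intros)
    moreover have "(\<integral>x. p (f x) \<partial>M) = p \<alpha> \<and> integrable M (\<lambda>x. p (f x))"
      using p fi by (auto simp: \<alpha>_def)
    then have "(\<integral>x. mu p (f (\<tau> \<one>\<^bsub>G\<^esub> x)) (f x) \<partial>M) = 0"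
      by (simp add: mu_def prob_space)
    ultimately show ?thesis by (auto simp: centred_observable_def mu_def)
  qed
  have corr: "centred_observable f (v, co p)" if p: "p = Re \<or> p = Im" and v: "v \<in> V" for p v
  proof -
    have vc: "v \<in> carrier G" using v V by auto
    have "\<bar>co p z w\<bar> \<le> 1" if "norm z = 1" "norm w = 1" for z w
      using p abs_Re_le_cmod[of "z * cnj w"] abs_Im_le_cmod[of "z * cnj w"] that by (auto simp: co_def norm_mult)
    moreover have "continuous_on UNIV (\<lambda>z :: complex \<times> complex. co p (fst z) (snd z))"
      using p unfolding co_def by (auto intro!: continuous_intros)
    moreover have "(\<integral>x. co p (f (\<tau> v x)) (f x) \<partial>M) = 0"
    proof -
      have m: "(\<lambda>x. f (\<tau> v x) * cnj (f x)) \<in> borel_measurable M"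
      proof (rule borel_measurable_times[OF measurable_compose[OF measurable_action[OF vc] fb] measurable_compose[OF fb]])
        show "cnj \<in> borel_measurable borel" by (intro borel_measurable_continuous_onI continuous_intros)
      qed
      have "integrable M (\<lambda>x. f (\<tau> v x) * cnj (f x))"
        by (rule integrable_const_bound[OF _ m, where B = 1], rule AE_I2)
           (simp add: norm_mult fs action_in_space[OF vc])
      moreover have "(\<integral>x. f (\<tau> v x) * cnj (f x) \<partial>M) = 0" using orth v by (simp add: L2_inner_def)
      ultimately show ?thesis using p by (auto simp: co_def simp del: times_complex.simps)
    qed
    ultimately show ?thesis using vc by (auto simp: centred_observable_def)
  qed
  have "centred_observable f (from_nat_into S i)" for i
    using from_nat_into[OF S(2), of i] mean corr by (auto simp: S_def)
  then obtain c where c: "\<And>g. c g \<in> sphere 0 1"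
    and lim: "\<And>i. (\<lambda>n. (\<Sum>g\<in>F n. obs G c (from_nat_into S i) g) / card (F n)) \<longlonglongrightarrow> 0"
    using uniform_sequence_exists[OF G(2) F f, of "from_nat_into S"] by blast
  have lim: "(\<lambda>n. (\<Sum>g\<in>F n. obs G c j g) / card (F n)) \<longlonglongrightarrow> 0" if "j \<in> S" for j
    using lim[of "to_nat_on S j"] that S(1) by simp
  have cF: "real (card (F n)) > 0" "F n \<subseteq> carrier G" for n using F by (auto simp: left_Folner_seq_def card_gt_0_iff)
  have "(\<lambda>n. (\<Sum>g\<in>F n. c (v \<otimes>\<^bsub>G\<^esub> g) * cnj (c g)) / of_nat (card (F n))) \<longlonglongrightarrow> 0" if v: "v \<in> V" for v
  proof -
    have "(v, co Re) \<in> S" "(v, co Im) \<in> S" using v by (auto simp: S_def)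
    note l = lim[OF this(1)] lim[OF this(2)]
    have e1: "Re ((\<Sum>g\<in>F n. c (v \<otimes>\<^bsub>G\<^esub> g) * cnj (c g)) / of_nat (card (F n))) = (\<Sum>g\<in>F n. obs G c (v, co Re) g) / card (F n)" for n
      by (simp add: obs_def co_def Re_divide_of_nat del: times_complex.simps)
    have e2: "Im ((\<Sum>g\<in>F n. c (v \<otimes>\<^bsub>G\<^esub> g) * cnj (c g)) / of_nat (card (F n))) = (\<Sum>g\<in>F n. obs G c (v, co Im) g) / card (F n)" for n
      by (simp add: obs_def co_def Im_divide_of_nat del: times_complex.simps)
    show ?thesis unfolding tendsto_complex_iff e1 e2 using l by simp
  qed
  then have z: "(\<lambda>n. (\<Sum>g\<in>F n. c g) / of_nat (card (F n))) \<longlonglongrightarrow> 0"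
    using vdC c unfolding vdC_set_def by blast
  have "(\<lambda>n. (\<Sum>g\<in>F n. c g) / of_nat (card (F n))) \<longlonglongrightarrow> \<alpha>"
  proof -
    have av: "p ((\<Sum>g\<in>F n. c g) / of_nat (card (F n))) = 2 * ((\<Sum>g\<in>F n. obs G c (\<one>\<^bsub>G\<^esub>, mu p) g) / card (F n)) + p \<alpha>"
      if p: "p = Re \<or> p = Im" for n p
    proof -
      have "(\<Sum>g\<in>F n. obs G c (\<one>\<^bsub>G\<^esub>, mu p) g) = ((\<Sum>g\<in>F n. p (c g)) - card (F n) * p \<alpha>) / 2"
        by (simp add: obs_def mu_def sum_divide_distrib[symmetric] sum_subtractf)
      then show ?thesis using p cF[of n] by (auto simp: Re_divide_of_nat Im_divide_of_nat field_simps)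
    qed
    have "(\<lambda>n. p ((\<Sum>g\<in>F n. c g) / of_nat (card (F n)))) \<longlonglongrightarrow> p \<alpha>" if p: "p = Re \<or> p = Im" for p
    proof -
      have "(\<one>\<^bsub>G\<^esub>, mu p) \<in> S" using p by (auto simp: S_def)
      from tendsto_add[OF tendsto_mult[OF tendsto_const lim[OF this]] tendsto_const, of 2 "p \<alpha>"]
      show ?thesis unfolding av[OF p] by simp
    qed
    then show ?thesis unfolding tendsto_complex_iff by blast
  qed
  with z have "\<alpha> = 0" using LIMSEQ_unique by blast
  then show "(\<integral>x. f x \<partial>M) = 0" by (simp add: \<alpha>_def)
qed

section \<open>Measures given by limiting pattern frequencies\<close>

definition round_dyadic :: "nat \<Rightarrow> complex \<Rightarrow> complex" where
  "round_dyadic k z = Complex (of_int \<lfloor>2 ^ k * Re z\<rfloor> / 2 ^ k) (of_int \<lfloor>2 ^ k * Im z\<rfloor> / 2 ^ k)"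

lemma floor_scaled_dist: "\<bar>of_int \<lfloor>2 ^ k * x\<rfloor> / 2 ^ k - x\<bar> \<le> 1 / 2 ^ k" for x :: real
proof -
  have "of_int \<lfloor>2 ^ k * x\<rfloor> / 2 ^ k - x = (of_int \<lfloor>2 ^ k * x\<rfloor> - 2 ^ k * x) / 2 ^ k" by (simp add: field_simps)
  moreover have "\<bar>of_int \<lfloor>2 ^ k * x\<rfloor> - 2 ^ k * x\<bar> \<le> 1" by linarith
  ultimately show ?thesis by (simp add: abs_divide divide_right_mono)
qed

lemma round_dyadic_dist: "norm (round_dyadic k z - z) \<le> 2 / 2 ^ k"
proof -
  have "norm (round_dyadic k z - z) \<le> \<bar>Re (round_dyadic k z - z)\<bar> + \<bar>Im (round_dyadic k z - z)\<bar>" by (rule cmod_le)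
  also have "\<dots> \<le> 1 / 2 ^ k + 1 / 2 ^ k"
    using floor_scaled_dist[of k "Re z"] floor_scaled_dist[of k "Im z"] by (simp add: round_dyadic_def)
  finally show ?thesis by simp
qed

lemma finite_round_dyadic_sphere: "finite (round_dyadic k ` sphere 0 1)"
proof -
  have b: "\<lfloor>2 ^ k * x\<rfloor> \<in> {- (2 ^ k)..2 ^ k}" if "\<bar>x\<bar> \<le> 1" for x :: real
  proof -
    have "2 ^ k * x \<le> 2 ^ k * 1" "2 ^ k * (-1) \<le> 2 ^ k * x" using that by (intro mult_left_mono; simp add: abs_le_iff)+
    then have "2 ^ k * x < 2 ^ k + 1" "- (2 ^ k) \<le> 2 ^ k * x" by linarith+
    then show ?thesis by (simp add: floor_le_iff le_floor_iff)
  qed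
  have "round_dyadic k ` sphere 0 1 \<subseteq> (\<lambda>(a, b). Complex (of_int a / 2 ^ k) (of_int b / 2 ^ k)) ` ({- (2 ^ k)..2 ^ k} \<times> {- (2 ^ k)..2 ^ k})"
  proof
    fix w assume "w \<in> round_dyadic k ` sphere 0 1"
    then obtain z where z: "norm z = 1" "w = round_dyadic k z" by auto
    have "\<bar>Re z\<bar> \<le> 1" "\<bar>Im z\<bar> \<le> 1" using abs_Re_le_cmod[of z] abs_Im_le_cmod[of z] z by auto
    then show "w \<in> (\<lambda>(a, b). Complex (of_int a / 2 ^ k) (of_int b / 2 ^ k)) ` ({- (2 ^ k)..2 ^ k} \<times> {- (2 ^ k)..2 ^ k})"
      using b z by (force simp: round_dyadic_def)
  qed
  then show ?thesis by (rule finite_subset) auto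
qed

text \<open>
  The alphabets are finite so that limits of finite-dimensional distributions are again probability
  measures, without any tightness argument.
\<close>

locale pattern_frequencies =
  fixes I :: "'i set" and F :: "nat \<Rightarrow> 'u set" and Y :: "'u \<Rightarrow> 'i \<Rightarrow> complex" and A :: "'i \<Rightarrow> complex set"
    and L :: "'i set \<Rightarrow> ('i \<Rightarrow> complex) \<Rightarrow> real"
  assumes F: "\<And>n. finite (F n)" "\<And>n. F n \<noteq> {}"
    and A: "\<And>i. i \<in> I \<Longrightarrow> finite (A i)"
    and Y: "\<And>n u i. u \<in> F n \<Longrightarrow> i \<in> I \<Longrightarrow> Y u i \<in> A i"
    and L: "\<And>J s. finite J \<Longrightarrow> J \<subseteq> I \<Longrightarrow> s \<in> PiE J A \<Longrightarrow>
        (\<lambda>n. real (card {u\<in>F n. restrict (Y u) J = s}) / card (F n)) \<longlonglongrightarrow> L J s"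
begin

abbreviation sample_average :: "nat \<Rightarrow> (('i \<Rightarrow> complex) \<Rightarrow> 'r) \<Rightarrow> 'r :: real_normed_field" where
  "sample_average n \<psi> \<equiv> (\<Sum>u\<in>F n. \<psi> (restrict (Y u) I)) / of_nat (card (F n))"

lemma finite_patterns: "finite J \<Longrightarrow> J \<subseteq> I \<Longrightarrow> finite (PiE J A)"
  using A by (intro finite_PiE) auto

lemma sum_patterns_limit:
  fixes \<phi> :: "('i \<Rightarrow> complex) \<Rightarrow> 'r :: real_normed_field"
  assumes J: "finite J" "J \<subseteq> I"
  shows "(\<lambda>n. (\<Sum>u\<in>F n. \<phi> (restrict (Y u) J)) / of_nat (card (F n))) \<longlonglongrightarrow> (\<Sum>s\<in>PiE J A. of_real (L J s) * \<phi> s)"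
proof -
  have "(\<Sum>u\<in>F n. \<phi> (restrict (Y u) J)) / of_nat (card (F n)) =
      (\<Sum>s\<in>PiE J A. of_real (card {u\<in>F n. restrict (Y u) J = s} / card (F n)) * \<phi> s)" for n
  proof -
    have "(\<Sum>u\<in>F n. \<phi> (restrict (Y u) J)) = (\<Sum>s\<in>PiE J A. \<Sum>u\<in>{u\<in>F n. restrict (Y u) J = s}. \<phi> (restrict (Y u) J))"
      using J Y[of _ n] by (intro sum.group[symmetric] F finite_patterns) (auto simp: subset_iff)
    also have "\<dots> = (\<Sum>s\<in>PiE J A. of_nat (card {u\<in>F n. restrict (Y u) J = s}) * \<phi> s)"
      by (intro sum.cong refl) simp
    finally show ?thesis by (simp add: sum_divide_distrib)
  qed
  then show ?thesis
    by (simp only:) (intro tendsto_sum tendsto_mult tendsto_of_real L J tendsto_const)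
qed

lemma L_nonneg: "finite J \<Longrightarrow> J \<subseteq> I \<Longrightarrow> s \<in> PiE J A \<Longrightarrow> 0 \<le> L J s"
  by (rule LIMSEQ_le_const[OF L]) auto

lemma sum_L:
  assumes J: "finite J" "J \<subseteq> I" shows "(\<Sum>s\<in>PiE J A. L J s) = 1"
proof -
  have "(\<lambda>n. (\<Sum>u\<in>F n. 1) / of_nat (card (F n))) \<longlonglongrightarrow> (\<Sum>s\<in>PiE J A. L J s)"
    using sum_patterns_limit[OF J, of "\<lambda>_. 1::real"] by simp
  moreover have "(\<Sum>u\<in>F n. 1) / of_nat (card (F n)) = (1::real)" for n using F[of n] by simp
  ultimately have "(\<lambda>n. 1) \<longlonglongrightarrow> (\<Sum>s\<in>PiE J A. L J s)" by simp
  then show ?thesis by (rule LIMSEQ_unique[OF _ tendsto_const])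
qed

definition limit_patterns :: "'i set \<Rightarrow> ('i \<Rightarrow> complex) pmf" where
  "limit_patterns J = embed_pmf (\<lambda>s. if s \<in> PiE J A then L J s else 0)"

lemma pmf_limit_patterns:
  assumes J: "finite J" "J \<subseteq> I" shows "pmf (limit_patterns J) s = (if s \<in> PiE J A then L J s else 0)"
  unfolding limit_patterns_def
proof (rule pmf_embed_pmf)
  show "0 \<le> (if s \<in> PiE J A then L J s else 0)" for s using L_nonneg[OF J] by auto
  have "(\<integral>\<^sup>+ s. ennreal (if s \<in> PiE J A then L J s else 0) \<partial>count_space UNIV)
      = (\<integral>\<^sup>+ s. ennreal (L J s) * indicator (PiE J A) s \<partial>count_space UNIV)"
    by (intro nn_integral_cong) (auto simp: indicator_def)
  also have "\<dots> = (\<integral>\<^sup>+ s. ennreal (L J s) \<partial>count_space (PiE J A))"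
    by (simp add: nn_integral_count_space_indicator)
  also have "\<dots> = (\<Sum>s\<in>PiE J A. ennreal (L J s))" by (rule nn_integral_count_space_finite[OF finite_patterns[OF J]])
  also have "\<dots> = 1" using L_nonneg[OF J] by (simp add: sum_ennreal sum_L[OF J])
  finally show "(\<integral>\<^sup>+ s. ennreal (if s \<in> PiE J A then L J s else 0) \<partial>count_space UNIV) = 1" .
qed

lemma set_limit_patterns: "finite J \<Longrightarrow> J \<subseteq> I \<Longrightarrow> set_pmf (limit_patterns J) \<subseteq> PiE J A"
  by (auto simp: set_pmf_eq pmf_limit_patterns split: if_splits)

lemma integral_limit_patterns:
  fixes \<phi> :: "('i \<Rightarrow> complex) \<Rightarrow> 'r :: {real_normed_field, banach, second_countable_topology}"
  assumes J: "finite J" "J \<subseteq> I"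
  shows "(\<integral>s. \<phi> s \<partial>measure_pmf (limit_patterns J)) = (\<Sum>s\<in>PiE J A. of_real (L J s) * \<phi> s)"
proof -
  have "(\<integral>s. \<phi> s \<partial>measure_pmf (limit_patterns J)) = (\<Sum>s\<in>PiE J A. pmf (limit_patterns J) s *\<^sub>R \<phi> s)"
    by (rule integral_measure_pmf[OF finite_patterns[OF J]]) (use set_limit_patterns[OF J] in auto)
  then show ?thesis by (simp add: pmf_limit_patterns[OF J] scaleR_conv_of_real)
qed

lemma map_limit_patterns:
  assumes J: "J \<subseteq> H" "finite H" "H \<subseteq> I"
  shows "map_pmf (\<lambda>s. restrict s J) (limit_patterns H) = limit_patterns J"
proof (rule pmf_eqI)
  fix t
  have Jf: "finite J" "J \<subseteq> I" using J finite_subset by auto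
  have "pmf (map_pmf (\<lambda>s. restrict s J) (limit_patterns H)) t = measure (measure_pmf (limit_patterns H)) {s. restrict s J = t}"
    by (simp add: pmf_map vimage_def)
  also have "\<dots> = (\<integral>s. indicator {s. restrict s J = t} s \<partial>measure_pmf (limit_patterns H))" by simp
  also have "\<dots> = (\<Sum>s\<in>PiE H A. L H s * indicator {s. restrict s J = t} s)"
    using integral_limit_patterns[OF J(2,3), of "indicator {s. restrict s J = t} :: _ \<Rightarrow> real"] by simp
  finally have 1: "(\<lambda>n. (\<Sum>u\<in>F n. indicator {s. restrict s J = t} (restrict (Y u) H)) / card (F n))
      \<longlonglongrightarrow> pmf (map_pmf (\<lambda>s. restrict s J) (limit_patterns H)) t"
    using sum_patterns_limit[OF J(2,3), of "indicator {s. restrict s J = t} :: _ \<Rightarrow> real"] by simp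
  have "pmf (limit_patterns J) t = (\<integral>s. indicator {t} s \<partial>measure_pmf (limit_patterns J))" by (simp add: pmf.rep_eq)
  also have "\<dots> = (\<Sum>s\<in>PiE J A. L J s * indicator {t} s)"
    using integral_limit_patterns[OF Jf, of "indicator {t} :: _ \<Rightarrow> real"] by simp
  finally have 2: "(\<lambda>n. (\<Sum>u\<in>F n. indicator {t} (restrict (Y u) J)) / card (F n)) \<longlonglongrightarrow> pmf (limit_patterns J) t"
    using sum_patterns_limit[OF Jf, of "indicator {t} :: _ \<Rightarrow> real"] by simp
  have "restrict (restrict (Y u) H) J = restrict (Y u) J" for u
    using J(1) by (auto simp: restrict_def subset_iff)
  then have "indicator {s. restrict s J = t} (restrict (Y u) H) = (indicator {t} (restrict (Y u) J) :: real)" for u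
    by (auto simp: indicator_def)
  with 1 2 show "pmf (map_pmf (\<lambda>s. restrict s J) (limit_patterns H)) t = pmf (limit_patterns J) t"
    using LIMSEQ_unique by simp
qed

definition limit_marginal :: "'i set \<Rightarrow> ('i \<Rightarrow> complex) measure" where
  "limit_marginal J = distr (measure_pmf (limit_patterns J)) (PiM J (\<lambda>_. borel)) (\<lambda>s. restrict s J)"

lemma restrict_measurable_pmf: "(\<lambda>s. restrict s J) \<in> measurable (measure_pmf p) (PiM J (\<lambda>_. borel))"
  by (auto simp: space_PiM)

sublocale proj: polish_projective I limit_marginal
proof (intro polish_projective.intro projective_family.intro)
  fix J H assume J: "J \<subseteq> H" "finite H" "H \<subseteq> I"
  have "distr (limit_marginal H) (PiM J (\<lambda>_. borel)) (\<lambda>f. restrict f J)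
      = distr (measure_pmf (limit_patterns H)) (PiM J (\<lambda>_. borel)) (\<lambda>s. restrict (restrict s H) J)"
    unfolding limit_marginal_def using J(1)
    by (subst distr_distr[OF measurable_restrict_subset[OF J(1)] restrict_measurable_pmf]) (simp add: comp_def)
  also have "\<dots> = distr (measure_pmf (limit_patterns H)) (PiM J (\<lambda>_. borel)) (\<lambda>s. restrict (restrict s J) J)"
    using J(1) by (intro distr_cong refl) (auto simp: restrict_def subset_iff fun_eq_iff)
  also have "\<dots>
      = distr (measure_pmf (map_pmf (\<lambda>s. restrict s J) (limit_patterns H))) (PiM J (\<lambda>_. borel)) (\<lambda>s. restrict s J)"
    unfolding map_pmf_rep_eq
    by (subst distr_distr[OF _ ]) (auto simp: comp_def space_PiM)
  finally show "limit_marginal J = distr (limit_marginal H) (PiM J (\<lambda>_. borel)) (\<lambda>f. restrict f J)"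
    using map_limit_patterns[OF J] by (simp add: limit_marginal_def)
next
  show "prob_space (limit_marginal J)" for J
    unfolding limit_marginal_def by (rule prob_space.prob_space_distr[OF prob_space_measure_pmf restrict_measurable_pmf])
qed

abbreviation \<nu> :: "('i \<Rightarrow> complex) measure" where "\<nu> \<equiv> proj.lim"

lemma distr_restrict:
  assumes J: "finite J" "J \<subseteq> I"
  shows "distr \<nu> (PiM J (\<lambda>_. borel)) (\<lambda>y. restrict y J) = limit_marginal J"
proof (rule measure_eqI)
  show "sets (distr \<nu> (PiM J (\<lambda>_. borel)) (\<lambda>y. restrict y J)) = sets (limit_marginal J)" by (simp add: limit_marginal_def)
  fix B assume "B \<in> sets (distr \<nu> (PiM J (\<lambda>_. borel)) (\<lambda>y. restrict y J))"
  then have B: "B \<in> sets (PiM J (\<lambda>_. borel))" by simp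
  have m: "(\<lambda>y. restrict y J) \<in> measurable \<nu> (PiM J (\<lambda>_. borel))"
    using measurable_restrict_subset[OF J(2), of "\<lambda>_. borel :: complex measure"] by (simp cong: measurable_cong_sets)
  have "(\<lambda>y. restrict y J) -` B \<inter> space \<nu> = prod_emb I (\<lambda>_. borel) J B"
    by (simp add: prod_emb_def space_PiM)
  then show "emeasure (distr \<nu> (PiM J (\<lambda>_. borel)) (\<lambda>y. restrict y J)) B = emeasure (limit_marginal J) B"
    by (subst emeasure_distr[OF m B]) (simp add: proj.emeasure_lim_emb[OF J(2,1) B])
qed

text \<open>
  A cylinder function sees finitely many coordinates, where \<open>\<nu>\<close> is the limit of the sample distributions.
\<close>

lemma cylinder_average:
  fixes \<psi> :: "('i \<Rightarrow> complex) \<Rightarrow> 'r :: {real_normed_field, banach, second_countable_topology}"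
  assumes J: "finite J" "J \<subseteq> I" and \<psi>: "\<psi> \<in> borel_measurable (PiM I (\<lambda>_. borel))"
    and dep: "\<And>y y'. y \<in> extensional I \<Longrightarrow> y' \<in> extensional I \<Longrightarrow> (\<And>i. i \<in> J \<Longrightarrow> y i = y' i) \<Longrightarrow> \<psi> y = \<psi> y'"
  shows "(\<lambda>n. sample_average n \<psi>) \<longlonglongrightarrow> (\<integral>y. \<psi> y \<partial>\<nu>)"
proof -
  define ex where "ex \<eta> = (\<lambda>i\<in>I. if i \<in> J then \<eta> i else 0)" for \<eta> :: "'i \<Rightarrow> complex"
  have exm: "ex \<in> measurable (PiM J (\<lambda>_. borel)) (PiM I (\<lambda>_. borel))"
    unfolding ex_def
  proof (rule measurable_restrict)
    fix i assume "i \<in> I"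
    show "(\<lambda>\<eta>. if i \<in> J then \<eta> i else 0) \<in> measurable (PiM J (\<lambda>_. borel)) borel"
      by (cases "i \<in> J") auto
  qed
  have m: "(\<lambda>y. restrict y J) \<in> measurable \<nu> (PiM J (\<lambda>_. borel))"
    using measurable_restrict_subset[OF J(2), of "\<lambda>_. borel :: complex measure"] by (simp cong: measurable_cong_sets)
  have ex: "\<psi> (ex (restrict y J)) = \<psi> (restrict y I)" for y
    using J(2) by (intro dep) (auto simp: ex_def)
  have "(\<integral>y. \<psi> y \<partial>\<nu>) = (\<integral>y. \<psi> (ex (restrict y J)) \<partial>\<nu>)"
    by (intro Bochner_Integration.integral_cong refl) (auto simp: ex space_PiM PiE_def extensional_restrict)
  also have "\<dots> = (\<integral>\<eta>. \<psi> (ex \<eta>) \<partial>limit_marginal J)"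
    unfolding distr_restrict[OF J, symmetric] by (rule integral_distr[symmetric, OF m measurable_compose[OF exm \<psi>]])
  also have "\<dots> = (\<integral>s. \<psi> (ex (restrict s J)) \<partial>measure_pmf (limit_patterns J))"
    unfolding limit_marginal_def by (rule integral_distr[OF restrict_measurable_pmf measurable_compose[OF exm \<psi>]])
  also have "\<dots> = (\<Sum>s\<in>PiE J A. of_real (L J s) * \<psi> (ex (restrict s J)))" by (rule integral_limit_patterns[OF J])
  finally have eq: "(\<integral>y. \<psi> y \<partial>\<nu>) = (\<Sum>s\<in>PiE J A. of_real (L J s) * \<psi> (ex (restrict s J)))" .
  show ?thesis
    unfolding eq using sum_patterns_limit[OF J, of "\<lambda>s. \<psi> (ex (restrict s J))"] by (simp add: ex)
qed

lemma cylinder_AE: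
  assumes J: "finite J" "J \<subseteq> I" and P: "{y\<in>space (PiM I (\<lambda>_. borel)). P y} \<in> sets (PiM I (\<lambda>_. borel))"
    and dep: "\<And>y y'. y \<in> extensional I \<Longrightarrow> y' \<in> extensional I \<Longrightarrow> (\<And>i. i \<in> J \<Longrightarrow> y i = y' i) \<Longrightarrow> P y = P y'"
    and sample: "\<And>n u. u \<in> F n \<Longrightarrow> P (restrict (Y u) I)"
  shows "AE y in \<nu>. P y"
proof -
  let ?\<psi> = "indicator {y\<in>space (PiM I (\<lambda>_. borel :: complex measure)). \<not> P y} :: _ \<Rightarrow> real"
  have neg: "{y\<in>space (PiM I (\<lambda>_. borel)). \<not> P y} \<in> sets (PiM I (\<lambda>_. borel))" using sets.sets_Collect_neg[OF P] .
  have "(\<lambda>n. sample_average n ?\<psi>) \<longlonglongrightarrow> (\<integral>y. ?\<psi> y \<partial>\<nu>)"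
  proof (rule cylinder_average[OF J])
    show "?\<psi> \<in> borel_measurable (PiM I (\<lambda>_. borel))" using neg by simp
    show "?\<psi> y = ?\<psi> y'" if "y \<in> extensional I" "y' \<in> extensional I" "\<And>i. i \<in> J \<Longrightarrow> y i = y' i" for y y'
      using dep[OF that] that by (auto simp: indicator_def space_PiM PiE_def)
  qed
  moreover have "(\<Sum>u\<in>F n. ?\<psi> (restrict (Y u) I)) = 0" for n
    using sample by (intro sum.neutral) (auto simp: indicator_def)
  ultimately have "(\<integral>y. ?\<psi> y \<partial>\<nu>) = 0" using LIMSEQ_unique[OF tendsto_const] by force
  moreover have "{y\<in>space (PiM I (\<lambda>_. borel :: complex measure)). \<not> P y} \<inter> space \<nu> = {y\<in>space \<nu>. \<not> P y}" by auto
  ultimately have "measure \<nu> {y\<in>space \<nu>. \<not> P y} = 0" by simp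
  then show ?thesis
    using neg by (subst AE_iff_measurable[OF _ refl]) (auto simp: proj.P.emeasure_eq_measure)
qed

end

section \<open>The Furstenberg correspondence\<close>

text \<open>
  There are only countably many patterns, so a diagonal subsequence makes all frequencies converge.
\<close>

lemma convergent_pattern_frequencies:
  fixes I :: "'i set" and F :: "nat \<Rightarrow> 'u set"
  assumes I: "countable I" and F: "\<And>n. finite (F n)" "\<And>n. F n \<noteq> {}"
    and A: "\<And>i. i \<in> I \<Longrightarrow> finite (A i)"
    and Y: "\<And>n u i. u \<in> F n \<Longrightarrow> i \<in> I \<Longrightarrow> Y u i \<in> A i"
  shows "\<exists>r L. strict_mono r \<and> pattern_frequencies I (F \<circ> r) Y A L"
proof -
  define S where "S = (SIGMA J:{J. finite J \<and> J \<subseteq> I}. PiE J A)"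
  have cS: "countable S"
    unfolding S_def using A
    by (intro countable_SIGMA countable_Collect_finite_subset I countable_finite finite_PiE) auto
  define fr where "fr n = (\<lambda>(J, s). real (card {u\<in>F n. restrict (Y u) J = s}) / card (F n))" for n
  have bd: "norm (fr n x) \<le> 1" for n x
  proof -
    have "card {u\<in>F n. restrict (Y u) J = s} \<le> card (F n)" for J s using F by (intro card_mono) auto
    then show ?thesis by (auto simp: fr_def divide_le_eq split: prod.split)
  qed
  obtain r where r: "strict_mono r" "\<And>x. x \<in> S \<Longrightarrow> \<exists>l. (\<lambda>n. fr (r n) x) \<longlonglongrightarrow> l"
  proof (rule function_convergent_subsequence[where f = fr and M = 1, OF cS bd])
    fix k assume "strict_mono (k :: nat \<Rightarrow> nat)" "\<And>x. x \<in> S \<Longrightarrow> \<exists>l. (\<lambda>n. fr (k n) x) \<longlonglongrightarrow> l"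
    then show thesis by (rule that[of k])
  qed
  define L where "L J s = lim (\<lambda>n. fr (r n) (J, s))" for J s
  have "pattern_frequencies I (F \<circ> r) Y A L"
  proof
    fix J s assume "finite J" "J \<subseteq> I" "s \<in> PiE J A"
    then have "(J, s) \<in> S" by (simp add: S_def)
    from r(2)[OF this] have "(\<lambda>n. fr (r n) (J, s)) \<longlonglongrightarrow> L J s"
      unfolding L_def by (metis limI)
    then show "(\<lambda>n. real (card {u\<in>(F \<circ> r) n. restrict (Y u) J = s}) / card ((F \<circ> r) n)) \<longlonglongrightarrow> L J s"
      by (simp add: fr_def)
  qed (use F A Y in auto)
  then show ?thesis using r by blast
qed

text \<open>
  Recovers a point of the circle from a sequence that behaves like its dyadic roundings.
\<close>

lemma dyadic_limit:
  fixes w :: "nat \<Rightarrow> complex"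
  assumes d: "\<And>k l. norm (w k - w l) \<le> 2 / 2 ^ k + 2 / 2 ^ l" and n: "\<And>k. \<bar>norm (w k) - 1\<bar> \<le> 2 / 2 ^ k"
  shows "norm (lim w) = 1" and "norm (w k - lim w) \<le> 2 / 2 ^ k"
proof -
  have z: "(\<lambda>k. 2 / 2 ^ k :: real) \<longlonglongrightarrow> 0" by real_asymp
  have "Cauchy w"
  proof (rule CauchyI)
    fix e :: real assume e: "e > 0"
    obtain N where N: "\<And>k. k \<ge> N \<Longrightarrow> 2 / 2 ^ k < e / 2"
      using order_tendstoD(2)[OF z, of "e / 2"] e by (auto simp: eventually_sequentially)
    have "norm (w m - w n) < e" if "m \<ge> N" "n \<ge> N" for m n
      using d[of m n] N[OF that(1)] N[OF that(2)] by linarith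
    then show "\<exists>M. \<forall>m\<ge>M. \<forall>n\<ge>M. norm (w m - w n) < e" by blast
  qed
  then have lim: "w \<longlonglongrightarrow> lim w" by (simp add: Cauchy_convergent_iff convergent_LIMSEQ_iff)
  have "(\<lambda>k. norm (w k) - 1) \<longlonglongrightarrow> 0"
    by (rule Lim_null_comparison[OF _ z]) (use n in auto)
  then have "(\<lambda>k. norm (w k) - 1 + 1) \<longlonglongrightarrow> 0 + 1" by (intro tendsto_add tendsto_const)
  then show "norm (lim w) = 1" using LIMSEQ_unique[OF tendsto_norm[OF lim]] by simp
  have "(\<lambda>l. 2 / 2 ^ k + 2 / 2 ^ l :: real) \<longlonglongrightarrow> 2 / 2 ^ k + 0" by (intro tendsto_add tendsto_const z)
  moreover have "(\<lambda>l. norm (w k - w l)) \<longlonglongrightarrow> norm (w k - lim w)" by (intro tendsto_intros lim)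
  ultimately show "norm (w k - lim w) \<le> 2 / 2 ^ k"
    using d[of k] by (intro LIMSEQ_le[of "\<lambda>l. norm (w k - w l)" _ "\<lambda>l. 2 / 2 ^ k + 2 / 2 ^ l"]) auto
qed

definition circle_functions :: "('g, 'b) monoid_scheme \<Rightarrow> ('g \<Rightarrow> complex) measure" where
  "circle_functions G = PiM (carrier G) (\<lambda>_. restrict_space borel (sphere 0 1))"

text \<open>
  Right translation is a left action: \<open>(gh)\<close> acts as \<open>h\<close> followed by \<open>g\<close>. The evaluation at the neutral
  element satisfies \<open>(right_shift G v x) \<one> = x v\<close>.
\<close>

definition right_shift :: "('g, 'b) monoid_scheme \<Rightarrow> 'g \<Rightarrow> ('g \<Rightarrow> complex) \<Rightarrow> ('g \<Rightarrow> complex)" where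
  "right_shift G h = restrict (\<lambda>x. \<lambda>g\<in>carrier G. x (g \<otimes>\<^bsub>G\<^esub> h)) (space (circle_functions G))"

lemma space_circle_functions: "space (circle_functions G) = carrier G \<rightarrow>\<^sub>E sphere 0 1"
  by (simp add: circle_functions_def space_PiM space_restrict_space)

context group
begin

lemma right_shift_in:
  assumes "h \<in> carrier G" "x \<in> space (circle_functions G)" shows "right_shift G h x \<in> space (circle_functions G)"
  using assms by (auto simp: right_shift_def space_circle_functions PiE_iff)

lemma right_shift_mult:
  assumes "h \<in> carrier G" "k \<in> carrier G" "x \<in> space (circle_functions G)"
  shows "right_shift G (h \<otimes> k) x = right_shift G h (right_shift G k x)"
proof
  fix g
  show "right_shift G (h \<otimes> k) x g = right_shift G h (right_shift G k x) g"
    using right_shift_in[OF assms(2,3)] assms by (auto simp: right_shift_def restrict_def m_assoc)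
qed

lemma right_shift_one: "x \<in> space (circle_functions G) \<Longrightarrow> right_shift G \<one> x = x"
  by (auto simp: right_shift_def space_circle_functions fun_eq_iff restrict_def PiE_def extensional_def)

lemma right_shift_inv:
  assumes "h \<in> carrier G" "x \<in> space (circle_functions G)"
  shows "right_shift G (inv h) (right_shift G h x) = x" "right_shift G h (right_shift G (inv h) x) = x"
  using assms by (simp_all add: right_shift_mult[symmetric] right_shift_one)

lemma right_shift_action: "group_action G (space (circle_functions G)) (right_shift G)"
proof -
  let ?E = "space (circle_functions G)"
  have bij: "right_shift G h \<in> carrier (BijGroup ?E)" if h: "h \<in> carrier G" for h
  proof -
    have "bij_betw (right_shift G h) ?E ?E"
      by (rule bij_betw_byWitness[where f' = "right_shift G (inv h)"])
         (use h right_shift_in right_shift_inv in auto)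
    then show ?thesis by (simp add: BijGroup_def Bij_def right_shift_def)
  qed
  have "right_shift G \<in> hom G (BijGroup ?E)"
  proof (rule homI)
    fix h k assume hk: "h \<in> carrier G" "k \<in> carrier G"
    have "right_shift G (h \<otimes> k) = compose ?E (right_shift G h) (right_shift G k)"
    proof
      fix x show "right_shift G (h \<otimes> k) x = compose ?E (right_shift G h) (right_shift G k) x"
        using right_shift_mult[OF hk] by (cases "x \<in> ?E") (auto simp: compose_def right_shift_def)
    qed
    then show "right_shift G (h \<otimes> k) = right_shift G h \<otimes>\<^bsub>BijGroup ?E\<^esub> right_shift G k"
      using bij hk by (simp add: BijGroup_def)
  qed (rule bij)
  then show ?thesis
    by (intro group_action.intro group_hom.intro group_hom_axioms.intro group_BijGroup is_group)
qed

lemma right_shift_measurable: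
  assumes h: "h \<in> carrier G" shows "right_shift G h \<in> measurable (circle_functions G) (circle_functions G)"
proof -
  have "(\<lambda>x. \<lambda>g\<in>carrier G. x (g \<otimes> h)) \<in> measurable (circle_functions G) (circle_functions G)"
    unfolding circle_functions_def using h by (intro measurable_restrict measurable_component_singleton) auto
  then show ?thesis
    by (rule measurable_cong[THEN iffD1, rotated]) (simp add: right_shift_def)
qed

lemma right_shift_mps:
  assumes M: "prob_space M" "sets M = sets (circle_functions G)"
    and inv: "\<And>h. h \<in> carrier G \<Longrightarrow> distr M M (right_shift G h) = M"
  shows "measure_preserving_system G M (right_shift G)"
proof -
  have sp: "space M = space (circle_functions G)" using M(2) by (rule sets_eq_imp_space_eq)
  have meas: "right_shift G h \<in> measurable M M" if "h \<in> carrier G" for h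
    using right_shift_measurable[OF that] M(2) by (simp cong: measurable_cong_sets)
  have pres: "emeasure M (right_shift G h ` A) = emeasure M A" if h: "h \<in> carrier G" and A: "A \<in> sets M" for h A
  proof -
    have AE: "A \<subseteq> space M" using sets.sets_into_space[OF A] .
    have "right_shift G h ` A = right_shift G (inv h) -` A \<inter> space M"
    proof (intro Set.set_eqI iffI)
      fix x assume "x \<in> right_shift G h ` A"
      then obtain a where a: "a \<in> A" "x = right_shift G h a" by auto
      then have "a \<in> space (circle_functions G)" using AE sp by auto
      then show "x \<in> right_shift G (inv h) -` A \<inter> space M"
        using a h right_shift_in right_shift_inv(1) sp by auto
    next
      fix x assume x: "x \<in> right_shift G (inv h) -` A \<inter> space M"
      then have "x = right_shift G h (right_shift G (inv h) x)" using h right_shift_inv(2) sp by auto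
      then show "x \<in> right_shift G h ` A" using x by auto
    qed
    then have "emeasure M (right_shift G h ` A) = emeasure (distr M M (right_shift G (inv h))) A"
      using h by (simp add: emeasure_distr[OF meas A])
    then show ?thesis using inv[of "inv h"] h by simp
  qed
  have "group_action G (space M) (right_shift G)" using right_shift_action by (simp add: sp)
  then show ?thesis
    using M(1) meas pres
    by (intro measure_preserving_system.intro measure_preserving_system_axioms.intro) auto
qed

end

text \<open>
  A point of the circle at \<open>g\<close>, read off the rounded values \<open>y (g, k)\<close>. The default value \<open>1\<close> is used on a
  null set only.
\<close>

definition circle_coordinate :: "('g \<times> nat \<Rightarrow> complex) \<Rightarrow> 'g \<Rightarrow> complex" where
  "circle_coordinate y g = (let z = lim (\<lambda>k. y (g, k)) in if norm z = 1 then z else 1)"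

context group
begin

lemma left_Folner_subseq:
  assumes F: "left_Folner_seq G F" and r: "strict_mono r" shows "left_Folner_seq G (F \<circ> r)"
proof -
  have "(\<lambda>n. real (card (sym_diff ((F \<circ> r) n) (g <# (F \<circ> r) n))) / real (card ((F \<circ> r) n))) \<longlonglongrightarrow> 0"
    if "g \<in> carrier G" for g
  proof -
    have "(\<lambda>n. real (card (sym_diff (F n) (g <# F n))) / real (card (F n))) \<longlonglongrightarrow> 0"
      using F that by (simp add: left_Folner_seq_def)
    from LIMSEQ_subseq_LIMSEQ[OF this r] show ?thesis by (simp add: comp_def)
  qed
  then show ?thesis using F by (simp add: left_Folner_seq_def)
qed

lemma Folner_average_translate:
  fixes \<phi> :: "'a \<Rightarrow> real"
  assumes F: "left_Folner_seq G F" and h: "h \<in> carrier G" and \<phi>: "\<And>g. g \<in> carrier G \<Longrightarrow> \<bar>\<phi> g\<bar> \<le> 1"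
    and l: "(\<lambda>n. (\<Sum>g\<in>F n. \<phi> g) / card (F n)) \<longlonglongrightarrow> l"
  shows "(\<lambda>n. (\<Sum>g\<in>F n. \<phi> (h \<otimes> g)) / card (F n)) \<longlonglongrightarrow> l"
proof -
  have Fn: "finite (F n)" "F n \<subseteq> carrier G" for n using F by (auto simp: left_Folner_seq_def)
  have "(\<lambda>n. (\<Sum>g\<in>F n. \<phi> (h \<otimes> g)) / card (F n) - (\<Sum>g\<in>F n. \<phi> g) / card (F n)) \<longlonglongrightarrow> 0"
  proof (rule Lim_null_comparison)
    show "(\<lambda>n. real (card (sym_diff (F n) (h <# F n))) / real (card (F n))) \<longlonglongrightarrow> 0"
      using F h by (auto simp: left_Folner_seq_def)
    show "\<forall>\<^sub>F n in sequentially. norm ((\<Sum>g\<in>F n. \<phi> (h \<otimes> g)) / card (F n) - (\<Sum>g\<in>F n. \<phi> g) / card (F n))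
        \<le> real (card (sym_diff (F n) (h <# F n))) / real (card (F n))"
    proof (intro always_eventually allI)
      fix n
      show "norm ((\<Sum>g\<in>F n. \<phi> (h \<otimes> g)) / card (F n) - (\<Sum>g\<in>F n. \<phi> g) / card (F n))
        \<le> real (card (sym_diff (F n) (h <# F n))) / real (card (F n))"
        unfolding diff_divide_distrib[symmetric] real_norm_def abs_divide abs_of_nat
        using sum_translate_le[OF Fn h \<phi>] by (intro divide_right_mono) auto
    qed
  qed
  from tendsto_add[OF this l] show ?thesis by simp
qed

text \<open>
  The index set is \<open>G \<times> nat\<close>: the sample at \<open>u\<close> records, for every \<open>g\<close> and \<open>k\<close>, the value \<open>c (gu)\<close>
  rounded to precision \<open>2 / 2 ^ k\<close>. Limiting pattern frequencies give a measure \<open>\<nu>\<close> on arrays of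
  rounded values, and letting \<open>k\<close> tend to infinity in each array transports \<open>\<nu>\<close> to a measure on circle-valued
  functions. Left invariance of the averages turns into invariance under right translation, since
  translating the array of \<open>u\<close> by \<open>h\<close> yields the array of \<open>hu\<close>. A continuous function of two
  coordinates is uniformly close to the same function of their roundings, which is a cylinder function.
\<close>

proposition Furstenberg_correspondence:
  fixes c :: "'a \<Rightarrow> complex"
  assumes cG: "countable (carrier G)" and Fol: "left_Folner_seq G F" and c: "\<forall>g\<in>carrier G. c g \<in> sphere 0 1"
  shows "\<exists>r (M :: ('a \<Rightarrow> complex) measure) \<tau> f. strict_mono r \<and> measure_preserving_system G M \<tau> \<and>
    f \<in> measurable M (restrict_space borel (sphere 0 1)) \<and>
    (\<forall>v\<in>carrier G. \<forall>H :: complex \<Rightarrow> complex \<Rightarrow> complex. continuous_on UNIV (\<lambda>z. H (fst z) (snd z)) \<longrightarrow>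
      (\<lambda>n. (\<Sum>g\<in>F (r n). H (c (v \<otimes> g)) (c g)) / of_nat (card (F (r n)))) \<longlonglongrightarrow> (\<integral>x. H (f (\<tau> v x)) (f x) \<partial>M))"
proof -
  have c: "c g \<in> sphere 0 1" if "g \<in> carrier G" for g using c that by blast
  define I where "I = carrier G \<times> (UNIV :: nat set)"
  define A where "A i = round_dyadic (snd i) ` sphere 0 1" for i :: "'a \<times> nat"
  define Y where "Y u i = round_dyadic (snd i) (c (fst i \<otimes> u))" for u i
  have Fn: "finite (F n)" "F n \<noteq> {}" "F n \<subseteq> carrier G" for n using Fol by (auto simp: left_Folner_seq_def)
  have "\<exists>r L. strict_mono r \<and> pattern_frequencies I (F \<circ> r) Y A L"
  proof (rule convergent_pattern_frequencies)
    show "countable I" using cG by (simp add: I_def)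
    show "finite (A i)" for i by (simp add: A_def finite_round_dyadic_sphere)
    show "Y u i \<in> A i" if "u \<in> F n" "i \<in> I" for n u i
      using that Fn(3)[of n] c unfolding Y_def A_def I_def by (intro imageI) auto
  qed (use Fn in auto)
  then obtain r L where r: "strict_mono r" and "pattern_frequencies I (F \<circ> r) Y A L" by blast
  interpret pattern_frequencies I "F \<circ> r" Y A L by fact
  have F': "left_Folner_seq G (F \<circ> r)" by (rule left_Folner_subseq[OF Fol r])
  let ?S = "PiM I (\<lambda>_. borel :: complex measure)"
  let ?N = "circle_functions G"
  have coord_m: "(\<lambda>y. y i) \<in> borel_measurable ?S" if "i \<in> I" for i
    using that by (rule measurable_component_singleton)
  have sample_norm: "norm (c (g \<otimes> u)) = 1" if "u \<in> (F \<circ> r) n" "g \<in> carrier G" for u n g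
    using c[of "g \<otimes> u"] that Fn(3)[of "r n"] by auto
  have ae: "AE y in \<nu>. \<forall>k. norm (y (g, k) - circle_coordinate y g) \<le> 2 / 2 ^ k" if g: "g \<in> carrier G" for g
  proof -
    have gI: "(g, k) \<in> I" for k using g by (simp add: I_def)
    have "AE y in \<nu>. norm (y (g, k) - y (g, l)) \<le> 2 / 2 ^ k + 2 / 2 ^ l" for k l
    proof (rule cylinder_AE[where J = "{(g, k), (g, l)}"])
      show "{y\<in>space ?S. norm (y (g, k) - y (g, l)) \<le> 2 / 2 ^ k + 2 / 2 ^ l} \<in> sets ?S"
        using coord_m[OF gI] by (intro borel_measurable_le borel_measurable_norm borel_measurable_diff) auto
      fix n u assume u: "u \<in> (F \<circ> r) n"
      show "norm (restrict (Y u) I (g, k) - restrict (Y u) I (g, l)) \<le> 2 / 2 ^ k + 2 / 2 ^ l"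
        using round_dyadic_dist[of k "c (g \<otimes> u)"] round_dyadic_dist[of l "c (g \<otimes> u)"]
          norm_triangle_ineq4[of "round_dyadic k (c (g \<otimes> u)) - c (g \<otimes> u)" "round_dyadic l (c (g \<otimes> u)) - c (g \<otimes> u)"]
        by (simp add: gI Y_def)
    qed (use gI in auto)
    then have 1: "AE y in \<nu>. \<forall>k l. norm (y (g, k) - y (g, l)) \<le> 2 / 2 ^ k + 2 / 2 ^ l"
      by (simp add: AE_all_countable)
    have "AE y in \<nu>. \<bar>norm (y (g, k)) - 1\<bar> \<le> 2 / 2 ^ k" for k
    proof (rule cylinder_AE[where J = "{(g, k)}"])
      show "{y\<in>space ?S. \<bar>norm (y (g, k)) - 1\<bar> \<le> 2 / 2 ^ k} \<in> sets ?S"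
        using coord_m[OF gI] by (intro borel_measurable_le borel_measurable_abs borel_measurable_diff borel_measurable_norm) auto
      fix n u assume u: "u \<in> (F \<circ> r) n"
      show "\<bar>norm (restrict (Y u) I (g, k)) - 1\<bar> \<le> 2 / 2 ^ k"
        using round_dyadic_dist[of k "c (g \<otimes> u)"] norm_triangle_ineq3[of "round_dyadic k (c (g \<otimes> u))" "c (g \<otimes> u)"]
          sample_norm[OF u g] by (simp add: gI Y_def)
    qed (use gI in auto)
    then have 2: "AE y in \<nu>. \<forall>k. \<bar>norm (y (g, k)) - 1\<bar> \<le> 2 / 2 ^ k"
      by (simp add: AE_all_countable)
    from 1 2 show ?thesis
    proof eventually_elim
      case (elim y)
      then show ?case
        using dyadic_limit[of "\<lambda>k. y (g, k)"] by (simp add: circle_coordinate_def Let_def)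
    qed
  qed
  have cc_m: "(\<lambda>y. circle_coordinate y g) \<in> borel_measurable ?S" if g: "g \<in> carrier G" for g
  proof -
    have "(\<lambda>y. lim (\<lambda>k. y (g, k))) \<in> borel_measurable ?S"
      using g by (intro borel_measurable_lim_metric coord_m) (simp add: I_def)
    then show ?thesis
      unfolding circle_coordinate_def Let_def
      by (intro measurable_If borel_measurable_const) (auto intro!: borel_measurable_eq borel_measurable_norm)
  qed
  have cc_s: "circle_coordinate y g \<in> sphere 0 1" for y :: "'a \<times> nat \<Rightarrow> complex" and g
    by (auto simp: circle_coordinate_def Let_def)
  define decode where "decode y = (\<lambda>g\<in>carrier G. circle_coordinate y g)" for y :: "'a \<times> nat \<Rightarrow> complex"
  have decodem: "decode \<in> measurable ?S ?N"
    unfolding decode_def circle_functions_def using cc_m cc_s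
    by (intro measurable_restrict measurable_restrict_space2) auto
  have decodem': "decode \<in> measurable \<nu> ?N" using decodem by (simp cong: measurable_cong_sets)
  define M where "M = distr \<nu> ?N decode"
  have M: "prob_space M" "sets M = sets ?N"
    unfolding M_def using decodem' by (auto intro: proj.P.prob_space_distr)

  \<comment> \<open>Right translation of arrays.\<close>
  define \<sigma> where "\<sigma> h y = (\<lambda>i\<in>I. y (fst i \<otimes> h, snd i))" for h and y :: "'a \<times> nat \<Rightarrow> complex"
  have \<sigma>m: "\<sigma> h \<in> measurable ?S ?S" if "h \<in> carrier G" for h
    unfolding \<sigma>_def using that by (intro measurable_restrict coord_m) (auto simp: I_def)
  have \<sigma>m': "\<sigma> h \<in> measurable \<nu> \<nu>" if "h \<in> carrier G" for h
    using \<sigma>m[OF that] by (simp cong: measurable_cong_sets)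
  have \<sigma>inv: "distr \<nu> \<nu> (\<sigma> h) = \<nu>" if h: "h \<in> carrier G" for h
  proof (rule measure_eqI_PiM_infinite[where I = I and M = "\<lambda>_. borel"])
    have "prob_space (distr \<nu> \<nu> (\<sigma> h))" by (rule proj.P.prob_space_distr[OF \<sigma>m'[OF h]])
    then show "finite_measure (distr \<nu> \<nu> (\<sigma> h))" by (rule prob_space.finite_measure)
    fix B J assume J: "finite J" "J \<subseteq> I" and B: "\<And>i. i \<in> J \<Longrightarrow> B i \<in> sets (borel :: complex measure)"
    define C where "C = prod_emb I (\<lambda>_. borel) J (PiE J B)"
    have C: "C \<in> sets ?S" unfolding C_def using J B by (intro sets_PiM_I) auto
    have CI: "y \<in> C \<longleftrightarrow> y \<in> extensional I \<and> (\<forall>i\<in>J. y i \<in> B i)" for y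
      using J(2) by (auto simp: C_def prod_emb_def PiE_iff space_PiM subset_iff)
    define \<psi> :: "('a \<times> nat \<Rightarrow> complex) \<Rightarrow> real" where "\<psi> = indicator C"
    have \<psi>m: "\<psi> \<in> borel_measurable ?S" using C by (simp add: \<psi>_def)
    have l1: "(\<lambda>n. sample_average n \<psi>) \<longlonglongrightarrow> (\<integral>y. \<psi> y \<partial>\<nu>)"
      by (rule cylinder_average[OF J \<psi>m]) (auto simp: \<psi>_def indicator_def CI)
    define J' where "J' = (\<lambda>i. (fst i \<otimes> h, snd i)) ` J"
    have J': "finite J'" "J' \<subseteq> I" using J h by (auto simp: J'_def I_def subset_iff)
    have "(\<lambda>n. (\<Sum>u\<in>(F \<circ> r) n. \<psi> (\<sigma> h (restrict (Y u) I))) / of_nat (card ((F \<circ> r) n))) \<longlonglongrightarrow> (\<integral>y. \<psi> (\<sigma> h y) \<partial>\<nu>)"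
    proof (rule cylinder_average[OF J' measurable_compose[OF \<sigma>m[OF h] \<psi>m]])
      fix y y' :: "'a \<times> nat \<Rightarrow> complex" assume "\<And>i. i \<in> J' \<Longrightarrow> y i = y' i"
      then show "\<psi> (\<sigma> h y) = \<psi> (\<sigma> h y')"
        using J(2) by (auto simp: \<psi>_def indicator_def CI \<sigma>_def J'_def subset_iff)
    qed
    moreover have "\<sigma> h (restrict (Y u) I) = restrict (Y (h \<otimes> u)) I" if "u \<in> (F \<circ> r) n" for u n
      using that Fn(3)[of "r n"] h by (auto simp: \<sigma>_def Y_def I_def fun_eq_iff m_assoc)
    ultimately have l2: "(\<lambda>n. (\<Sum>u\<in>(F \<circ> r) n. \<psi> (restrict (Y (h \<otimes> u)) I)) / of_nat (card ((F \<circ> r) n))) \<longlonglongrightarrow> (\<integral>y. \<psi> (\<sigma> h y) \<partial>\<nu>)"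
      by (simp cong: sum.cong)
    have "(\<lambda>n. (\<Sum>u\<in>(F \<circ> r) n. \<psi> (restrict (Y (h \<otimes> u)) I)) / of_nat (card ((F \<circ> r) n))) \<longlonglongrightarrow> (\<integral>y. \<psi> y \<partial>\<nu>)"
      by (rule Folner_average_translate[OF F' h _ l1]) (simp add: \<psi>_def)
    with l2 have "(\<integral>y. \<psi> (\<sigma> h y) \<partial>\<nu>) = (\<integral>y. \<psi> y \<partial>\<nu>)" using LIMSEQ_unique by blast
    moreover have "(\<integral>y. \<psi> (\<sigma> h y) \<partial>\<nu>) = (\<integral>y. \<psi> y \<partial>distr \<nu> \<nu> (\<sigma> h))"
      using \<psi>m by (intro integral_distr[symmetric] \<sigma>m' h) (simp cong: measurable_cong_sets)
    ultimately have "measure (distr \<nu> \<nu> (\<sigma> h)) C = measure \<nu> C"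
      using C by (simp add: \<psi>_def Int_absorb2 sets.sets_into_space)
    then show "emeasure (distr \<nu> \<nu> (\<sigma> h)) (prod_emb I (\<lambda>_. borel) J (PiE J B)) = emeasure \<nu> (prod_emb I (\<lambda>_. borel) J (PiE J B))"
      using finite_measure.emeasure_eq_measure[OF prob_space.finite_measure[OF \<open>prob_space (distr \<nu> \<nu> (\<sigma> h))\<close>], of C]
      by (simp add: C_def[symmetric] proj.P.emeasure_eq_measure)
  qed auto
  have equiv: "right_shift G h (decode y) = decode (\<sigma> h y)" if h: "h \<in> carrier G" for h y
  proof -
    have "decode y \<in> space ?N" using cc_s by (auto simp: decode_def space_circle_functions)
    then show ?thesis
      using h by (auto simp: right_shift_def decode_def \<sigma>_def circle_coordinate_def I_def fun_eq_iff)
  qed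
  have Minv: "distr M M (right_shift G h) = M" if h: "h \<in> carrier G" for h
  proof -
    have rs: "right_shift G h \<in> measurable ?N ?N" by (rule right_shift_measurable[OF h])
    have "distr M M (right_shift G h) = distr M ?N (right_shift G h)"
      using M(2) by (intro distr_cong) auto
    also have "\<dots> = distr \<nu> ?N (right_shift G h \<circ> decode)" unfolding M_def by (rule distr_distr[OF rs decodem'])
    also have "right_shift G h \<circ> decode = decode \<circ> \<sigma> h" using equiv[OF h] by auto
    also have "distr \<nu> ?N (decode \<circ> \<sigma> h) = distr (distr \<nu> \<nu> (\<sigma> h)) ?N decode" by (rule distr_distr[OF decodem' \<sigma>m'[OF h], symmetric])
    finally show ?thesis by (simp add: \<sigma>inv[OF h] M_def)
  qed
  have mps: "measure_preserving_system G M (right_shift G)" by (rule right_shift_mps[OF M Minv])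
  define f where "f x = x \<one>" for x :: "'a \<Rightarrow> complex"
  have f: "f \<in> measurable ?N (restrict_space borel (sphere 0 1))"
    unfolding f_def circle_functions_def by (rule measurable_component_singleton) simp
  have fM: "f \<in> measurable M (restrict_space borel (sphere 0 1))" using f M(2) by (simp cong: measurable_cong_sets)

  have lim: "(\<lambda>n. (\<Sum>g\<in>F (r n). H (c (v \<otimes> g)) (c g)) / of_nat (card (F (r n)))) \<longlonglongrightarrow> (\<integral>x. H (f (right_shift G v x)) (f x) \<partial>M)"
    if v: "v \<in> carrier G" and H: "continuous_on UNIV (\<lambda>z. H (fst z) (snd z))" for v and H :: "complex \<Rightarrow> complex \<Rightarrow> complex"
  proof (rule LIMSEQ_I)
    fix e :: real assume e: "e > 0"
    let ?B = "cball (0::complex) 3"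
    have "uniformly_continuous_on (?B \<times> ?B) (\<lambda>z. H (fst z) (snd z))"
      by (intro compact_uniformly_continuous continuous_on_subset[OF H] compact_Times) auto
    then obtain d where d: "d > 0" "\<And>z z'. z \<in> ?B \<times> ?B \<Longrightarrow> z' \<in> ?B \<times> ?B \<Longrightarrow> dist z' z < d \<Longrightarrow>
        dist (H (fst z') (snd z')) (H (fst z) (snd z)) < e / 4"
      unfolding uniformly_continuous_on_def using e by (metis zero_less_divide_iff zero_less_numeral)
    have "(\<lambda>k::nat. 4 / 2 ^ k :: real) \<longlonglongrightarrow> 0" by real_asymp
    \<comment> \<open>A precision at which rounding both arguments changes \<open>H\<close> by at most \<open>e / 4\<close>.\<close>
    then obtain k :: nat where k: "4 / 2 ^ k < d" using order_tendstoD(2)[of _ 0 _ d] d(1) by (force simp: eventually_sequentially)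
    have k2: "2 / 2 ^ k \<le> (2 :: real)" by (simp add: divide_le_eq)
    have close: "norm (H a' b' - H a b) \<le> e / 4"
      if "norm a = 1" "norm b = 1" "norm (a' - a) \<le> 2 / 2 ^ k" "norm (b' - b) \<le> 2 / 2 ^ k" for a b a' b'
    proof -
      have "norm a' \<le> 3" "norm b' \<le> 3"
        using that k2 norm_triangle_sub[of a' a] norm_triangle_sub[of b' b] by linarith+
      moreover have "dist (a', b') (a, b) < d"
      proof -
        have "dist (a', b') (a, b) \<le> dist a' a + dist b' b" by (simp add: dist_Pair_Pair sqrt_sum_squares_le_sum)
        also have "\<dots> \<le> 4 / 2 ^ k" using that by (simp add: dist_norm)
        finally show ?thesis using k by linarith
      qed
      ultimately show ?thesis using d(2)[of "(a, b)" "(a', b')"] that by (auto simp: dist_norm intro: less_imp_le)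
    qed
    have vI: "(v, k) \<in> I" "(\<one>, k) \<in> I" using v by (auto simp: I_def)
    define \<psi> where "\<psi> y = H (y (v, k)) (y (\<one>, k))" for y :: "'a \<times> nat \<Rightarrow> complex"
    have \<psi>m: "\<psi> \<in> borel_measurable ?S"
      unfolding \<psi>_def by (rule borel_measurable_continuous_Pair[OF coord_m[OF vI(1)] coord_m[OF vI(2)] H])
    have "(\<lambda>n. sample_average n \<psi>) \<longlonglongrightarrow> (\<integral>y. \<psi> y \<partial>\<nu>)"
    proof (rule cylinder_average[OF _ _ \<psi>m])
      show "finite {(v, k), (\<one>, k)}" "{(v, k), (\<one>, k)} \<subseteq> I" using vI by auto
    qed (simp add: \<psi>_def)
    from LIMSEQ_D[OF this, of "e / 4"] e obtain N where
      N: "\<And>n. n \<ge> N \<Longrightarrow> norm (sample_average n \<psi> - (\<integral>y. \<psi> y \<partial>\<nu>)) < e / 4"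
      by auto
    define h where "h y = H (circle_coordinate y v) (circle_coordinate y \<one>)" for y :: "'a \<times> nat \<Rightarrow> complex"
    have hm: "h \<in> borel_measurable ?S"
      unfolding h_def by (rule borel_measurable_continuous_Pair[OF cc_m[OF v] cc_m[OF one_closed] H])
    have "(\<integral>x. H (f (right_shift G v x)) (f x) \<partial>M) = (\<integral>y. H (f (right_shift G v (decode y))) (f (decode y)) \<partial>\<nu>)"
      unfolding M_def
    proof (rule integral_distr[OF decodem'])
      have fb: "f \<in> borel_measurable ?N" using f by (simp add: measurable_restrict_space2_iff)
      show "(\<lambda>x. H (f (right_shift G v x)) (f x)) \<in> borel_measurable ?N"
        by (rule borel_measurable_continuous_Pair[OF measurable_compose[OF right_shift_measurable[OF v] fb] fb H])
    qed
    also have "\<dots> = (\<integral>y. h y \<partial>\<nu>)"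
    proof (rule Bochner_Integration.integral_cong[OF refl])
      fix y
      have "decode y \<in> space ?N" using cc_s by (auto simp: decode_def space_circle_functions)
      then show "H (f (right_shift G v (decode y))) (f (decode y)) = h y"
        using v by (simp add: h_def f_def right_shift_def decode_def)
    qed
    finally have Ih: "(\<integral>x. H (f (right_shift G v x)) (f x) \<partial>M) = (\<integral>y. h y \<partial>\<nu>)" .
    have cl: "AE y in \<nu>. norm (\<psi> y - h y) \<le> e / 4"
      using ae[OF v] ae[OF one_closed]
    proof eventually_elim
      case (elim y)
      then show ?case unfolding \<psi>_def h_def using cc_s[of y v] cc_s[of y \<one>] by (intro close) auto
    qed
    obtain b where b: "\<And>y. norm (h y) \<le> b"
    proof -
      have "compact ((\<lambda>z. H (fst z) (snd z)) ` (?B \<times> ?B))"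
        by (intro compact_continuous_image continuous_on_subset[OF H] compact_Times) auto
      from compact_imp_bounded[OF this] obtain b where
        b: "\<forall>x\<in>(\<lambda>z. H (fst z) (snd z)) ` (?B \<times> ?B). norm x \<le> b"
        unfolding bounded_iff by (rule exE)
      have "norm (h y) \<le> b" for y
      proof -
        have "(circle_coordinate y v, circle_coordinate y \<one>) \<in> ?B \<times> ?B"
          using cc_s[of y v] cc_s[of y \<one>] by simp
        from bspec[OF b imageI[OF this]] show ?thesis by (simp add: h_def)
      qed
      then show ?thesis by (rule that)
    qed
    have hi: "integrable \<nu> h"
      using hm b by (intro proj.P.integrable_const_bound[where B = b]) (auto cong: measurable_cong_sets)
    have \<psi>i: "integrable \<nu> \<psi>"
    proof (rule proj.P.integrable_const_bound[where B = "b + e / 4"])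
      show "AE y in \<nu>. norm (\<psi> y) \<le> b + e / 4"
        using cl
      proof eventually_elim
        case (elim y)
        then show ?case using norm_triangle_sub[of "\<psi> y" "h y"] b[of y] by linarith
      qed
    qed (use \<psi>m in \<open>simp cong: measurable_cong_sets\<close>)
    have close_int: "norm ((\<integral>y. \<psi> y \<partial>\<nu>) - (\<integral>y. h y \<partial>\<nu>)) \<le> e / 4"
    proof -
      have "norm ((\<integral>y. \<psi> y \<partial>\<nu>) - (\<integral>y. h y \<partial>\<nu>)) = norm (\<integral>y. \<psi> y - h y \<partial>\<nu>)" using hi \<psi>i by simp
      also have "\<dots> \<le> (\<integral>y. norm (\<psi> y - h y) \<partial>\<nu>)" by (rule integral_norm_bound)
      also have "\<dots> \<le> (\<integral>y. e / 4 \<partial>\<nu>)" using hi \<psi>i cl by (intro integral_mono_AE) auto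
      finally show ?thesis using proj.P.prob_space by simp
    qed
    have close_avg: "norm ((\<Sum>g\<in>F (r n). H (c (v \<otimes> g)) (c g)) / of_nat (card (F (r n)))
        - sample_average n \<psi>) \<le> e / 4" for n
    proof -
      have cF: "real (card (F (r n))) > 0" using Fn[of "r n"] by (simp add: card_gt_0_iff)
      have "norm (\<Sum>g\<in>F (r n). H (c (v \<otimes> g)) (c g) - \<psi> (restrict (Y g) I)) \<le> (\<Sum>g\<in>F (r n). e / 4)"
      proof (rule sum_norm_le)
        fix g assume g: "g \<in> F (r n)"
        then have gc: "g \<in> carrier G" using Fn by auto
        have eq: "\<psi> (restrict (Y g) I) = H (round_dyadic k (c (v \<otimes> g))) (round_dyadic k (c g))"
          using vI gc by (simp add: \<psi>_def Y_def)
        have "norm (c (v \<otimes> g)) = 1" "norm (c g) = 1" using c[of "v \<otimes> g"] c[of g] gc v by auto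
        then have "norm (\<psi> (restrict (Y g) I) - H (c (v \<otimes> g)) (c g)) \<le> e / 4"
          unfolding eq by (rule close[OF _ _ round_dyadic_dist round_dyadic_dist])
        then show "norm (H (c (v \<otimes> g)) (c g) - \<psi> (restrict (Y g) I)) \<le> e / 4" by (simp add: norm_minus_commute)
      qed
      then have "norm ((\<Sum>g\<in>F (r n). H (c (v \<otimes> g)) (c g) - \<psi> (restrict (Y g) I)) / of_nat (card (F (r n)))) \<le> e / 4"
        using cF by (simp add: norm_divide divide_le_eq mult.commute)
      then show ?thesis by (simp add: sum_subtractf diff_divide_distrib)
    qed
    show "\<exists>no. \<forall>n\<ge>no. norm ((\<Sum>g\<in>F (r n). H (c (v \<otimes> g)) (c g)) / of_nat (card (F (r n))) - (\<integral>x. H (f (right_shift G v x)) (f x) \<partial>M)) < e"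
    proof (intro exI[of _ N] allI impI)
      fix n assume "n \<ge> N"
      let ?a = "(\<Sum>g\<in>F (r n). H (c (v \<otimes> g)) (c g)) / of_nat (card (F (r n)))"
      let ?b = "sample_average n \<psi>"
      have "norm (?a - (\<integral>y. h y \<partial>\<nu>)) \<le> norm (?a - ?b) + norm (?b - (\<integral>y. \<psi> y \<partial>\<nu>)) + norm ((\<integral>y. \<psi> y \<partial>\<nu>) - (\<integral>y. h y \<partial>\<nu>))"
        using norm_triangle_ineq[of "?a - ?b" "?b - (\<integral>y. h y \<partial>\<nu>)"] norm_triangle_ineq[of "?b - (\<integral>y. \<psi> y \<partial>\<nu>)" "(\<integral>y. \<psi> y \<partial>\<nu>) - (\<integral>y. h y \<partial>\<nu>)"] by simp
      then show "norm (?a - (\<integral>x. H (f (right_shift G v x)) (f x) \<partial>M)) < e"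
        unfolding Ih using close_avg[of n] N[OF \<open>n \<ge> N\<close>] close_int e by linarith
    qed
  qed
  show ?thesis
    by (rule exI[of _ r], rule exI[of _ M], rule exI[of _ "right_shift G"], rule exI[of _ f],
        intro conjI ballI allI impI r mps fM lim)
qed

end

section \<open>The characterisation of vdC sets\<close>

text \<open>
  If the averages of \<open>c\<close> do not tend to \<open>0\<close>, they stay away from \<open>0\<close> along a subsequence, which is again left
  Folner; the system attached to it has the correlations of \<open>c\<close>, hence mean \<open>0\<close>, a contradiction.
\<close>

lemma mps_vdC_condition_imp_vdC_set:
  fixes G :: "('g, 'b) monoid_scheme"
  assumes G: "group G" "countable (carrier G)" and F: "left_Folner_seq G F" and V: "V \<subseteq> carrier G"
    and mps: "mps_vdC_condition TYPE('g \<Rightarrow> complex) G V"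
  shows "vdC_set G F V"
  unfolding vdC_set_def
proof (intro conjI V allI impI)
  interpret group G by fact
  fix c :: "'g \<Rightarrow> complex"
  assume c: "\<forall>g\<in>carrier G. c g \<in> sphere 0 1"
    and corr: "\<forall>v\<in>V. (\<lambda>n. (\<Sum>g\<in>F n. c (v \<otimes>\<^bsub>G\<^esub> g) * cnj (c g)) / of_nat (card (F n))) \<longlonglongrightarrow> 0"
  define a where "a n = (\<Sum>g\<in>F n. c g) / of_nat (card (F n))" for n
  have "a \<longlonglongrightarrow> 0"
  proof (rule ccontr)
    assume "\<not> a \<longlonglongrightarrow> 0"
    then obtain e where e: "e > 0" "\<not> (\<forall>\<^sub>F n in sequentially. dist (a n) 0 < e)"
      by (auto simp: tendsto_iff)
    then have "\<exists>\<^sub>\<infinity>n. e \<le> norm (a n)"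
      by (simp add: frequently_cofinite[symmetric] cofinite_eq_sequentially not_eventually not_less)
    then have inf: "infinite {n. e \<le> norm (a n)}" by (simp add: frequently_cofinite)
    define s where "s = enumerate {n. e \<le> norm (a n)}"
    have s: "strict_mono s" "\<And>n. e \<le> norm (a (s n))"
      using strict_mono_enumerate[OF inf] enumerate_in_set[OF inf] by (auto simp: s_def)
    have Fs: "left_Folner_seq G (F \<circ> s)" by (rule left_Folner_subseq[OF F s(1)])
    obtain r M \<tau> f where r: "strict_mono r" and sys: "measure_preserving_system G (M :: ('g \<Rightarrow> complex) measure) \<tau>"
      and f: "f \<in> measurable M (restrict_space borel (sphere 0 1))"
      and lim: "\<forall>v\<in>carrier G. \<forall>H :: complex \<Rightarrow> complex \<Rightarrow> complex. continuous_on UNIV (\<lambda>z. H (fst z) (snd z)) \<longrightarrow>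
        (\<lambda>n. (\<Sum>g\<in>(F \<circ> s) (r n). H (c (v \<otimes>\<^bsub>G\<^esub> g)) (c g)) / of_nat (card ((F \<circ> s) (r n)))) \<longlonglongrightarrow> (\<integral>x. H (f (\<tau> v x)) (f x) \<partial>M)"
      using Furstenberg_correspondence[OF G(2) Fs c] by (elim exE conjE) (rule that)
    note lim = lim[rule_format]
    have sr: "strict_mono (s \<circ> r)" by (rule strict_mono_o[OF s(1) r])
    have "L2_inner M (f \<circ> \<tau> v) f = 0" if v: "v \<in> V" for v
    proof -
      have 1: "(\<lambda>n. (\<Sum>g\<in>(F \<circ> s) (r n). c (v \<otimes>\<^bsub>G\<^esub> g) * cnj (c g)) / of_nat (card ((F \<circ> s) (r n)))) \<longlonglongrightarrow> (\<integral>x. f (\<tau> v x) * cnj (f x) \<partial>M)"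
        using v V by (intro lim[of v "\<lambda>z w. z * cnj w"] continuous_intros) auto
      have "(\<lambda>n. (\<Sum>g\<in>F n. c (v \<otimes>\<^bsub>G\<^esub> g) * cnj (c g)) / of_nat (card (F n))) \<longlonglongrightarrow> 0" using corr v by blast
      from LIMSEQ_subseq_LIMSEQ[OF this sr]
      have 2: "(\<lambda>n. (\<Sum>g\<in>(F \<circ> s) (r n). c (v \<otimes>\<^bsub>G\<^esub> g) * cnj (c g)) / of_nat (card ((F \<circ> s) (r n)))) \<longlonglongrightarrow> 0"
        by (simp add: comp_def)
      show ?thesis using LIMSEQ_unique[OF 1 2] by (simp add: L2_inner_def)
    qed
    then have If: "(\<integral>x. f x \<partial>M) = 0" using mps sys f unfolding mps_vdC_condition_def by blast
    have "(\<lambda>n. (\<Sum>g\<in>(F \<circ> s) (r n). c g) / of_nat (card ((F \<circ> s) (r n)))) \<longlonglongrightarrow> (\<integral>x. f x \<partial>M)"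
      by (rule lim[OF one_closed, of "\<lambda>_ w. w"]) (intro continuous_intros)
    then have "(\<lambda>n. norm (a (s (r n)))) \<longlonglongrightarrow> 0"
      unfolding If by (simp add: a_def tendsto_norm_zero)
    then have "e \<le> 0" using s(2) by (intro LIMSEQ_le_const[of _ 0]) auto
    then show False using e by simp
  qed
  then show "(\<lambda>n. (\<Sum>g\<in>F n. c g) / of_nat (card (F n))) \<longlonglongrightarrow> 0" by (simp add: a_def[abs_def])
qed

theorem theorem1p1:
  fixes G :: "('g, 'b) monoid_scheme" and F :: "nat \<Rightarrow> 'g set" and V :: "'g set"
  assumes "group G"
    and "countable (carrier G)" and "infinite (carrier G)"
    and "amenable G"
    and "left_Folner_seq G F"
    and "V \<subseteq> carrier G"
  shows "(vdC_set G F V \<longleftrightarrow> mps_vdC_condition TYPE('g \<Rightarrow> complex) G V) \<and>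
         (vdC_set G F V \<longrightarrow> mps_vdC_condition TYPE('x) G V)"
proof (intro conjI iffI impI)
  assume vdC: "vdC_set G F V"
  show "mps_vdC_condition TYPE('g \<Rightarrow> complex) G V" "mps_vdC_condition TYPE('x) G V"
    by (rule vdC_set_imp_mps_vdC_condition[OF assms(2,3,5,6) vdC])+
next
  assume "mps_vdC_condition TYPE('g \<Rightarrow> complex) G V"
  then show "vdC_set G F V"
    by (rule mps_vdC_condition_imp_vdC_set[OF assms(1,2,5,6)])
qed

end
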